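(* Let $\mathcal{B}$ be a von Neumann subalgebra of a finite von Neumann algebra $\mathcal{A}$, with the trace on $\mathcal{B}$ being the restriction of the trace on $\mathcal{A}$. The induction $i_*$, $i_*(M)=\mathcal{A}\otimes_{\mathcal{B}}M$, is a faithfully flat functor from the category of $\mathcal{B}$-modules to the category of $\mathcal{A}$-modules. If $M$ is a $\mathcal{B}$-module, then $\dim_{\mathcal{B}}(M)=\dim_{\mathcal{A}}(i_*(M))$.
   Context: A von Neumann algebra $\mathcal{A}\subseteq\mathcal{B}(H)$ is finite if it has a normal faithful trace $\mathrm{tr}_{\mathcal{A}}$; such a trace is fixed and extended to square matrices by summing the diagonal traces. A von Neumann subalgebra of $\mathcal{A}$ is a $C^*$-subalgebra $\mathcal{B}$ with $\mathcal{B}''=\mathcal{B}$, commutants computed in $\mathcal{B}(H)$; the trace used on $\mathcal{B}$ is $\mathrm{tr}_{\mathcal{B}}=\mathrm{tr}_{\mathcal{A}}|_{\mathcal{B}}$. Modules are left modules. Dimension (for $\mathcal{A}$, and likewise for $\mathcal{B}$): if $P$ is a finitely generated projective $\mathcal{A}$-module, choose $n$ and $f:\mathcal{A}^n\to\mathcal{A}^n$ with $f=f^2=f^*$ and image (isomorphic to) $P$, and put $\dim_{\mathcal{A}}(P)=\mathrm{tr}_{\mathcal{A}}(f)$; for any $\mathcal{A}$-module $M$, $\dim_{\mathcal{A}}(M)=\sup\{\dim_{\mathcal{A}}(P): P\text{ a finitely generated projective submodule of }M\}$. Faithfully flat functor means: exact and faithful. *)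

theory Defs
  imports
    "HOL-Analysis.Analysis"
    "HOL-Library.Nonpos_Ints"
    "HOL-Algebra.Module"
    "HOL-Algebra.AbelCoset"
    "HOL-Algebra.Generated_Groups"
    "HOL-Algebra.Free_Abelian_Groups"
begin

section \<open>Complex Hilbert spaces and their bounded operators\<close>

text \<open>The inner product is linear in the first argument. Class \<^class>\<open>banach\<close> supplies the norm
  and completeness.\<close>

class complex_hilbert = banach +
  fixes scaleC :: "complex \<Rightarrow> 'a \<Rightarrow> 'a"
    and cinner :: "'a \<Rightarrow> 'a \<Rightarrow> complex"
  assumes scaleC_add_right: "scaleC c (x + y) = scaleC c x + scaleC c y"
    and scaleC_add_left: "scaleC (c + d) x = scaleC c x + scaleC d x"
    and scaleC_scaleC: "scaleC c (scaleC d x) = scaleC (c * d) x"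
    and scaleC_one: "scaleC 1 x = x"
    and scaleR_scaleC: "scaleR r x = scaleC (of_real r) x"
    and cinner_add_left: "cinner (x + y) z = cinner x z + cinner y z"
    and cinner_scaleC_left: "cinner (scaleC c x) y = c * cinner x y"
    and cinner_commute: "cinner x y = cnj (cinner y x)"
    and cinner_self: "cinner x x = of_real ((norm x)\<^sup>2)"

text \<open>The library type of bounded \<^emph>\<open>real\<close>-linear operators; complex linearity is imposed in
  \<open>bounded_ops\<close>. Its norm is the operator norm.\<close>

type_synonym 'h oper = "'h \<Rightarrow>\<^sub>L 'h"

definition bounded_ops :: "'h::complex_hilbert oper set" where
  "bounded_ops = {T. \<forall>c x. blinfun_apply T (scaleC c x) = scaleC c (blinfun_apply T x)}"

definition op_scaleC :: "complex \<Rightarrow> 'h::complex_hilbert oper \<Rightarrow> 'h oper" where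
  "op_scaleC c T = Blinfun (\<lambda>x. scaleC c (blinfun_apply T x))"

definition op_adj :: "'h::complex_hilbert oper \<Rightarrow> 'h oper" where
  "op_adj T = (THE S. \<forall>x y. cinner (blinfun_apply T x) y = cinner x (blinfun_apply S y))"

definition op_pos :: "'h::complex_hilbert oper \<Rightarrow> bool" where
  "op_pos T \<longleftrightarrow> (\<forall>x. cinner (blinfun_apply T x) x \<in> \<real>\<^sub>\<ge>\<^sub>0)"

definition op_le :: "'h::complex_hilbert oper \<Rightarrow> 'h oper \<Rightarrow> bool" where
  "op_le S T \<longleftrightarrow> op_pos (T - S)"

definition commutant :: "'h::complex_hilbert oper set \<Rightarrow> 'h oper set" where
  "commutant X = {T \<in> bounded_ops. \<forall>S\<in>X. T o\<^sub>L S = S o\<^sub>L T}"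


section \<open>Von Neumann algebras and traces\<close>

definition cstar_algebra :: "'h::complex_hilbert oper set \<Rightarrow> bool" where
  "cstar_algebra A \<longleftrightarrow>
     A \<subseteq> bounded_ops \<and> closed A \<and> 0 \<in> A \<and>
     (\<forall>S\<in>A. \<forall>T\<in>A. S + T \<in> A \<and> S o\<^sub>L T \<in> A) \<and>
     (\<forall>c. \<forall>T\<in>A. op_scaleC c T \<in> A) \<and>
     (\<forall>T\<in>A. op_adj T \<in> A)"

text \<open>The bicommutant condition forces the identity operator to be in the algebra.\<close>

definition von_neumann_algebra :: "'h::complex_hilbert oper set \<Rightarrow> bool" where
  "von_neumann_algebra A \<longleftrightarrow> cstar_algebra A \<and> commutant (commutant A) = A"

definition von_neumann_subalgebra :: "'h::complex_hilbert oper set \<Rightarrow> 'h oper set \<Rightarrow> bool" where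
  "von_neumann_subalgebra B A \<longleftrightarrow> B \<subseteq> A \<and> cstar_algebra B \<and> commutant (commutant B) = B"

definition is_trace :: "'h::complex_hilbert oper set \<Rightarrow> ('h oper \<Rightarrow> complex) \<Rightarrow> bool" where
  "is_trace A tr \<longleftrightarrow>
     (\<forall>S\<in>A. \<forall>T\<in>A. tr (S + T) = tr S + tr T) \<and>
     (\<forall>c. \<forall>T\<in>A. tr (op_scaleC c T) = c * tr T) \<and>
     (\<forall>S\<in>A. \<forall>T\<in>A. tr (S o\<^sub>L T) = tr (T o\<^sub>L S)) \<and>
     (\<forall>T\<in>A. tr (op_adj T o\<^sub>L T) \<in> \<real>\<^sub>\<ge>\<^sub>0)"

definition faithful_trace :: "'h::complex_hilbert oper set \<Rightarrow> ('h oper \<Rightarrow> complex) \<Rightarrow> bool" where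
  "faithful_trace A tr \<longleftrightarrow> (\<forall>T\<in>A. tr (op_adj T o\<^sub>L T) = 0 \<longrightarrow> T = 0)"

text \<open>Normality: the trace preserves suprema of upward directed sets of positive elements of
  the algebra that have a supremum in it.\<close>

definition normal_trace :: "'h::complex_hilbert oper set \<Rightarrow> ('h oper \<Rightarrow> complex) \<Rightarrow> bool" where
  "normal_trace A tr \<longleftrightarrow>
     (\<forall>D s. D \<noteq> {} \<and> D \<subseteq> A \<and> (\<forall>S\<in>D. op_pos S) \<and>
        (\<forall>S\<in>D. \<forall>T\<in>D. \<exists>U\<in>D. op_le S U \<and> op_le T U) \<and>
        s \<in> A \<and> (\<forall>S\<in>D. op_le S s) \<and>
        (\<forall>t\<in>A. (\<forall>S\<in>D. op_le S t) \<longrightarrow> op_le s t)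
        \<longrightarrow> Re (tr s) = (SUP S\<in>D. Re (tr S)))"

definition normal_faithful_trace ::
    "'h::complex_hilbert oper set \<Rightarrow> ('h oper \<Rightarrow> complex) \<Rightarrow> bool" where
  "normal_faithful_trace A tr \<longleftrightarrow> is_trace A tr \<and> normal_trace A tr \<and> faithful_trace A tr"

definition op_ring :: "'h::complex_hilbert oper set \<Rightarrow> 'h oper ring" where
  "op_ring A = \<lparr>carrier = A, monoid.mult = (o\<^sub>L), one = id_blinfun, ring.zero = 0, ring.add = (+)\<rparr>"


section \<open>Left modules over a not necessarily commutative ring\<close>

text \<open>The library locale \<^locale>\<open>module\<close> requires a commutative ring. The record is reused; its
  multiplicative fields are irrelevant for modules.\<close>

locale left_module = R?: ring R + M?: abelian_group M
    for R :: "('a, 'r) ring_scheme" (structure) and M :: "('a, 'b) module" (structure) +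
  assumes smult_closed:
      "\<lbrakk>a \<in> carrier R; x \<in> carrier M\<rbrakk> \<Longrightarrow> a \<odot>\<^bsub>M\<^esub> x \<in> carrier M"
    and smult_l_distr:
      "\<lbrakk>a \<in> carrier R; b \<in> carrier R; x \<in> carrier M\<rbrakk> \<Longrightarrow>
       (a \<oplus>\<^bsub>R\<^esub> b) \<odot>\<^bsub>M\<^esub> x = a \<odot>\<^bsub>M\<^esub> x \<oplus>\<^bsub>M\<^esub> b \<odot>\<^bsub>M\<^esub> x"
    and smult_r_distr:
      "\<lbrakk>a \<in> carrier R; x \<in> carrier M; y \<in> carrier M\<rbrakk> \<Longrightarrow>
       a \<odot>\<^bsub>M\<^esub> (x \<oplus>\<^bsub>M\<^esub> y) = a \<odot>\<^bsub>M\<^esub> x \<oplus>\<^bsub>M\<^esub> a \<odot>\<^bsub>M\<^esub> y"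
    and smult_assoc:
      "\<lbrakk>a \<in> carrier R; b \<in> carrier R; x \<in> carrier M\<rbrakk> \<Longrightarrow>
       (a \<otimes>\<^bsub>R\<^esub> b) \<odot>\<^bsub>M\<^esub> x = a \<odot>\<^bsub>M\<^esub> (b \<odot>\<^bsub>M\<^esub> x)"
    and smult_one:
      "x \<in> carrier M \<Longrightarrow> \<one>\<^bsub>R\<^esub> \<odot>\<^bsub>M\<^esub> x = x"

definition lmod_hom :: "('a, 'r) ring_scheme \<Rightarrow> ('a, 'm) module \<Rightarrow> ('a, 'n) module \<Rightarrow> ('m \<Rightarrow> 'n) set"
  where
  "lmod_hom R M N = {f \<in> carrier M \<rightarrow> carrier N.
     (\<forall>x\<in>carrier M. \<forall>y\<in>carrier M. f (x \<oplus>\<^bsub>M\<^esub> y) = f x \<oplus>\<^bsub>N\<^esub> f y) \<and>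
     (\<forall>a\<in>carrier R. \<forall>x\<in>carrier M. f (a \<odot>\<^bsub>M\<^esub> x) = a \<odot>\<^bsub>N\<^esub> f x)}"

definition lmod_iso :: "('a, 'r) ring_scheme \<Rightarrow> ('a, 'm) module \<Rightarrow> ('a, 'n) module \<Rightarrow> bool" where
  "lmod_iso R M N \<longleftrightarrow> (\<exists>f\<in>lmod_hom R M N. bij_betw f (carrier M) (carrier N))"

definition short_exact :: "('a, 'r) ring_scheme \<Rightarrow> ('a, 'l) module \<Rightarrow> ('a, 'm) module \<Rightarrow>
    ('a, 'n) module \<Rightarrow> ('l \<Rightarrow> 'm) \<Rightarrow> ('m \<Rightarrow> 'n) \<Rightarrow> bool" where
  "short_exact R L M N f g \<longleftrightarrow>
     f \<in> lmod_hom R L M \<and> g \<in> lmod_hom R M N \<and>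
     inj_on f (carrier L) \<and> f ` carrier L = a_kernel M N g \<and> g ` carrier M = carrier N"

text \<open>The free module on a basis \<open>I\<close>: finitely supported functions. In particular
  \<open>free_lmod R {..<n}\<close> is the module of row vectors of length \<open>n\<close>.\<close>

definition free_lmod :: "('a, 'r) ring_scheme \<Rightarrow> 'i set \<Rightarrow> ('a, 'i \<Rightarrow> 'a) module" where
  "free_lmod R I =
     \<lparr>carrier = {x. (\<forall>i\<in>I. x i \<in> carrier R) \<and> (\<forall>i. i \<notin> I \<longrightarrow> x i = \<zero>\<^bsub>R\<^esub>) \<and> finite {i. x i \<noteq> \<zero>\<^bsub>R\<^esub>}},
      monoid.mult = undefined, one = undefined,
      ring.zero = (\<lambda>i. \<zero>\<^bsub>R\<^esub>),
      ring.add = (\<lambda>x y i. x i \<oplus>\<^bsub>R\<^esub> y i),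
      smult = (\<lambda>a x i. a \<otimes>\<^bsub>R\<^esub> x i)\<rparr>"

definition finitely_generated :: "('a, 'r) ring_scheme \<Rightarrow> ('a, 'm) module \<Rightarrow> bool" where
  "finitely_generated R M \<longleftrightarrow>
     (\<exists>S. finite S \<and> S \<subseteq> carrier M \<and> (\<forall>H. submodule H R M \<and> S \<subseteq> H \<longrightarrow> H = carrier M))"

text \<open>Projective: isomorphic to a direct summand of a free module. Basis sets in the type of
  elements of the module suffice, because a projective module is a direct summand of the free
  module on its own carrier.\<close>

definition projective :: "('a, 'r) ring_scheme \<Rightarrow> ('a, 'm) module \<Rightarrow> bool" where
  "projective R P \<longleftrightarrow>
     (\<exists>(I :: 'm set) U V.
        submodule U R (free_lmod R I) \<and> submodule V R (free_lmod R I) \<and>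
        U \<inter> V = {\<zero>\<^bsub>free_lmod R I\<^esub>} \<and>
        U <+>\<^bsub>free_lmod R I\<^esub> V = carrier (free_lmod R I) \<and>
        lmod_iso R P ((free_lmod R I)\<lparr>carrier := U\<rparr>))"


section \<open>Induction along a ring inclusion\<close>

text \<open>For a subring \<open>S\<close> of \<open>R\<close>: \<open>R \<otimes>\<^sub>S M\<close> is the free abelian group on \<open>R \<times> M\<close> modulo the
  subgroup generated by the balancing relations, so its elements are cosets.\<close>

definition tensor_free ::
    "('a, 'r) ring_scheme \<Rightarrow> ('a, 'm) module \<Rightarrow> (('a \<times> 'm) \<Rightarrow>\<^sub>0 int) monoid" where
  "tensor_free R M = free_Abelian_group (carrier R \<times> carrier M)"

definition tensor_rel ::
    "('a, 'r) ring_scheme \<Rightarrow> ('a, 's) ring_scheme \<Rightarrow> ('a, 'm) module \<Rightarrow> (('a \<times> 'm) \<Rightarrow>\<^sub>0 int) set"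
  where
  "tensor_rel R S M = generate (tensor_free R M)
     ({frag_of (a \<oplus>\<^bsub>R\<^esub> b, x) - frag_of (a, x) - frag_of (b, x) | a b x.
          a \<in> carrier R \<and> b \<in> carrier R \<and> x \<in> carrier M} \<union>
      {frag_of (a, x \<oplus>\<^bsub>M\<^esub> y) - frag_of (a, x) - frag_of (a, y) | a x y.
          a \<in> carrier R \<and> x \<in> carrier M \<and> y \<in> carrier M} \<union>
      {frag_of (a \<otimes>\<^bsub>R\<^esub> s, x) - frag_of (a, s \<odot>\<^bsub>M\<^esub> x) | a s x.
          a \<in> carrier R \<and> s \<in> carrier S \<and> x \<in> carrier M})"

text \<open>In the scalar action and in the induced map below, the union over the representatives
  \<open>u\<close> of a coset is a single coset, since all representatives give the same one.\<close>

definition induced_module ::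
    "('a, 'r) ring_scheme \<Rightarrow> ('a, 's) ring_scheme \<Rightarrow> ('a, 'm) module \<Rightarrow>
     ('a, (('a \<times> 'm) \<Rightarrow>\<^sub>0 int) set) module" where
  "induced_module R S M =
     \<lparr>carrier = carrier (tensor_free R M Mod tensor_rel R S M),
      monoid.mult = undefined, one = undefined,
      ring.zero = \<one>\<^bsub>tensor_free R M Mod tensor_rel R S M\<^esub>,
      ring.add = (\<otimes>\<^bsub>tensor_free R M Mod tensor_rel R S M\<^esub>),
      smult = (\<lambda>r X. \<Union>u\<in>X. tensor_rel R S M #>\<^bsub>tensor_free R M\<^esub>
                 frag_extend (\<lambda>(a, x). frag_of (r \<otimes>\<^bsub>R\<^esub> a, x)) u)\<rparr>"

definition induced_map ::
    "('a, 'r) ring_scheme \<Rightarrow> ('a, 's) ring_scheme \<Rightarrow> ('a, 'n) module \<Rightarrow> ('m \<Rightarrow> 'n) \<Rightarrow>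
     (('a \<times> 'm) \<Rightarrow>\<^sub>0 int) set \<Rightarrow> (('a \<times> 'n) \<Rightarrow>\<^sub>0 int) set" where
  "induced_map R S N f X =
     (\<Union>u\<in>X. tensor_rel R S N #>\<^bsub>tensor_free R N\<^esub> frag_extend (\<lambda>(a, x). frag_of (a, f x)) u)"

abbreviation ind_obj ::
    "'h::complex_hilbert oper set \<Rightarrow> 'h oper set \<Rightarrow> ('h oper, 'm) module \<Rightarrow>
     ('h oper, (('h oper \<times> 'm) \<Rightarrow>\<^sub>0 int) set) module" where
  "ind_obj A B M \<equiv> induced_module (op_ring A) (op_ring B) M"

abbreviation ind_map ::
    "'h::complex_hilbert oper set \<Rightarrow> 'h oper set \<Rightarrow> ('h oper, 'n) module \<Rightarrow> ('m \<Rightarrow> 'n) \<Rightarrow>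
     (('h oper \<times> 'm) \<Rightarrow>\<^sub>0 int) set \<Rightarrow> (('h oper \<times> 'n) \<Rightarrow>\<^sub>0 int) set" where
  "ind_map A B N f \<equiv> induced_map (op_ring A) (op_ring B) N f"


section \<open>Dimension\<close>

text \<open>Left linear endomorphisms of the row vectors of length \<open>n\<close> are the maps \<open>x \<mapsto> x F\<close> for
  \<open>n \<times> n\<close> matrices \<open>F\<close>; composition and adjoint of maps are those of matrices. Only the entries
  with indices below \<open>n\<close> matter.\<close>

definition projection_matrix ::
    "'h::complex_hilbert oper set \<Rightarrow> nat \<Rightarrow> (nat \<Rightarrow> nat \<Rightarrow> 'h oper) \<Rightarrow> bool" where
  "projection_matrix A n F \<longleftrightarrow>
     (\<forall>i<n. \<forall>j<n. F i j \<in> A \<and> (\<Sum>k<n. F i k o\<^sub>L F k j) = F i j \<and> op_adj (F j i) = F i j)"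

definition matrix_image ::
    "'h::complex_hilbert oper set \<Rightarrow> nat \<Rightarrow> (nat \<Rightarrow> nat \<Rightarrow> 'h oper) \<Rightarrow>
     ('h oper, nat \<Rightarrow> 'h oper) module" where
  "matrix_image A n F = (free_lmod (op_ring A) {..<n})
     \<lparr>carrier := (\<lambda>x j. if j < n then \<Sum>i<n. x i o\<^sub>L F i j else 0) `
                   carrier (free_lmod (op_ring A) {..<n})\<rparr>"

definition matrix_trace ::
    "('h oper \<Rightarrow> complex) \<Rightarrow> nat \<Rightarrow> (nat \<Rightarrow> nat \<Rightarrow> 'h::complex_hilbert oper) \<Rightarrow> complex" where
  "matrix_trace tr n F = (\<Sum>i<n. tr (F i i))"

text \<open>The trace of a projection matrix is a non-negative real number, whence \<^const>\<open>Re\<close>; it does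
  not depend on the choice of \<open>n\<close> and \<open>F\<close>.\<close>

definition dim_fg_proj ::
    "'h::complex_hilbert oper set \<Rightarrow> ('h oper \<Rightarrow> complex) \<Rightarrow> ('h oper, 'm) module \<Rightarrow> real" where
  "dim_fg_proj A tr P = (SOME d. \<exists>n F. projection_matrix A n F \<and>
     lmod_iso (op_ring A) P (matrix_image A n F) \<and> d = Re (matrix_trace tr n F))"

definition vn_dim ::
    "'h::complex_hilbert oper set \<Rightarrow> ('h oper \<Rightarrow> complex) \<Rightarrow> ('h oper, 'm) module \<Rightarrow> ereal" where
  "vn_dim A tr M =
     (SUP H \<in> {H. submodule H (op_ring A) M \<and>
                  finitely_generated (op_ring A) (M\<lparr>carrier := H\<rparr>) \<and>
                  projective (op_ring A) (M\<lparr>carrier := H\<rparr>)}.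
        ereal (dim_fg_proj A tr (M\<lparr>carrier := H\<rparr>)))"

end

theory Submission
  imports Defs
begin

text \<open>
  Everything rests on annihilator projections: for a set \<open>S\<close> of column vectors over a von Neumann
  algebra \<open>A\<close> on \<open>H\<close>, the projection onto the orthogonal complement of \<open>S H\<close> in \<open>H\<^sup>n\<close> commutes
  with \<open>A'\<close>, so that its matrix \<open>F\<close> has entries in \<open>A'' = A\<close>; it satisfies \<open>F b = 0\<close> for \<open>b \<in> S\<close>,
  and every row \<open>y\<close> of bounded operators with \<open>y S = 0\<close> satisfies \<open>y F = y\<close>.

  Applied over \<open>B\<close> to rows over \<open>A\<close>, this gives the equational criterion of flatness for \<open>A\<close> over
  \<open>B\<close>, and faithfulness by a similar argument.

  Finitely generated projective submodules of \<open>M\<close> correspond to projections \<open>F\<close> with an injective map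
  from \<open>A\<^sup>n F\<close> to \<open>M\<close>, so that \<open>dim M\<close> is the supremum of their traces; by flatness, it does
  not decrease under induction. Conversely, let \<open>A\<^sup>k q\<close> embed into \<open>A \<otimes> M\<close>, with image in the submodule generated by
  \<open>1 \<otimes> m\<^sub>1, \<dots>, 1 \<otimes> m\<^sub>n\<close>, and let \<open>F\<close> be the projection over \<open>B\<close> annihilating the module of
  relations among the \<open>m\<^sub>i\<close>. Then \<open>B\<^sup>n F\<close> embeds into \<open>M\<close>, and \<open>tr q \<le> tr F\<close>: for finitely many
  relations this is a rank count for matrices over \<open>A\<close>, and normality of the trace passes to the limit.
  The rank-nullity theorem behind the count follows from normality as well: the projection onto
  the graph of \<open>s V\<close> has the same trace as the identity of \<open>A\<^sup>k\<close> for all \<open>k \<times> n\<close> matrices \<open>V\<close> and all \<open>s\<close>, and its diagonal corner decreases to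
  the projection onto the kernel as \<open>s\<close> tends to infinity.
\<close>

section \<open>Geometry of finite direct sums of Hilbert spaces\<close>

text \<open>What drives flatness: a row over \<open>A\<close> killed by columns over
  \<open>B\<close> is a combination of rows over \<open>B\<close> killed by them, namely of the rows
  of \<open>F\<close>. The columns may be infinitely many, so nothing is assumed of the relations of
  a \<open>B\<close>-module, which need not be finitely generated. Infinitely many relations are
  also the obstacle for the dimension: ranks can be counted for finite matrices only. Passing to
  finitely many relations costs an arbitrarily small amount of trace, which an inequality between
  traces tolerates. Rank-nullity is usually read off the polar decomposition, whose partial isometry
  intertwines range and kernel projections. The graph of \<open>s V\<close> does without functional
  calculus: it is isomorphic to the free module of its first coordinates, so its trace does not move
  with \<open>s\<close>, and the only limit to take is one of distances in Hilbert space. As modules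
  are left modules, their elements are rows and maps multiply from the right, while operators act on
  columns of vectors from the left. The adjoint exchanges the two sides, which is why relations
  enter the last projection as adjoint columns.\<close>

lemma cinner_add_right: "cinner x (y + z) = cinner x y + cinner x (z::'h::complex_hilbert)"
  by (subst (1 2 3) cinner_commute) (simp add: cinner_add_left)

lemma cinner_scaleC_right: "cinner x (scaleC c y) = cnj c * cinner x (y::'h::complex_hilbert)"
  by (subst (1 2) cinner_commute) (simp add: cinner_scaleC_left)

lemma scaleC_minus1: "scaleC (-1) x = - (x::'h::complex_hilbert)"
  using scaleR_scaleC[of "-1" x] by simp

lemma cinner_minus_left: "cinner (- x) y = - cinner x (y::'h::complex_hilbert)"
  using cinner_scaleC_left[of "-1" x y] by (simp add: scaleC_minus1)

lemma cinner_minus_right: "cinner x (- y) = - cinner x (y::'h::complex_hilbert)"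
  using cinner_scaleC_right[of x "-1" y] by (simp add: scaleC_minus1)

lemma cinner_diff_left: "cinner (x - y) z = cinner x z - cinner y (z::'h::complex_hilbert)"
  using cinner_add_left[of x "-y" z] by (simp add: cinner_minus_left)

lemma cinner_diff_right: "cinner x (y - z) = cinner x y - cinner x (z::'h::complex_hilbert)"
  using cinner_add_right[of x y "-z"] by (simp add: cinner_minus_right)

lemma cinner_zero_left [simp]: "cinner 0 (x::'h::complex_hilbert) = 0"
  using cinner_diff_left[of 0 0 x] by simp

lemma cinner_zero_right [simp]: "cinner (x::'h::complex_hilbert) 0 = 0"
  using cinner_diff_right[of x 0 0] by simp

lemma cinner_sum_left: "cinner (sum f I) y = (\<Sum>i\<in>I. cinner (f i) (y::'h::complex_hilbert))"
  by (induction I rule: infinite_finite_induct) (simp_all add: cinner_add_left)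

lemma cinner_sum_right: "cinner y (sum f I) = (\<Sum>i\<in>I. cinner y (f i :: 'h::complex_hilbert))"
  by (induction I rule: infinite_finite_induct) (simp_all add: cinner_add_right)

text \<open>The class ties \<open>norm\<close> to real scaling only; complex homogeneity has to come
  from \<open>cinner_self\<close>.\<close>

lemma norm_scaleC: "norm (scaleC c x) = cmod c * norm (x::'h::complex_hilbert)"
proof -
  have "complex_of_real ((norm (scaleC c x))\<^sup>2) = c * cnj c * of_real ((norm x)\<^sup>2)"
    unfolding cinner_self[symmetric] by (simp add: cinner_scaleC_left cinner_scaleC_right)
  also have "\<dots> = of_real ((cmod c * norm x)\<^sup>2)"
    by (simp only: complex_mult_cnj cmod_power2[symmetric] power_mult_distrib of_real_mult)
  finally have "(norm (scaleC c x))\<^sup>2 = (cmod c * norm x)\<^sup>2"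
    using of_real_eq_iff by blast
  then show ?thesis by (simp add: power2_eq_iff_nonneg)
qed

lemma scaleC_zero_right [simp]: "scaleC c (0::'h::complex_hilbert) = 0"
  by (metis norm_scaleC mult_zero_right norm_eq_zero norm_zero)

lemma scaleC_diff_right: "scaleC c (x - y) = scaleC c x - scaleC c (y::'h::complex_hilbert)"
  using scaleC_add_right[of c "x - y" y] by (simp add: algebra_simps)

lemma norm_add_sq: "(norm (x + y))\<^sup>2 = (norm x)\<^sup>2 + (norm y)\<^sup>2 + 2 * Re (cinner x (y::'h::complex_hilbert))"
proof -
  have "complex_of_real ((norm (x + y))\<^sup>2)
      = of_real ((norm x)\<^sup>2) + of_real ((norm y)\<^sup>2) + (cinner x y + cnj (cinner x y))"
    by (simp only: cinner_self[symmetric] cinner_add_left cinner_add_right cinner_commute[of y x]) simp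
  also have "\<dots> = of_real ((norm x)\<^sup>2 + (norm y)\<^sup>2 + 2 * Re (cinner x y))"
    by (simp add: complex_add_cnj)
  finally show ?thesis using of_real_eq_iff by blast
qed

lemma norm_diff_scaleC_sq:
  "(norm (x - scaleC c y))\<^sup>2 =
     (norm x)\<^sup>2 + (cmod c)\<^sup>2 * (norm y)\<^sup>2 - 2 * Re (cnj c * cinner x (y::'h::complex_hilbert))"
  using norm_add_sq[of x "- scaleC c y"]
  by (simp add: norm_scaleC cinner_minus_right cinner_scaleC_right power_mult_distrib)

lemma cinner_Cauchy_Schwarz: "cmod (cinner x y) \<le> norm x * norm (y::'h::complex_hilbert)"
proof (cases "y = 0")
  case False
  \<comment> \<open>The coefficient of the orthogonal projection of \<open>x\<close> onto the line
    through \<open>y\<close>; the squared length of the remainder is non-negative, which is the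
    inequality.\<close>
  define c where "c = cinner x y / of_real ((norm y)\<^sup>2)"
  have "Re (cnj c * cinner x y) = (cmod (cinner x y))\<^sup>2 / (norm y)\<^sup>2"
  proof -
    have "cnj c * cinner x y = (cinner x y * cnj (cinner x y)) / of_real ((norm y)\<^sup>2)"
      by (simp add: c_def)
    also have "\<dots> = of_real ((cmod (cinner x y))\<^sup>2 / (norm y)\<^sup>2)"
      by (simp only: complex_norm_square[symmetric] of_real_divide)
    finally show ?thesis by simp
  qed
  moreover have "(cmod c)\<^sup>2 * (norm y)\<^sup>2 = (cmod (cinner x y))\<^sup>2 / (norm y)\<^sup>2"
    using False by (simp add: c_def norm_divide power_divide norm_power norm_mult power2_eq_square)
  ultimately have "0 \<le> (norm x)\<^sup>2 - (cmod (cinner x y))\<^sup>2 / (norm y)\<^sup>2"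
    using norm_diff_scaleC_sq[of x c y] zero_le_power2[of "norm (x - scaleC c y)"] by linarith
  then have "(cmod (cinner x y))\<^sup>2 \<le> (norm x * norm y)\<^sup>2"
    using False by (simp add: field_simps power_mult_distrib)
  then show ?thesis by (rule power2_le_imp_le) simp
qed simp

lemma bounded_linear_cinner_left: "bounded_linear (\<lambda>x. cinner x (y::'h::complex_hilbert))"
  by (rule bounded_linear_intro[where K = "norm y"])
    (simp_all add: cinner_add_left scaleR_scaleC cinner_scaleC_left cinner_Cauchy_Schwarz scaleR_conv_of_real)

lemmas tendsto_cinner_left = bounded_linear.tendsto[OF bounded_linear_cinner_left]

text \<open>Vectors of the direct sum over \<open>I\<close> are functions on the whole index type
  whose values off \<open>I\<close> are ignored. They are therefore determined on \<open>I\<close>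
  only, and the equalities below are claimed only there.\<close>

definition hinner :: "'i set \<Rightarrow> ('i \<Rightarrow> 'h) \<Rightarrow> ('i \<Rightarrow> 'h::complex_hilbert) \<Rightarrow> complex" where
  "hinner I \<xi> \<eta> = (\<Sum>i\<in>I. cinner (\<xi> i) (\<eta> i))"

definition hnorm2 :: "'i set \<Rightarrow> ('i \<Rightarrow> 'h::complex_hilbert) \<Rightarrow> real" where
  "hnorm2 I \<xi> = (\<Sum>i\<in>I. (norm (\<xi> i))\<^sup>2)"

lemma hnorm2_nonneg [simp]: "0 \<le> hnorm2 I \<xi>"
  by (simp add: hnorm2_def sum_nonneg)

lemma hinner_self: "hinner I \<xi> \<xi> = of_real (hnorm2 I \<xi>)"
  by (simp add: hinner_def hnorm2_def cinner_self)

lemma hinner_commute: "hinner I \<xi> \<eta> = cnj (hinner I \<eta> \<xi>)"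
  unfolding hinner_def cnj_sum by (intro sum.cong refl cinner_commute)

lemma hnorm2_diff_scaleC:
  "hnorm2 I (\<lambda>i. \<xi> i - scaleC c (\<eta> i)) =
     hnorm2 I \<xi> + (cmod c)\<^sup>2 * hnorm2 I \<eta> - 2 * Re (cnj c * hinner I \<xi> \<eta>)"
  by (simp only: hnorm2_def hinner_def norm_diff_scaleC_sq sum.distrib sum_subtractf
      sum_distrib_left Re_sum)

lemma hnorm2_eq_0_iff: "finite I \<Longrightarrow> hnorm2 I \<xi> = 0 \<longleftrightarrow> (\<forall>i\<in>I. \<xi> i = 0)"
  by (simp add: hnorm2_def sum_nonneg_eq_0_iff)

definition hsubspace :: "('i \<Rightarrow> 'h::complex_hilbert) set \<Rightarrow> bool" where
  "hsubspace \<Omega> \<longleftrightarrow> (\<lambda>i. 0) \<in> \<Omega> \<and> (\<forall>x\<in>\<Omega>. \<forall>y\<in>\<Omega>. (\<lambda>i. x i + y i) \<in> \<Omega>) \<and>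
     (\<forall>c. \<forall>x\<in>\<Omega>. (\<lambda>i. scaleC c (x i)) \<in> \<Omega>)"

text \<open>The subspace need not be closed: the projection onto its closure is approximated from
  within.\<close>

lemma hilbert_projection:
  fixes \<Omega> :: "('i \<Rightarrow> 'h::complex_hilbert) set"
  assumes I: "finite I" and \<Omega>: "hsubspace \<Omega>"
  shows "\<exists>\<eta> \<omega>. (\<forall>n::nat. \<omega> n \<in> \<Omega>) \<and> (\<forall>i\<in>I. (\<lambda>n. \<omega> n i) \<longlonglongrightarrow> \<eta> i) \<and>
     (\<forall>x\<in>\<Omega>. hinner I (\<lambda>i. \<xi> i - \<eta> i) x = 0)"
proof -
  define d where "d \<omega> = hnorm2 I (\<lambda>i. \<xi> i - \<omega> i)" for \<omega>
  define \<delta> where "\<delta> = (INF \<omega>\<in>\<Omega>. d \<omega>)"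
  have bdd: "bdd_below (d ` \<Omega>)" by (rule bdd_belowI[of _ 0]) (auto simp: d_def)
  have ne: "d ` \<Omega> \<noteq> {}" using \<Omega> by (auto simp: hsubspace_def)
  have \<delta>: "\<delta> \<le> d \<omega>" if "\<omega> \<in> \<Omega>" for \<omega>
    unfolding \<delta>_def using bdd that by (auto intro: cINF_lower)
  have "\<exists>\<omega>\<in>\<Omega>. d \<omega> < \<delta> + inverse (real (Suc n))" for n
    using cInf_lessD[OF ne, of "\<delta> + inverse (real (Suc n))"] by (auto simp: \<delta>_def)
  then obtain \<omega> where \<omega>: "\<And>n. \<omega> n \<in> \<Omega>" "\<And>n. d (\<omega> n) < \<delta> + inverse (real (Suc n))"
    by metis
  \<comment> \<open>The parallelogram law for \<open>x - a\<close> and \<open>x - b\<close>, written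
    with the midpoint of \<open>a\<close> and \<open>b\<close>, so that summing over
    \<open>I\<close> turns the right-hand side into distances from \<open>\<xi>\<close>.\<close>
  have para: "(norm (a - b))\<^sup>2 = 2 * (norm (x - a))\<^sup>2 + 2 * (norm (x - b))\<^sup>2
      - 4 * (norm (x - scaleC (1/2) (a + b)))\<^sup>2" for a b x :: 'h
  proof -
    have h: "scaleC (1/2) y + scaleC (1/2) y = y" for y :: 'h
      by (simp add: scaleC_add_left[symmetric] scaleC_one)
    define u v where "u = x - a" and "v = x - b"
    have "a - b = v + - u" by (simp add: u_def v_def)
    then have 1: "(norm (a - b))\<^sup>2 = (norm v)\<^sup>2 + (norm u)\<^sup>2 - 2 * Re (cinner v u)"
      using norm_add_sq[of v "-u"] by (simp add: cinner_minus_right)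
    have "x - scaleC (1/2) (a + b) = scaleC (1/2) (u + v)"
      using h[of x] by (simp add: u_def v_def scaleC_add_right scaleC_diff_right algebra_simps)
    then have "4 * (norm (x - scaleC (1/2) (a + b)))\<^sup>2 = (norm (u + v))\<^sup>2"
      by (simp add: norm_scaleC power_divide)
    moreover have "Re (cinner u v) = Re (cinner v u)"
      by (subst cinner_commute) simp
    ultimately show ?thesis
      unfolding 1 by (simp add: norm_add_sq u_def[symmetric] v_def[symmetric])
  qed
  \<comment> \<open>Midpoints stay in \<open>\<Omega>\<close>, so the subtracted term of the
    parallelogram law is at least \<open>4 * \<delta>\<close>; this makes the minimising sequence
    Cauchy.\<close>
  have mid: "(\<lambda>i. scaleC (1/2) (\<omega> m i + \<omega> n i)) \<in> \<Omega>" for m n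
    using \<Omega> \<omega>(1) by (auto simp: hsubspace_def)
  have cau: "hnorm2 I (\<lambda>i. \<omega> m i - \<omega> n i) \<le> 2 * inverse (real (Suc m)) + 2 * inverse (real (Suc n))" for m n
  proof -
    have "hnorm2 I (\<lambda>i. \<omega> m i - \<omega> n i) = 2 * d (\<omega> m) + 2 * d (\<omega> n)
        - 4 * d (\<lambda>i. scaleC (1/2) (\<omega> m i + \<omega> n i))"
      unfolding d_def hnorm2_def sum_distrib_left sum_subtractf[symmetric] sum.distrib[symmetric]
      by (intro sum.cong refl para)
    also have "\<dots> \<le> 2 * d (\<omega> m) + 2 * d (\<omega> n) - 4 * \<delta>" using \<delta>[OF mid] by simp
    finally show ?thesis using \<omega>(2)[of m] \<omega>(2)[of n] by linarith
  qed
  have "\<exists>l. (\<lambda>n. \<omega> n i) \<longlonglongrightarrow> l" if i: "i \<in> I" for i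
  proof -
    have le: "(norm (\<omega> m i - \<omega> n i))\<^sup>2 \<le> 2 * inverse (real (Suc m)) + 2 * inverse (real (Suc n))" for m n
      using member_le_sum[of i I "\<lambda>i. (norm (\<omega> m i - \<omega> n i))\<^sup>2"] i I cau[of m n]
      by (auto simp: hnorm2_def)
    have "Cauchy (\<lambda>n. \<omega> n i)"
    proof (rule metric_CauchyI)
      fix e :: real assume e: "0 < e"
      obtain N where N: "inverse (real (Suc N)) < e\<^sup>2 / 4"
        using reals_Archimedean[of "e\<^sup>2 / 4"] e by auto
      have "dist (\<omega> m i) (\<omega> n i) < e" if "m \<ge> N" "n \<ge> N" for m n
      proof -
        have "inverse (real (Suc m)) \<le> inverse (real (Suc N))" "inverse (real (Suc n)) \<le> inverse (real (Suc N))"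
          using that by (auto intro!: le_imp_inverse_le)
        then have "(norm (\<omega> m i - \<omega> n i))\<^sup>2 < e\<^sup>2" using le[of m n] N by linarith
        then show ?thesis using e by (simp add: dist_norm power2_less_imp_less)
      qed
      then show "\<exists>M. \<forall>m\<ge>M. \<forall>n\<ge>M. dist (\<omega> m i) (\<omega> n i) < e" by blast
    qed
    then show ?thesis by (simp add: Cauchy_convergent_iff convergent_def)
  qed
  then obtain \<eta> where \<eta>: "\<And>i. i \<in> I \<Longrightarrow> (\<lambda>n. \<omega> n i) \<longlonglongrightarrow> \<eta> i" by metis
  have d\<eta>: "d \<eta> \<le> \<delta>"
  proof (rule LIMSEQ_le)
    show "(\<lambda>n. d (\<omega> n)) \<longlonglongrightarrow> d \<eta>"
      unfolding d_def hnorm2_def by (intro tendsto_intros \<eta>)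
    show "(\<lambda>n. \<delta> + inverse (real (Suc n))) \<longlonglongrightarrow> \<delta>"
      using tendsto_add[OF tendsto_const LIMSEQ_inverse_real_of_nat] by simp
  qed (use \<omega>(2) less_imp_le in blast)
  have ort: "hinner I (\<lambda>i. \<xi> i - \<eta> i) x = 0" if x: "x \<in> \<Omega>" for x
  proof -
    define z where "z = hinner I (\<lambda>i. \<xi> i - \<eta> i) x"
    have ge: "\<delta> \<le> hnorm2 I (\<lambda>i. (\<xi> i - \<eta> i) - scaleC c (x i))" for c
    proof (rule LIMSEQ_le_const)
      show "(\<lambda>n. hnorm2 I (\<lambda>i. (\<xi> i - \<omega> n i) - scaleC c (x i))) \<longlonglongrightarrow> hnorm2 I (\<lambda>i. (\<xi> i - \<eta> i) - scaleC c (x i))"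
        unfolding hnorm2_def by (intro tendsto_intros \<eta>)
      have "\<delta> \<le> hnorm2 I (\<lambda>i. \<xi> i - \<omega> n i - scaleC c (x i))" for n
        using \<delta>[of "\<lambda>i. \<omega> n i + scaleC c (x i)"] \<Omega> \<omega>(1) x
        by (simp add: hsubspace_def d_def diff_diff_eq)
      then show "\<exists>N. \<forall>n\<ge>N. \<delta> \<le> hnorm2 I (\<lambda>i. \<xi> i - \<omega> n i - scaleC c (x i))" by blast
    qed
    define X where "X = hnorm2 I x"
    \<comment> \<open>Moving \<open>\<eta>\<close> by \<open>c x\<close> with \<open>c = t z\<close>
      changes the squared distance by \<open>t * (cmod z)\<^sup>2 * (t * X - 2)\<close>, which
      minimality forbids to be negative. The added 1 gives \<open>t * X < 1\<close> and covers
      \<open>X = 0\<close>.\<close>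
    define t where "t = 1 / (X + 1)"
    have X: "X \<ge> 0" by (simp add: X_def)
    then have t: "t > 0" "t * X < 1" by (simp_all add: t_def field_simps)
    have "0 \<le> (cmod (of_real t * z))\<^sup>2 * X - 2 * Re (cnj (of_real t * z) * z)"
      using ge[of "of_real t * z"] d\<eta> hnorm2_diff_scaleC[of I "\<lambda>i. \<xi> i - \<eta> i" "of_real t * z" x]
      by (simp add: z_def X_def d_def)
    moreover have "Re (cnj (of_real t * z) * z) = t * (cmod z)\<^sup>2"
    proof -
      have "cnj (of_real t * z) * z = of_real t * (z * cnj z)" by simp
      also have "\<dots> = of_real (t * (cmod z)\<^sup>2)" by (simp only: complex_norm_square[symmetric] of_real_mult)
      finally show ?thesis by (simp only: Re_complex_of_real)
    qed
    ultimately have "0 \<le> t * (cmod z)\<^sup>2 * (t * X - 2)"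
      by (simp add: norm_mult power_mult_distrib power2_eq_square algebra_simps)
    then have "(cmod z)\<^sup>2 \<le> 0"
      using t by (smt (verit) mult_pos_neg mult_pos_pos zero_le_power2)
    then show ?thesis by (simp add: z_def)
  qed
  show ?thesis using \<omega>(1) \<eta> ort by blast
qed

section \<open>Adjoints\<close>

lemma bounded_opsD: "T \<in> bounded_ops \<Longrightarrow> blinfun_apply T (scaleC c x) = scaleC c (blinfun_apply T x)"
  by (simp add: bounded_ops_def)

lemma riesz:
  fixes f :: "'h::complex_hilbert \<Rightarrow> complex"
  assumes f: "bounded_linear f" and fC: "\<And>c x. f (scaleC c x) = c * f x"
  shows "\<exists>z. \<forall>x. f x = cinner x z"
proof (cases "\<forall>x. f x = 0")
  case False
  then obtain x0 where x0: "f x0 \<noteq> 0" by blast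
  interpret f: bounded_linear f by fact
  \<comment> \<open>The index type \<open>unit\<close> turns the projection theorem for direct sums
    into the one for the space itself; the projection is onto the kernel of
    \<open>f\<close>.\<close>
  define \<Omega> where "\<Omega> = {\<xi>::unit \<Rightarrow> 'h. f (\<xi> ()) = 0}"
  have "hsubspace \<Omega>"
    by (auto simp: hsubspace_def \<Omega>_def f.zero f.add fC)
  from hilbert_projection[OF _ this, of "{()}" "\<lambda>_. x0"]
  obtain \<eta> \<omega> where *: "\<And>n::nat. \<omega> n \<in> \<Omega>" "(\<lambda>n. \<omega> n ()) \<longlonglongrightarrow> \<eta> ()"
    "\<And>x. x \<in> \<Omega> \<Longrightarrow> cinner (x0 - \<eta> ()) (x ()) = 0"
    by (auto simp: hinner_def)
  have "(\<lambda>n. f (\<omega> n ())) \<longlonglongrightarrow> f (\<eta> ())" by (rule f.tendsto[OF *(2)])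
  then have f\<eta>: "f (\<eta> ()) = 0" using *(1) by (simp add: \<Omega>_def LIMSEQ_const_iff)
  \<comment> \<open>The component of \<open>x0\<close> orthogonal to the kernel. Every vector
    differs from a multiple of \<open>w\<close> by an element of the kernel, so \<open>f\<close> is
    a multiple of the inner product with \<open>w\<close>.\<close>
  define w where "w = x0 - \<eta> ()"
  have fw: "f w = f x0" by (simp add: w_def f.diff f\<eta>)
  then have w0: "w \<noteq> 0" using x0 f.zero by auto
  have ort: "cinner w x = 0" if "f x = 0" for x
    using *(3)[of "\<lambda>_. x"] that by (simp add: w_def \<Omega>_def)
  have "f x = cinner x (scaleC (cnj (f w / of_real ((norm w)\<^sup>2))) w)" for x
  proof -
    have "f (x - scaleC (f x / f w) w) = 0" using x0 fw by (simp add: f.diff fC)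
    then have "cinner (x - scaleC (f x / f w) w) w = 0"
      using ort by (subst cinner_commute) simp
    then have "cinner x w = f x / f w * of_real ((norm w)\<^sup>2)"
      by (simp add: cinner_diff_left cinner_scaleC_left cinner_self)
    then show ?thesis using x0 fw w0 by (simp add: cinner_scaleC_right)
  qed
  then show ?thesis by blast
qed (auto intro: exI[of _ 0])

lemma cinner_eqI: "(\<And>x. cinner x y = cinner x z) \<Longrightarrow> y = (z::'h::complex_hilbert)"
proof -
  assume "\<And>x. cinner x y = cinner x z"
  then have "cinner (y - z) (y - z) = 0" by (simp add: cinner_diff_right)
  then show "y = z" by (simp add: cinner_self)
qed

lemma adjoint_exists:
  fixes T :: "'h::complex_hilbert oper"
  assumes T: "T \<in> bounded_ops"
  shows "\<exists>S\<in>bounded_ops. \<forall>x y. cinner (blinfun_apply T x) y = cinner x (blinfun_apply S y)"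
proof -
  have "\<exists>z. \<forall>x. cinner (blinfun_apply T x) y = cinner x z" for y
    by (rule riesz)
      (auto intro: bounded_linear_compose[OF bounded_linear_cinner_left] blinfun.bounded_linear_right
        simp: bounded_opsD[OF T] cinner_scaleC_left)
  then obtain S where S: "\<And>x y. cinner (blinfun_apply T x) y = cinner x (S y)" by metis
  have add: "S (x + y) = S x + S y" for x y
    by (rule cinner_eqI) (simp add: S[symmetric] cinner_add_right)
  have scC: "S (scaleC c x) = scaleC c (S x)" for c x
    by (rule cinner_eqI) (simp add: S[symmetric] cinner_scaleC_right)
  have bl: "bounded_linear S"
  proof (rule bounded_linear_intro[where K = "norm T"])
    show "S (x + y) = S x + S y" for x y by (rule add)
    show "S (r *\<^sub>R x) = r *\<^sub>R S x" for r x by (simp add: scaleR_scaleC scC)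
    \<comment> \<open>Test the adjoint relation at \<open>S y\<close> itself and cancel one factor
      \<open>norm (S y)\<close>.\<close>
    show "norm (S y) \<le> norm y * norm T" for y
    proof (cases "S y = 0")
      case False
      have "of_real ((norm (S y))\<^sup>2) = cinner (blinfun_apply T (S y)) y" by (simp add: S cinner_self)
      then have "(norm (S y))\<^sup>2 = cmod (cinner (blinfun_apply T (S y)) y)"
        by (metis norm_of_real abs_of_nonneg zero_le_power2)
      also have "\<dots> \<le> norm (blinfun_apply T (S y)) * norm y" by (rule cinner_Cauchy_Schwarz)
      also have "\<dots> \<le> norm T * norm (S y) * norm y"
        by (intro mult_right_mono norm_blinfun) simp
      finally show ?thesis using False by (simp add: power2_eq_square mult_ac)
    qed (simp)
  qed
  show ?thesis
    by (rule bexI[of _ "Blinfun S"]) (auto simp: bounded_ops_def bounded_linear_Blinfun_apply[OF bl] S scC)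
qed

lemma op_adj_eqI:
  fixes T :: "'h::complex_hilbert oper"
  assumes "\<And>x y. cinner (blinfun_apply T x) y = cinner x (blinfun_apply S y)"
  shows "op_adj T = S"
  unfolding op_adj_def
proof (rule the_equality)
  fix S' assume "\<forall>x y. cinner (blinfun_apply T x) y = cinner x (blinfun_apply S' y)"
  with assms show "S' = S" by (intro blinfun_eqI cinner_eqI) metis
qed (use assms in blast)

lemma
  fixes T :: "'h::complex_hilbert oper"
  assumes "T \<in> bounded_ops"
  shows op_adj_closed: "op_adj T \<in> bounded_ops"
    and cinner_op_adj: "cinner (blinfun_apply T x) y = cinner x (blinfun_apply (op_adj T) y)"
  using adjoint_exists[OF assms] op_adj_eqI by blast+

lemma cinner_op_adj_left:
  "T \<in> bounded_ops \<Longrightarrow> cinner (blinfun_apply (op_adj T) x) y = cinner x (blinfun_apply T y)"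
  by (subst (1 2) cinner_commute) (simp add: cinner_op_adj)

lemma op_adj_op_adj: "T \<in> bounded_ops \<Longrightarrow> op_adj (op_adj T) = T"
  by (rule op_adj_eqI) (rule cinner_op_adj_left)

lemma op_adj_zero [simp]: "op_adj 0 = 0"
  by (rule op_adj_eqI) simp

lemma op_adj_id [simp]: "op_adj id_blinfun = id_blinfun"
  by (rule op_adj_eqI) simp

lemma op_adj_add: "S \<in> bounded_ops \<Longrightarrow> T \<in> bounded_ops \<Longrightarrow> op_adj (S + T) = op_adj S + op_adj T"
  by (rule op_adj_eqI) (simp add: blinfun.add_left cinner_add_left cinner_add_right cinner_op_adj)

lemma op_adj_compose:
  "S \<in> bounded_ops \<Longrightarrow> T \<in> bounded_ops \<Longrightarrow> op_adj (S o\<^sub>L T) = op_adj T o\<^sub>L op_adj S"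
  by (rule op_adj_eqI) (simp add: cinner_op_adj)

lemma op_scaleC_apply: "blinfun_apply (op_scaleC c T) x = scaleC c (blinfun_apply T (x::'h::complex_hilbert))"
proof -
  have "bounded_linear (\<lambda>x. scaleC c (blinfun_apply T x))"
  proof (rule bounded_linear_intro[where K = "cmod c * norm T"])
    show "norm (scaleC c (blinfun_apply T x)) \<le> norm x * (cmod c * norm T)" for x
      using mult_left_mono[OF norm_blinfun[of T x], of "cmod c"] by (simp add: norm_scaleC mult_ac)
    show "scaleC c (blinfun_apply T (r *\<^sub>R x)) = r *\<^sub>R scaleC c (blinfun_apply T x)" for r x
      unfolding blinfun.scaleR_right by (simp add: scaleR_scaleC scaleC_scaleC mult.commute)
  qed (simp add: blinfun.add_right scaleC_add_right)
  then show ?thesis by (simp add: op_scaleC_def bounded_linear_Blinfun_apply)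
qed

lemma bounded_ops_zero: "0 \<in> bounded_ops"
  by (simp add: bounded_ops_def)

lemma bounded_ops_id: "id_blinfun \<in> bounded_ops"
  by (simp add: bounded_ops_def)

lemma bounded_ops_add: "S \<in> bounded_ops \<Longrightarrow> T \<in> bounded_ops \<Longrightarrow> S + T \<in> bounded_ops"
  by (simp add: bounded_ops_def blinfun.add_left scaleC_add_right)

lemma bounded_ops_diff: "S \<in> bounded_ops \<Longrightarrow> T \<in> bounded_ops \<Longrightarrow> S - T \<in> bounded_ops"
  by (simp add: bounded_ops_def blinfun.diff_left scaleC_diff_right)

lemma bounded_ops_compose: "S \<in> bounded_ops \<Longrightarrow> T \<in> bounded_ops \<Longrightarrow> S o\<^sub>L T \<in> bounded_ops"
  by (simp add: bounded_ops_def)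

lemma bounded_ops_sum: "(\<And>i. i \<in> I \<Longrightarrow> f i \<in> bounded_ops) \<Longrightarrow> sum f I \<in> bounded_ops"
  by (induction I rule: infinite_finite_induct) (simp_all add: bounded_ops_zero bounded_ops_add)

lemma op_adj_sum: "(\<And>i. i \<in> I \<Longrightarrow> f i \<in> bounded_ops) \<Longrightarrow> op_adj (sum f I) = (\<Sum>i\<in>I. op_adj (f i))"
  by (induction I rule: infinite_finite_induct) (simp_all add: bounded_ops_sum op_adj_add)

section \<open>Annihilator projections\<close>

text \<open>\<open>\<nu>\<close> is the projection of \<open>\<xi>\<close> to the orthogonal
  complement of \<open>\<Omega>\<close>: the second clause puts \<open>\<xi> - \<nu>\<close> into
  the closure of \<open>\<Omega>\<close>. A relation rather than a function, since coordinates off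
  \<open>I\<close> are free.\<close>

definition hproj :: "'i set \<Rightarrow> ('i \<Rightarrow> 'h::complex_hilbert) set \<Rightarrow> ('i \<Rightarrow> 'h) \<Rightarrow> ('i \<Rightarrow> 'h) \<Rightarrow> bool" where
  "hproj I \<Omega> \<xi> \<nu> \<longleftrightarrow> (\<forall>x\<in>\<Omega>. hinner I \<nu> x = 0) \<and>
     (\<exists>\<omega>. (\<forall>n::nat. \<omega> n \<in> \<Omega>) \<and> (\<forall>i\<in>I. (\<lambda>n. \<omega> n i) \<longlonglongrightarrow> \<xi> i - \<nu> i))"

lemma hinner_add_left: "hinner I (\<lambda>i. \<xi> i + \<eta> i) \<zeta> = hinner I \<xi> \<zeta> + hinner I \<eta> \<zeta>"
  by (simp add: hinner_def cinner_add_left sum.distrib)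

lemma hinner_diff_right: "hinner I \<zeta> (\<lambda>i. \<xi> i - \<eta> i) = hinner I \<zeta> \<xi> - hinner I \<zeta> \<eta>"
  by (simp add: hinner_def cinner_diff_right sum_subtractf)

lemma hinner_scaleC_left: "hinner I (\<lambda>i. scaleC c (\<xi> i)) \<zeta> = c * hinner I \<xi> \<zeta>"
  by (simp add: hinner_def cinner_scaleC_left sum_distrib_left)

lemma hproj_exists:
  assumes "finite I" "hsubspace \<Omega>"
  shows "\<exists>\<nu>. hproj I \<Omega> \<xi> \<nu>"
proof -
  obtain \<eta> \<omega> where "\<And>n::nat. \<omega> n \<in> \<Omega>" "\<And>i. i \<in> I \<Longrightarrow> (\<lambda>n. \<omega> n i) \<longlonglongrightarrow> \<eta> i"
    "\<And>x. x \<in> \<Omega> \<Longrightarrow> hinner I (\<lambda>i. \<xi> i - \<eta> i) x = 0"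
    using hilbert_projection[OF assms, of \<xi>] by blast
  then have "hproj I \<Omega> \<xi> (\<lambda>i. \<xi> i - \<eta> i)" by (auto simp: hproj_def)
  then show ?thesis by blast
qed

lemma hproj_orthogonal:
  assumes "hproj I \<Omega> \<xi> \<nu>" and \<mu>: "\<And>x. x \<in> \<Omega> \<Longrightarrow> hinner I \<mu> x = 0"
  shows "hinner I \<mu> (\<lambda>i. \<xi> i - \<nu> i) = 0"
proof -
  obtain \<omega> where \<omega>: "\<forall>n::nat. \<omega> n \<in> \<Omega>" "\<forall>i\<in>I. (\<lambda>n. \<omega> n i) \<longlonglongrightarrow> \<xi> i - \<nu> i"
    using assms(1) unfolding hproj_def by blast
  have "(\<lambda>n. hinner I (\<omega> n) \<mu>) \<longlonglongrightarrow> hinner I (\<lambda>i. \<xi> i - \<nu> i) \<mu>"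
    unfolding hinner_def using \<omega> by (intro tendsto_sum tendsto_cinner_left) auto
  moreover have "hinner I (\<omega> n) \<mu> = 0" for n
    using \<mu> \<omega>(1) by (subst hinner_commute) simp
  ultimately have "hinner I (\<lambda>i. \<xi> i - \<nu> i) \<mu> = 0" by (simp add: LIMSEQ_const_iff)
  then show ?thesis by (subst hinner_commute) simp
qed

text \<open>Both sides equal the inner product of \<open>\<nu>\<close> and \<open>\<nu>'\<close>,
  because the remainders lie in the closure of \<open>\<Omega>\<close>.\<close>

lemma hproj_symmetric:
  assumes "hproj I \<Omega> \<xi> \<nu>" "hproj I \<Omega> \<xi>' \<nu>'"
  shows "hinner I \<nu> \<xi>' = hinner I \<xi> \<nu>'"
proof -
  have 1: "hinner I \<nu> \<xi>' = hinner I \<nu> \<nu>'"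
    using hproj_orthogonal[OF assms(2), of \<nu>] assms(1) by (simp add: hproj_def hinner_diff_right)
  have "hinner I \<nu>' \<xi> = hinner I \<nu>' \<nu>"
    using hproj_orthogonal[OF assms(1), of \<nu>'] assms(2) by (simp add: hproj_def hinner_diff_right)
  then have "hinner I \<xi> \<nu>' = hinner I \<nu> \<nu>'" by (metis hinner_commute)
  with 1 show ?thesis by simp
qed

lemma hproj_norm:
  assumes "hproj I \<Omega> \<xi> \<nu>"
  shows "hnorm2 I \<xi> = hnorm2 I \<nu> + hnorm2 I (\<lambda>i. \<xi> i - \<nu> i)"
proof -
  have "hinner I \<nu> \<xi> = hinner I \<nu> \<nu>"
    using hproj_orthogonal[OF assms, of \<nu>] assms by (simp add: hproj_def hinner_diff_right)
  then have "hinner I \<xi> \<nu> = of_real (hnorm2 I \<nu>)"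
    by (metis hinner_commute hinner_self)
  then show ?thesis using hnorm2_diff_scaleC[of I \<xi> 1 \<nu>] by (simp add: scaleC_one)
qed

lemma hproj_add:
  assumes "hsubspace \<Omega>" "hproj I \<Omega> \<xi> \<nu>" "hproj I \<Omega> \<xi>' \<nu>'"
  shows "hproj I \<Omega> (\<lambda>i. \<xi> i + \<xi>' i) (\<lambda>i. \<nu> i + \<nu>' i)"
proof -
  obtain \<omega> \<omega>' where "\<forall>n::nat. \<omega> n \<in> \<Omega>" "\<forall>i\<in>I. (\<lambda>n. \<omega> n i) \<longlonglongrightarrow> \<xi> i - \<nu> i"
    "\<forall>n::nat. \<omega>' n \<in> \<Omega>" "\<forall>i\<in>I. (\<lambda>n. \<omega>' n i) \<longlonglongrightarrow> \<xi>' i - \<nu>' i"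
    using assms(2,3) unfolding hproj_def by blast
  then have "\<forall>n. (\<lambda>i. \<omega> n i + \<omega>' n i) \<in> \<Omega>"
    "\<forall>i\<in>I. (\<lambda>n. \<omega> n i + \<omega>' n i) \<longlonglongrightarrow> (\<xi> i + \<xi>' i) - (\<nu> i + \<nu>' i)"
    using assms(1) by (auto simp: hsubspace_def add_diff_add intro: tendsto_add)
  then show ?thesis
    using assms unfolding hproj_def by (auto simp: hinner_add_left intro!: exI[of _ "\<lambda>n i. \<omega> n i + \<omega>' n i"])
qed

lemma tendsto_scaleC: "(f \<longlongrightarrow> l) G \<Longrightarrow> ((\<lambda>n. scaleC c (f n :: 'h::complex_hilbert)) \<longlongrightarrow> scaleC c l) G"
proof -
  have "bounded_linear (\<lambda>x::'h. scaleC c x)"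
    by (rule bounded_linear_intro[where K = "cmod c"])
      (simp_all add: scaleC_add_right scaleR_scaleC scaleC_scaleC norm_scaleC mult.commute)
  then show "(f \<longlongrightarrow> l) G \<Longrightarrow> ?thesis" by (rule bounded_linear.tendsto)
qed

lemma hproj_scaleC:
  assumes "hsubspace \<Omega>" "hproj I \<Omega> \<xi> \<nu>"
  shows "hproj I \<Omega> (\<lambda>i. scaleC c (\<xi> i)) (\<lambda>i. scaleC c (\<nu> i))"
proof -
  obtain \<omega> where "\<forall>n::nat. \<omega> n \<in> \<Omega>" "\<forall>i\<in>I. (\<lambda>n. \<omega> n i) \<longlonglongrightarrow> \<xi> i - \<nu> i"
    using assms(2) unfolding hproj_def by blast
  then have "\<forall>n. (\<lambda>i. scaleC c (\<omega> n i)) \<in> \<Omega>"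
    "\<forall>i\<in>I. (\<lambda>n. scaleC c (\<omega> n i)) \<longlonglongrightarrow> scaleC c (\<xi> i) - scaleC c (\<nu> i)"
    using assms(1) by (auto simp: hsubspace_def scaleC_diff_right[symmetric] intro: tendsto_scaleC)
  then show ?thesis
    using assms unfolding hproj_def by (auto simp: hinner_scaleC_left intro!: exI[of _ "\<lambda>n i. scaleC c (\<omega> n i)"])
qed

lemma hproj_fixed: "hsubspace \<Omega> \<Longrightarrow> (\<And>x. x \<in> \<Omega> \<Longrightarrow> hinner I \<nu> x = 0) \<Longrightarrow> hproj I \<Omega> \<nu> \<nu>"
  by (auto simp: hproj_def hsubspace_def intro: exI[of _ "\<lambda>n i. 0"])

lemma hproj_in: "\<omega> \<in> \<Omega> \<Longrightarrow> hproj I \<Omega> \<omega> (\<lambda>i. 0)"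
  by (auto simp: hproj_def hinner_def intro: exI[of _ "\<lambda>n. \<omega>"])

lemma hproj_sum:
  assumes "hsubspace \<Omega>" "\<And>j. j \<in> J \<Longrightarrow> hproj I \<Omega> (\<xi> j) (\<nu> j)"
  shows "hproj I \<Omega> (\<lambda>i. \<Sum>j\<in>J. \<xi> j i) (\<lambda>i. \<Sum>j\<in>J. \<nu> j i)"
  using assms(2)
proof (induction J rule: infinite_finite_induct)
  case (insert x F)
  then show ?case using hproj_add[OF assms(1), of I "\<xi> x" "\<nu> x"] by simp
qed (use assms(1) hproj_in[of "\<lambda>i. 0" \<Omega> I] in \<open>simp_all add: hsubspace_def\<close>)

lemma hproj_cong:
  "hproj I \<Omega> \<xi> \<nu> \<Longrightarrow> (\<And>i. i \<in> I \<Longrightarrow> \<xi> i = \<xi>' i) \<Longrightarrow> hproj I \<Omega> \<xi>' \<nu>"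
  by (simp add: hproj_def)

text \<open>By linearity the difference of two projections of \<open>\<xi>\<close> is a projection
  of zero, and by Pythagoras (\<open>hproj_norm\<close>) its norm vanishes.\<close>

lemma hproj_unique:
  assumes "finite I" "hsubspace \<Omega>" "hproj I \<Omega> \<xi> \<nu>" "hproj I \<Omega> \<xi> \<nu>'" "i \<in> I"
  shows "\<nu> i = \<nu>' i"
proof -
  have "hproj I \<Omega> (\<lambda>i. \<xi> i + scaleC (-1) (\<xi> i)) (\<lambda>i. \<nu> i + scaleC (-1) (\<nu>' i))"
    by (intro hproj_add hproj_scaleC assms)
  from hproj_norm[OF this]
  have "hnorm2 I (\<lambda>i. \<nu> i + scaleC (-1) (\<nu>' i)) = 0"
    using hnorm2_nonneg[of I "\<lambda>i. \<nu> i + scaleC (-1) (\<nu>' i)"]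
      hnorm2_nonneg[of I "\<lambda>i. \<xi> i + scaleC (-1) (\<xi> i) - (\<nu> i + scaleC (-1) (\<nu>' i))"]
    by (simp add: scaleC_minus1 hnorm2_def)
  then show ?thesis using assms(1,5) by (simp add: hnorm2_eq_0_iff scaleC_minus1)
qed

section \<open>Spans of the ranges of operator columns\<close>

inductive_set col_range :: "('i \<Rightarrow> 'h::complex_hilbert oper) set \<Rightarrow> ('i \<Rightarrow> 'h) set"
  for S where
  zero: "(\<lambda>i. 0) \<in> col_range S"
| step: "b \<in> S \<Longrightarrow> \<omega> \<in> col_range S \<Longrightarrow> (\<lambda>i. blinfun_apply (b i) \<eta> + \<omega> i) \<in> col_range S"

lemma col_range_mono: "x \<in> col_range S \<Longrightarrow> S \<subseteq> S' \<Longrightarrow> x \<in> col_range S'"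
  by (induction rule: col_range.induct) (auto intro: col_range.intros)

lemma col_range_add: "x \<in> col_range S \<Longrightarrow> y \<in> col_range S \<Longrightarrow> (\<lambda>i. x i + y i) \<in> col_range S"
  by (induction rule: col_range.induct) (auto simp: add.assoc intro: col_range.intros)

text \<open>Meant for \<open>f\<close> an operator of the commutant: it passes through every column,
  so the span is invariant under it. The columns are controlled on \<open>I\<close> only, hence so
  is the result.\<close>

lemma col_range_map:
  assumes "x \<in> col_range S" "\<And>x y. f (x + y) = f x + f y" "f 0 = 0" "\<And>b i \<eta>. b \<in> S \<Longrightarrow> i \<in> I \<Longrightarrow> f (blinfun_apply (b i) \<eta>) = blinfun_apply (b i) (g \<eta>)"
  shows "\<exists>z\<in>col_range S. \<forall>i\<in>I. f (x i) = z i"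
  using assms(1)
proof (induction rule: col_range.induct)
  case (step b \<omega> \<eta>)
  then obtain z where "z \<in> col_range S" "\<forall>i\<in>I. f (\<omega> i) = z i" by blast
  with step show ?case
    by (intro bexI[of _ "\<lambda>i. blinfun_apply (b i) (g \<eta>) + z i"]) (auto simp: assms col_range.intros)
qed (auto simp: assms intro: col_range.zero bexI[of _ "\<lambda>i. 0"])

text \<open>A vector of the span uses finitely many columns; this is what lets
  \<open>ann_directed_inf\<close> approximate an infinite set of columns by finite ones.\<close>

lemma col_range_finite: "x \<in> col_range S \<Longrightarrow> \<exists>S0. finite S0 \<and> S0 \<subseteq> S \<and> x \<in> col_range S0"
proof (induction rule: col_range.induct)
  case (step b \<omega> \<eta>)
  then obtain S0 where "finite S0" "S0 \<subseteq> S" "\<omega> \<in> col_range S0" by blast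
  with step.hyps show ?case
    by (intro exI[of _ "insert b S0"]) (auto intro: col_range.step col_range_mono)
qed (auto intro: col_range.zero)

lemma hsubspace_col_range:
  assumes "\<And>b i. b \<in> S \<Longrightarrow> b i \<in> bounded_ops"
  shows "hsubspace (col_range S)"
proof -
  have "(\<lambda>i. scaleC c (x i)) \<in> col_range S" if "x \<in> col_range S" for c x
    using that
  proof (induction rule: col_range.induct)
    case (step b \<omega> \<eta>)
    then show ?case
      using col_range.step[of b S "\<lambda>i. scaleC c (\<omega> i)" "scaleC c \<eta>"] assms
      by (simp add: scaleC_add_right bounded_opsD)
  qed (simp add: col_range.zero)
  then show ?thesis
    by (auto simp: hsubspace_def col_range_add intro: col_range.zero)
qed

section \<open>Projection matrices that annihilate a set of columns\<close>

definition proj_on :: "'h::complex_hilbert oper set \<Rightarrow> 'i set \<Rightarrow> ('i \<Rightarrow> 'i \<Rightarrow> 'h oper) \<Rightarrow> bool" where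
  "proj_on A I F \<longleftrightarrow> (\<forall>i\<in>I. \<forall>j\<in>I. F i j \<in> A \<and> (\<Sum>k\<in>I. F i k o\<^sub>L F k j) = F i j \<and> op_adj (F j i) = F i j)"

lemma projection_matrix_iff: "projection_matrix A n F \<longleftrightarrow> proj_on A {..<n} F"
  by (auto simp: projection_matrix_def proj_on_def)

definition mat_apply :: "'i set \<Rightarrow> ('i \<Rightarrow> 'i \<Rightarrow> 'h::complex_hilbert oper) \<Rightarrow> ('i \<Rightarrow> 'h) \<Rightarrow> 'i \<Rightarrow> 'h" where
  "mat_apply I F \<xi> i = (\<Sum>j\<in>I. blinfun_apply (F i j) (\<xi> j))"

text \<open>The rows \<open>y\<close> in the last clause are arbitrary rows of bounded operators: an
  annihilator over \<open>B\<close> has to fix rows over \<open>A\<close>, and in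
  \<open>unit_map_faithful\<close> also rows of commutators with elements of the commutant of
  \<open>B\<close>.\<close>

definition is_ann :: "'h::complex_hilbert oper set \<Rightarrow> 'i set \<Rightarrow> ('i \<Rightarrow> 'h oper) set \<Rightarrow>
    ('i \<Rightarrow> 'i \<Rightarrow> 'h oper) \<Rightarrow> bool" where
  "is_ann A I S F \<longleftrightarrow> proj_on A I F \<and>
     (\<forall>b\<in>S. \<forall>i\<in>I. (\<Sum>j\<in>I. F i j o\<^sub>L b j) = 0) \<and>
     (\<forall>y. (\<forall>i\<in>I. y i \<in> bounded_ops) \<longrightarrow> (\<forall>b\<in>S. (\<Sum>i\<in>I. y i o\<^sub>L b i) = 0) \<longrightarrow>
        (\<forall>j\<in>I. (\<Sum>i\<in>I. y i o\<^sub>L F i j) = y j))"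

lemma von_neumann_bounded: "von_neumann_algebra A \<Longrightarrow> T \<in> A \<Longrightarrow> T \<in> bounded_ops"
  by (auto simp: von_neumann_algebra_def cstar_algebra_def)

lemma commutant_adj:
  assumes "\<And>S. S \<in> A \<Longrightarrow> S \<in> bounded_ops \<and> op_adj S \<in> A" "T \<in> commutant A"
  shows "op_adj T \<in> commutant A"
proof -
  have T: "T \<in> bounded_ops" using assms by (simp add: commutant_def)
  have "op_adj T o\<^sub>L S = S o\<^sub>L op_adj T" if "S \<in> A" for S
  proof -
    have "T o\<^sub>L op_adj S = op_adj S o\<^sub>L T" using that assms by (auto simp: commutant_def)
    then have "op_adj (T o\<^sub>L op_adj S) = op_adj (op_adj S o\<^sub>L T)" by simp
    then show ?thesis using that assms T by (simp add: op_adj_compose op_adj_op_adj)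
  qed
  then show ?thesis using T by (simp add: commutant_def op_adj_closed)
qed

context
  fixes A :: "'h::complex_hilbert oper set" and I :: "'i set" and S :: "('i \<Rightarrow> 'h oper) set"
  assumes A: "von_neumann_algebra A" and I: "finite I" and S: "\<And>b i. b \<in> S \<Longrightarrow> i \<in> I \<Longrightarrow> b i \<in> A"
begin

text \<open>Boundedness is asked of all coordinates because \<open>hsubspace\<close> speaks of
  functions on the whole index type; \<open>ann_exists_strong\<close> removes this by setting the
  columns to zero off \<open>I\<close>.\<close>

lemma ann_exists_aux:
  assumes S0: "\<And>b i. b \<in> S \<Longrightarrow> b i \<in> bounded_ops"
  shows "\<exists>F. is_ann A I S F \<and> (\<forall>\<xi>. hproj I (col_range S) \<xi> (mat_apply I F \<xi>))"
proof -
  let ?\<Omega> = "col_range S"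
  have \<Omega>: "hsubspace ?\<Omega>" using hsubspace_col_range S0 by blast
  obtain N where N: "\<And>\<xi>. hproj I ?\<Omega> \<xi> (N \<xi>)" using hproj_exists[OF I \<Omega>] by metis
  have NI: "N \<xi> i = \<nu> i" if "hproj I ?\<Omega> \<xi> \<nu>" "i \<in> I" for \<xi> \<nu> i
    using hproj_unique[OF I \<Omega> N that] .
  \<comment> \<open>The vector with \<open>\<eta>\<close> in position \<open>j\<close>. The matrix
    entries of the projection are read off by feeding it such vectors.\<close>
  define e where "e j \<eta> = (\<lambda>i. if i = j then \<eta> else 0)" for j :: 'i and \<eta> :: 'h
  have hin_e: "hinner I \<xi> (e j y) = cinner (\<xi> j) y" if "j \<in> I" for \<xi> j y
  proof -
    have "hinner I \<xi> (e j y) = (\<Sum>i\<in>I. if j = i then cinner (\<xi> i) y else 0)"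
      unfolding hinner_def e_def by (intro sum.cong) auto
    then show ?thesis using that I by simp
  qed
  have hin_e': "hinner I (e j y) \<xi> = cinner y (\<xi> j)" if "j \<in> I" for \<xi> j y
    by (subst hinner_commute, subst hin_e[OF that], subst cinner_commute) simp
  have n_e: "hnorm2 I (e j \<eta>) = (norm \<eta>)\<^sup>2" if "j \<in> I" for j \<eta>
    using hinner_self[of I "e j \<eta>"] hin_e[OF that, of "e j \<eta>" \<eta>] cinner_self[of \<eta>]
    by (metis e_def of_real_eq_iff)
  define F where "F i j = Blinfun (\<lambda>\<eta>. N (e j \<eta>) i)" for i j
  have F: "blinfun_apply (F i j) \<eta> = N (e j \<eta>) i" if "i \<in> I" "j \<in> I" for i j \<eta>
  proof -
    have "bounded_linear (\<lambda>\<eta>. N (e j \<eta>) i)"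
    proof (rule bounded_linear_intro[where K = 1])
      fix x y and r :: real
      have "hproj I ?\<Omega> (e j (x + y)) (\<lambda>i. N (e j x) i + N (e j y) i)"
        by (rule hproj_cong[OF hproj_add[OF \<Omega> N N]]) (simp add: e_def)
      then show "N (e j (x + y)) i = N (e j x) i + N (e j y) i" using NI that by blast
      have "hproj I ?\<Omega> (e j (r *\<^sub>R x)) (\<lambda>i. scaleC (of_real r) (N (e j x) i))"
        by (rule hproj_cong[OF hproj_scaleC[OF \<Omega> N]]) (simp add: e_def scaleR_scaleC)
      then show "N (e j (r *\<^sub>R x)) i = r *\<^sub>R N (e j x) i" using NI that by (simp add: scaleR_scaleC)
      have "(norm (N (e j x) i))\<^sup>2 \<le> hnorm2 I (N (e j x))"
        unfolding hnorm2_def using that I by (intro member_le_sum) auto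
      also have "\<dots> \<le> hnorm2 I (e j x)"
        using hproj_norm[OF N, of "e j x"] by simp
      finally have "(norm (N (e j x) i))\<^sup>2 \<le> (norm x)\<^sup>2" by (simp add: n_e that)
      then show "norm (N (e j x) i) \<le> norm x * 1" by simp
    qed
    then show ?thesis by (simp add: F_def bounded_linear_Blinfun_apply)
  qed
  have FN: "mat_apply I F \<xi> i = N \<xi> i" if "i \<in> I" for \<xi> i
  proof -
    have "hproj I ?\<Omega> \<xi> (\<lambda>i. \<Sum>j\<in>I. N (e j (\<xi> j)) i)"
      by (rule hproj_cong[OF hproj_sum[OF \<Omega> N]]) (simp add: e_def I)
    then show ?thesis using NI[of \<xi>] that by (simp add: mat_apply_def F)
  qed
  have hpF: "hproj I ?\<Omega> \<xi> (mat_apply I F \<xi>)" for \<xi>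
    using N[of \<xi>] by (simp add: hproj_def hinner_def FN)
  have adj: "op_adj (F j i) = F i j" if "i \<in> I" "j \<in> I" for i j
  proof (rule op_adj_eqI)
    fix x y
    have "hinner I (N (e i x)) (e j y) = hinner I (e i x) (N (e j y))"
      by (rule hproj_symmetric[OF N N])
    then show "cinner (blinfun_apply (F j i) x) y = cinner x (blinfun_apply (F i j) y)"
      using that by (simp add: F hin_e hin_e')
  qed
  have idem: "(\<Sum>k\<in>I. F i k o\<^sub>L F k j) = F i j" if "i \<in> I" "j \<in> I" for i j
  proof (rule blinfun_eqI)
    fix \<eta>
    have "blinfun_apply (\<Sum>k\<in>I. F i k o\<^sub>L F k j) \<eta> = mat_apply I F (N (e j \<eta>)) i"
      using that by (simp add: blinfun.sum_left mat_apply_def F)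
    also have "\<dots> = N (N (e j \<eta>)) i" using that by (simp add: FN)
    also have "\<dots> = N (e j \<eta>) i"
      using N[of "e j \<eta>"] that by (intro NI hproj_fixed[OF \<Omega>]) (auto simp: hproj_def)
    finally show "blinfun_apply (\<Sum>k\<in>I. F i k o\<^sub>L F k j) \<eta> = blinfun_apply (F i j) \<eta>"
      using that by (simp add: F)
  qed
  have star: "T \<in> bounded_ops \<and> op_adj T \<in> A" if "T \<in> A" for T
    using A that by (auto simp: von_neumann_algebra_def cstar_algebra_def)
  have com: "F i j o\<^sub>L T = T o\<^sub>L F i j" if T: "T \<in> commutant A" and ij: "i \<in> I" "j \<in> I" for T i j
  proof (rule blinfun_eqI)
    fix \<eta>
    have map: "\<exists>z\<in>?\<Omega>. \<forall>i\<in>I. blinfun_apply T (x i) = z i" if "x \<in> ?\<Omega>" "T \<in> commutant A" for x T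
      by (rule col_range_map[OF that(1), where g = "blinfun_apply T"])
        (use that S in \<open>auto simp: blinfun.add_right commutant_def simp flip: blinfun_apply_blinfun_compose\<close>)
    have Tb: "T \<in> bounded_ops" using T by (simp add: commutant_def)
    \<comment> \<open>\<open>T\<close> applied coordinatewise to a projection gives the projection
      of the image: invariance of the span under the adjoint of \<open>T\<close> keeps the result
      orthogonal to it, and invariance under \<open>T\<close> keeps the remainder in its
      closure.\<close>
    have "hproj I ?\<Omega> (\<lambda>i. blinfun_apply T (e j \<eta> i)) (\<lambda>i. blinfun_apply T (N (e j \<eta>) i))"
      unfolding hproj_def
    proof (intro conjI ballI)
      fix x assume "x \<in> ?\<Omega>"
      then obtain z where z: "z \<in> ?\<Omega>" "\<And>i. i \<in> I \<Longrightarrow> blinfun_apply (op_adj T) (x i) = z i"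
        using map[OF _ commutant_adj[OF star T]] by blast
      have "hinner I (\<lambda>i. blinfun_apply T (N (e j \<eta>) i)) x = hinner I (N (e j \<eta>)) z"
        unfolding hinner_def using z(2) by (intro sum.cong) (auto simp: cinner_op_adj[OF Tb])
      then show "hinner I (\<lambda>i. blinfun_apply T (N (e j \<eta>) i)) x = 0"
        using N[of "e j \<eta>"] z(1) by (simp add: hproj_def)
    next
      obtain \<omega> where \<omega>: "\<And>n::nat. \<omega> n \<in> ?\<Omega>" "\<And>i. i \<in> I \<Longrightarrow> (\<lambda>n. \<omega> n i) \<longlonglongrightarrow> e j \<eta> i - N (e j \<eta>) i"
        using N[of "e j \<eta>"] by (auto simp: hproj_def)
      obtain z where z: "\<And>n. z n \<in> ?\<Omega>" "\<And>n i. i \<in> I \<Longrightarrow> blinfun_apply T (\<omega> n i) = z n i"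
        using map[OF \<omega>(1) T] by metis
      have "(\<lambda>n. z n i) \<longlonglongrightarrow> blinfun_apply T (e j \<eta> i) - blinfun_apply T (N (e j \<eta>) i)" if "i \<in> I" for i
        unfolding z(2)[OF that, symmetric] blinfun.diff_right[symmetric]
        by (intro blinfun.tendsto tendsto_const \<omega>(2) that)
      then show "\<exists>z. (\<forall>n::nat. z n \<in> ?\<Omega>) \<and> (\<forall>i\<in>I. (\<lambda>n. z n i) \<longlonglongrightarrow>
          blinfun_apply T (e j \<eta> i) - blinfun_apply T (N (e j \<eta>) i))"
        using z(1) by blast
    qed
    then have "hproj I ?\<Omega> (e j (blinfun_apply T \<eta>)) (\<lambda>i. blinfun_apply T (N (e j \<eta>) i))"
      by (rule hproj_cong) (simp add: e_def)
    from NI[OF this ij(1)]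
    show "blinfun_apply (F i j o\<^sub>L T) \<eta> = blinfun_apply (T o\<^sub>L F i j) \<eta>"
      using ij by (simp add: F)
  qed
  have FA: "F i j \<in> A" if "i \<in> I" "j \<in> I" for i j
  proof -
    have "F i j \<in> bounded_ops"
    proof -
      have "N (e j (scaleC c x)) i = scaleC c (N (e j x) i)" for c x
      proof -
        have "hproj I ?\<Omega> (e j (scaleC c x)) (\<lambda>i. scaleC c (N (e j x) i))"
          by (rule hproj_cong[OF hproj_scaleC[OF \<Omega> N]]) (simp add: e_def)
        then show ?thesis using NI that by blast
      qed
      then show ?thesis using that by (simp add: bounded_ops_def F)
    qed
    then have "F i j \<in> commutant (commutant A)"
      using com that by (simp add: commutant_def[of "commutant A"])
    then show ?thesis using A by (simp add: von_neumann_algebra_def)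
  qed
  have zero: "(\<Sum>j\<in>I. F i j o\<^sub>L b j) = 0" if "b \<in> S" "i \<in> I" for b i
  proof (rule blinfun_eqI)
    fix \<eta>
    have "(\<lambda>i. blinfun_apply (b i) \<eta>) \<in> ?\<Omega>"
      using col_range.step[OF that(1) col_range.zero] by simp
    then have "hproj I ?\<Omega> (\<lambda>i. blinfun_apply (b i) \<eta>) (\<lambda>i. 0)" by (rule hproj_in)
    from NI[OF this that(2)] FN[OF that(2), of "\<lambda>i. blinfun_apply (b i) \<eta>"]
    show "blinfun_apply (\<Sum>j\<in>I. F i j o\<^sub>L b j) \<eta> = blinfun_apply 0 \<eta>"
      by (simp add: blinfun.sum_left mat_apply_def)
  qed
  have fixed: "(\<Sum>i\<in>I. y i o\<^sub>L F i j) = y j"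
    if y: "\<And>i. i \<in> I \<Longrightarrow> y i \<in> bounded_ops" "\<And>b. b \<in> S \<Longrightarrow> (\<Sum>i\<in>I. y i o\<^sub>L b i) = 0"
      and j: "j \<in> I" for y j
  proof (rule blinfun_eqI)
    fix \<zeta>
    have "cinner \<eta> (blinfun_apply (\<Sum>i\<in>I. y i o\<^sub>L F i j) \<zeta>) = cinner \<eta> (blinfun_apply (y j) \<zeta>)" for \<eta>
    proof -
      \<comment> \<open>That \<open>y\<close> kills \<open>S\<close> means that the vector of all
        \<open>op_adj (y i) \<eta>\<close> is orthogonal to the span, hence fixed by the projection.
        Moving \<open>y\<close> and \<open>F\<close> back across the inner product gives
        \<open>y F = y\<close>.\<close>
      define \<xi> where "\<xi> i = blinfun_apply (op_adj (y i)) \<eta>" for i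
      have "hinner I \<xi> x = 0" if "x \<in> ?\<Omega>" for x
        using that
      proof (induction rule: col_range.induct)
        case (step b \<omega> \<zeta>)
        have "hinner I \<xi> (\<lambda>i. blinfun_apply (b i) \<zeta>) = cinner \<eta> (blinfun_apply (\<Sum>i\<in>I. y i o\<^sub>L b i) \<zeta>)"
          by (simp add: hinner_def \<xi>_def blinfun.sum_left cinner_sum_right cinner_op_adj_left y(1))
        then have "hinner I \<xi> (\<lambda>i. blinfun_apply (b i) \<zeta>) = 0" using y(2) step by simp
        with step show ?case by (simp add: hinner_def cinner_add_right sum.distrib)
      qed (simp add: hinner_def)
      then have "hproj I ?\<Omega> \<xi> \<xi>" using hproj_fixed[OF \<Omega>] by blast
      from NI[OF this j] FN[OF j, of \<xi>] have "(\<Sum>i\<in>I. blinfun_apply (F j i) (\<xi> i)) = \<xi> j"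
        by (simp add: mat_apply_def)
      then have "cinner (\<Sum>i\<in>I. blinfun_apply (F j i) (\<xi> i)) \<zeta> = cinner (\<xi> j) \<zeta>" by simp
      moreover have "cinner (\<Sum>i\<in>I. blinfun_apply (F j i) (\<xi> i)) \<zeta>
          = cinner \<eta> (blinfun_apply (\<Sum>i\<in>I. y i o\<^sub>L F i j) \<zeta>)"
        unfolding cinner_sum_left blinfun.sum_left cinner_sum_right
      proof (rule sum.cong[OF refl])
        fix i assume i: "i \<in> I"
        have "cinner (blinfun_apply (F j i) (\<xi> i)) \<zeta> = cinner (\<xi> i) (blinfun_apply (F i j) \<zeta>)"
          using cinner_op_adj[of "F j i" "\<xi> i" \<zeta>] adj FA i j star by simp
        then show "cinner (blinfun_apply (F j i) (\<xi> i)) \<zeta> = cinner \<eta> (blinfun_apply (y i o\<^sub>L F i j) \<zeta>)"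
          by (simp add: \<xi>_def cinner_op_adj_left y(1) i)
      qed
      ultimately show ?thesis by (simp add: \<xi>_def cinner_op_adj_left y(1) j)
    qed
    then show "blinfun_apply (\<Sum>i\<in>I. y i o\<^sub>L F i j) \<zeta> = blinfun_apply (y j) \<zeta>" by (rule cinner_eqI)
  qed
  have "proj_on A I F" by (simp add: proj_on_def FA idem adj)
  then have "is_ann A I S F" unfolding is_ann_def using zero fixed by simp
  with hpF show ?thesis by blast
qed

end

lemma col_range_restrict:
  "\<omega> \<in> col_range S \<Longrightarrow> \<exists>\<omega>'\<in>col_range ((\<lambda>b i. if i \<in> I then b i else 0) ` S). \<forall>i\<in>I. \<omega>' i = \<omega> i"
proof (induction rule: col_range.induct)
  case (step b \<omega> \<eta>)
  then obtain \<omega>' where \<omega>': "\<omega>' \<in> col_range ((\<lambda>b i. if i \<in> I then b i else 0) ` S)" "\<forall>i\<in>I. \<omega>' i = \<omega> i"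
    by blast
  from col_range.step[OF imageI[OF step.hyps(1)] \<omega>'(1), of \<eta>] \<omega>'(2)
  show ?case by (intro bexI) auto
qed (auto intro: col_range.zero bexI[of _ "\<lambda>i. 0"])

lemma col_range_restrict':
  "\<omega> \<in> col_range ((\<lambda>b i. if i \<in> I then b i else 0) ` S) \<Longrightarrow> \<exists>\<omega>'\<in>col_range S. \<forall>i\<in>I. \<omega>' i = \<omega> i"
proof (induction rule: col_range.induct)
  case (step c \<omega> \<eta>)
  then obtain \<omega>' b where \<omega>': "\<omega>' \<in> col_range S" "\<forall>i\<in>I. \<omega>' i = \<omega> i" "b \<in> S" "c = (\<lambda>i. if i \<in> I then b i else 0)"
    by blast
  from col_range.step[OF \<omega>'(3,1), of \<eta>] \<omega>'(2,4)
  show ?case by (intro bexI) auto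
qed (auto intro: col_range.zero bexI[of _ "\<lambda>i. 0"])

text \<open>The two estimates say that the squared norm of the projected vector is the squared
  distance of \<open>\<xi>\<close> from the span of \<open>S\<close>. In the operator order,
  annihilators of different sets are compared through these distances.\<close>

lemma ann_exists_strong:
  fixes A :: "'h::complex_hilbert oper set"
  assumes A: "von_neumann_algebra A" and I: "finite I" and S: "\<And>b i. b \<in> S \<Longrightarrow> i \<in> I \<Longrightarrow> b i \<in> A"
  shows "\<exists>F. is_ann A I S F \<and>
    (\<forall>\<xi>. \<forall>\<omega>\<in>col_range S. hnorm2 I (mat_apply I F \<xi>) \<le> hnorm2 I (\<lambda>i. \<xi> i - \<omega> i)) \<and>
    (\<forall>\<xi>. \<forall>\<epsilon>>0. \<exists>\<omega>\<in>col_range S. hnorm2 I (\<lambda>i. \<xi> i - \<omega> i) < hnorm2 I (mat_apply I F \<xi>) + \<epsilon>)"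
proof -
  define S' where "S' = (\<lambda>b i. if i \<in> I then b i else 0) ` S"
  have "0 \<in> A" using A by (simp add: von_neumann_algebra_def cstar_algebra_def)
  then have S': "b i \<in> A" if "b \<in> S'" for b i using S that by (auto simp: S'_def)
  then have S'b: "b i \<in> bounded_ops" if "b \<in> S'" for b i using that A von_neumann_bounded by blast
  obtain F where F: "is_ann A I S' F" "\<And>\<xi>. hproj I (col_range S') \<xi> (mat_apply I F \<xi>)"
    using ann_exists_aux[of A I S'] A I S' S'b by blast
  have sub: "hsubspace (col_range S')" using hsubspace_col_range S'b by blast
  have "is_ann A I S F" using F(1) unfolding is_ann_def S'_def ball_simps by (simp cong: sum.cong)
  moreover have "hnorm2 I (mat_apply I F \<xi>) \<le> hnorm2 I (\<lambda>i. \<xi> i - \<omega> i)" if \<omega>: "\<omega> \<in> col_range S" for \<xi> \<omega>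
  proof -
    obtain \<omega>' where \<omega>': "\<omega>' \<in> col_range S'" "\<forall>i\<in>I. \<omega>' i = \<omega> i"
      using col_range_restrict[OF \<omega>] by (auto simp: S'_def)
    have "hproj I (col_range S') (\<lambda>i. \<xi> i + scaleC (-1) (\<omega>' i)) (\<lambda>i. mat_apply I F \<xi> i + scaleC (-1) 0)"
      by (intro hproj_add hproj_scaleC F hproj_in sub \<omega>')
    from hproj_norm[OF this] \<omega>'(2) show ?thesis
      using hnorm2_nonneg[of I "\<lambda>i. \<xi> i + scaleC (- 1) (\<omega>' i) - mat_apply I F \<xi> i"]
      by (simp add: scaleC_minus1 hnorm2_def)
  qed
  moreover have "\<exists>\<omega>\<in>col_range S. hnorm2 I (\<lambda>i. \<xi> i - \<omega> i) < hnorm2 I (mat_apply I F \<xi>) + \<epsilon>" if "\<epsilon> > 0" for \<xi> \<epsilon>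
  proof -
    obtain \<omega> where \<omega>: "\<forall>n::nat. \<omega> n \<in> col_range S'" "\<forall>i\<in>I. (\<lambda>n. \<omega> n i) \<longlonglongrightarrow> \<xi> i - mat_apply I F \<xi> i"
      using F(2)[of \<xi>] unfolding hproj_def by blast
    have "(\<lambda>n. hnorm2 I (\<lambda>i. \<xi> i - \<omega> n i)) \<longlonglongrightarrow> hnorm2 I (\<lambda>i. \<xi> i - (\<xi> i - mat_apply I F \<xi> i))"
      unfolding hnorm2_def using \<omega>(2) by (intro tendsto_intros) auto
    then have "\<forall>\<^sub>F n in sequentially. hnorm2 I (\<lambda>i. \<xi> i - \<omega> n i) < hnorm2 I (mat_apply I F \<xi>) + \<epsilon>"
      using that by (intro order_tendstoD(2)) (auto simp: hnorm2_def)
    then obtain n where n: "hnorm2 I (\<lambda>i. \<xi> i - \<omega> n i) < hnorm2 I (mat_apply I F \<xi>) + \<epsilon>"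
      unfolding eventually_sequentially by blast
    obtain \<omega>' where "\<omega>' \<in> col_range S" "\<forall>i\<in>I. \<omega>' i = \<omega> n i"
      using col_range_restrict'[of "\<omega> n" I S] \<omega>(1) by (auto simp: S'_def)
    with n show ?thesis by (intro bexI[of _ \<omega>']) (simp_all add: hnorm2_def)
  qed
  ultimately show ?thesis by blast
qed

lemma ann_exists:
  assumes "von_neumann_algebra A" "finite I" "\<forall>b\<in>S. \<forall>i\<in>I. b i \<in> A"
  shows "\<exists>F. is_ann A I S F"
  using ann_exists_strong[of A I S] assms by blast

lemma is_annD:
  assumes "is_ann A I S F"
  shows "proj_on A I F"
    and "b \<in> S \<Longrightarrow> i \<in> I \<Longrightarrow> (\<Sum>j\<in>I. F i j o\<^sub>L b j) = 0"
    and "(\<And>i. i \<in> I \<Longrightarrow> y i \<in> bounded_ops) \<Longrightarrow> (\<And>b. b \<in> S \<Longrightarrow> (\<Sum>i\<in>I. y i o\<^sub>L b i) = 0) \<Longrightarrow>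
        j \<in> I \<Longrightarrow> (\<Sum>i\<in>I. y i o\<^sub>L F i j) = y j"
  using assms by (simp_all add: is_ann_def)

lemma proj_onD:
  assumes "proj_on A I F" "i \<in> I" "j \<in> I"
  shows "F i j \<in> A" "(\<Sum>k\<in>I. F i k o\<^sub>L F k j) = F i j" "op_adj (F j i) = F i j"
  using assms by (simp_all add: proj_on_def)

text \<open>Each fixes the rows of the other, so \<open>F G = F\<close> and \<open>G F = G\<close>;
  the adjoint of the second equation is \<open>F G = G\<close>.\<close>

lemma ann_unique:
  assumes A: "von_neumann_algebra A" and F: "is_ann A I S F" and G: "is_ann A I S G" and ij: "i \<in> I" "j \<in> I"
  shows "F i j = G i j"
proof -
  note PF = proj_onD[OF is_annD(1)[OF F]] and PG = proj_onD[OF is_annD(1)[OF G]]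
  have bF: "F i j \<in> bounded_ops" and bG: "G i j \<in> bounded_ops" if "i \<in> I" "j \<in> I" for i j
    using PF(1) PG(1) von_neumann_bounded[OF A] that by blast+
  have 1: "(\<Sum>k\<in>I. F i k o\<^sub>L G k j) = F i j" if "i \<in> I" "j \<in> I" for i j
    using is_annD(3)[OF G, of "F i"] bF is_annD(2)[OF F] that by simp
  have 2: "(\<Sum>k\<in>I. G j k o\<^sub>L F k i) = G j i"
    using is_annD(3)[OF F, of "G j"] bG is_annD(2)[OF G] ij by simp
  have "op_adj (\<Sum>k\<in>I. G j k o\<^sub>L F k i) = (\<Sum>k\<in>I. F i k o\<^sub>L G k j)"
    using ij by (simp add: op_adj_sum bounded_ops_compose bF bG op_adj_compose PF(3) PG(3) cong: sum.cong)
  with 1[OF ij] 2 ij show ?thesis by (simp add: PG(3))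
qed

text \<open>By uniqueness, every annihilator inherits the description by distances from the one
  constructed above.\<close>

lemma
  fixes A :: "'h::complex_hilbert oper set"
  assumes A: "von_neumann_algebra A" and I: "finite I" and S: "\<forall>b\<in>S. \<forall>i\<in>I. b i \<in> A"
    and F: "is_ann A I S F"
  shows ann_upper: "\<omega> \<in> col_range S \<Longrightarrow> hnorm2 I (mat_apply I F \<xi>) \<le> hnorm2 I (\<lambda>i. \<xi> i - \<omega> i)"
    and ann_approx: "\<epsilon> > 0 \<Longrightarrow>
      \<exists>\<omega>\<in>col_range S. hnorm2 I (\<lambda>i. \<xi> i - \<omega> i) < hnorm2 I (mat_apply I F \<xi>) + \<epsilon>"
proof -
  obtain G where G: "is_ann A I S G"
    "\<And>\<xi> \<omega>. \<omega>\<in>col_range S \<Longrightarrow> hnorm2 I (mat_apply I G \<xi>) \<le> hnorm2 I (\<lambda>i. \<xi> i - \<omega> i)"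
    "\<And>\<xi> \<epsilon>. \<epsilon> > 0 \<Longrightarrow> \<exists>\<omega>\<in>col_range S. hnorm2 I (\<lambda>i. \<xi> i - \<omega> i) < hnorm2 I (mat_apply I G \<xi>) + \<epsilon>"
    using ann_exists_strong[of A I S] A I S by blast
  have "hnorm2 I (mat_apply I G \<xi>) = hnorm2 I (mat_apply I F \<xi>)"
    using ann_unique[OF A F G(1)] by (simp add: hnorm2_def mat_apply_def cong: sum.cong)
  with G(2,3) show "\<omega> \<in> col_range S \<Longrightarrow> hnorm2 I (mat_apply I F \<xi>) \<le> hnorm2 I (\<lambda>i. \<xi> i - \<omega> i)"
    "\<epsilon> > 0 \<Longrightarrow> \<exists>\<omega>\<in>col_range S. hnorm2 I (\<lambda>i. \<xi> i - \<omega> i) < hnorm2 I (mat_apply I F \<xi>) + \<epsilon>"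
    by metis+
qed

text \<open>\<open>F i i\<close> is the sum of the products
  \<open>op_adj (F k i) o\<^sub>L F k i\<close>, so its quadratic form is the squared norm of column
  \<open>i\<close> applied to \<open>\<eta>\<close>. Order relations between diagonal entries thus
  become inequalities between distances.\<close>

lemma cinner_proj_on_diag:
  assumes A: "von_neumann_algebra A" and "finite I" and F: "proj_on A I F" and i: "i \<in> I"
  shows "cinner (blinfun_apply (F i i) \<eta>) \<eta> =
    of_real (hnorm2 I (mat_apply I F (\<lambda>j. if j = i then \<eta> else 0)))"
proof -
  note PF = proj_onD[OF F]
  have *: "mat_apply I F (\<lambda>j. if j = i then \<eta> else 0) k = blinfun_apply (F k i) \<eta>" if "k \<in> I" for k
  proof -
    have "mat_apply I F (\<lambda>j. if j = i then \<eta> else 0) k = (\<Sum>j\<in>I. if i = j then blinfun_apply (F k j) \<eta> else 0)"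
      unfolding mat_apply_def by (intro sum.cong) auto
    then show ?thesis using i assms(2) by simp
  qed
  have "cinner (blinfun_apply (F i i) \<eta>) \<eta> = cinner (blinfun_apply (\<Sum>k\<in>I. F i k o\<^sub>L F k i) \<eta>) \<eta>"
    using PF(2)[OF i i] by simp
  also have "\<dots> = (\<Sum>k\<in>I. cinner (blinfun_apply (F i k) (blinfun_apply (F k i) \<eta>)) \<eta>)"
    by (simp add: blinfun.sum_left cinner_sum_left)
  also have "\<dots> = (\<Sum>k\<in>I. cinner (blinfun_apply (F k i) \<eta>) (blinfun_apply (F k i) \<eta>))"
    using i von_neumann_bounded[OF A] PF(1,3) by (intro sum.cong refl) (metis cinner_op_adj)
  also have "\<dots> = of_real (hnorm2 I (mat_apply I F (\<lambda>j. if j = i then \<eta> else 0)))"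
    by (simp add: hnorm2_def * cinner_self cong: sum.cong)
  finally show ?thesis .
qed

section \<open>Traces of projections\<close>

text \<open>Any finite index set is allowed, so that block matrices can be indexed by disjoint sums
  \<open>I <+> J\<close>.\<close>

definition ptrace :: "('h oper \<Rightarrow> complex) \<Rightarrow> 'i set \<Rightarrow> ('i \<Rightarrow> 'i \<Rightarrow> 'h::complex_hilbert oper) \<Rightarrow> real" where
  "ptrace tr I F = (\<Sum>i\<in>I. Re (tr (F i i)))"

locale vn_algebra =
  fixes A :: "'h::complex_hilbert oper set"
  assumes vN: "von_neumann_algebra A"
begin

lemma bounded: "T \<in> A \<Longrightarrow> T \<in> bounded_ops"
  using vN by (rule von_neumann_bounded)

lemma zero_mem [simp]: "0 \<in> A" and
  add_mem: "S \<in> A \<Longrightarrow> T \<in> A \<Longrightarrow> S + T \<in> A" and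
  compose_mem: "S \<in> A \<Longrightarrow> T \<in> A \<Longrightarrow> S o\<^sub>L T \<in> A" and
  adj_mem: "T \<in> A \<Longrightarrow> op_adj T \<in> A" and
  scaleC_mem: "T \<in> A \<Longrightarrow> op_scaleC c T \<in> A"
  using vN by (simp_all add: von_neumann_algebra_def cstar_algebra_def)

lemma id_mem [simp]: "id_blinfun \<in> A"
proof -
  have "id_blinfun \<in> commutant (commutant A)"
    by (auto simp: commutant_def bounded_ops_id intro!: blinfun_eqI)
  then show ?thesis using vN by (simp add: von_neumann_algebra_def)
qed

lemma scaleR_mem: "T \<in> A \<Longrightarrow> r *\<^sub>R T \<in> A"
proof -
  assume "T \<in> A"
  moreover have "op_scaleC (of_real r) T = r *\<^sub>R T"
    by (rule blinfun_eqI) (simp add: op_scaleC_apply blinfun.scaleR_left scaleR_scaleC)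
  ultimately show ?thesis using scaleC_mem by metis
qed

lemma minus_mem: "T \<in> A \<Longrightarrow> - T \<in> A"
  using scaleR_mem[of T "-1"] by simp

lemma diff_mem: "S \<in> A \<Longrightarrow> T \<in> A \<Longrightarrow> S - T \<in> A"
  using add_mem[of S "- T"] minus_mem by simp

lemma sum_mem: "(\<And>i. i \<in> I \<Longrightarrow> f i \<in> A) \<Longrightarrow> sum f I \<in> A"
  by (induction I rule: infinite_finite_induct) (simp_all add: add_mem)

lemmas closed = zero_mem add_mem compose_mem adj_mem id_mem scaleR_mem minus_mem diff_mem sum_mem

end

lemma compose_sum_left: "(\<Sum>i\<in>I. f i) o\<^sub>L T = (\<Sum>i\<in>I. f i o\<^sub>L T)"
  by (rule blinfun_eqI) (simp add: blinfun.sum_left)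

lemma compose_sum_right: "T o\<^sub>L (\<Sum>i\<in>I. f i) = (\<Sum>i\<in>I. T o\<^sub>L f i)"
  by (rule blinfun_eqI) (simp add: blinfun.sum_left blinfun.sum_right)

lemma compose_diff_left: "(S - T) o\<^sub>L U = (S o\<^sub>L U) - (T o\<^sub>L U)"
  by (rule blinfun_eqI) (simp add: blinfun.diff_left)

lemma compose_diff_right: "U o\<^sub>L (S - T) = (U o\<^sub>L S) - (U o\<^sub>L T)"
  by (rule blinfun_eqI) (simp add: blinfun.diff_left blinfun.diff_right)

lemma compose_add_left: "(S + T) o\<^sub>L U = (S o\<^sub>L U) + (T o\<^sub>L U)"
  by (rule blinfun_eqI) (simp add: blinfun.add_left)

lemma compose_add_right: "U o\<^sub>L (S + T) = (U o\<^sub>L S) + (U o\<^sub>L T)"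
  by (rule blinfun_eqI) (simp add: blinfun.add_left blinfun.add_right)

lemma compose_minus_left: "(- S) o\<^sub>L U = - (S o\<^sub>L U)"
  by (rule blinfun_eqI) (simp add: blinfun.minus_left)

lemma compose_minus_right: "U o\<^sub>L (- S) = - (U o\<^sub>L S)"
  by (rule blinfun_eqI) (simp add: blinfun.minus_left blinfun.minus_right)

lemma compose_assoc: "(S o\<^sub>L T) o\<^sub>L U = S o\<^sub>L (T o\<^sub>L U)"
  by (rule blinfun_eqI) simp

lemma compose_id_left [simp]: "id_blinfun o\<^sub>L T = T"
  by (rule blinfun_eqI) simp

lemma compose_id_right [simp]: "T o\<^sub>L id_blinfun = T"
  by (rule blinfun_eqI) simp

lemma compose_scaleR_left: "(r *\<^sub>R S) o\<^sub>L U = r *\<^sub>R (S o\<^sub>L U)"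
  by (rule blinfun_eqI) (simp add: blinfun.scaleR_left)

lemma compose_scaleR_right: "U o\<^sub>L (r *\<^sub>R S) = r *\<^sub>R (U o\<^sub>L S)"
  by (rule blinfun_eqI) (simp add: blinfun.scaleR_left blinfun.scaleR_right)

lemma op_adj_diff: "S \<in> bounded_ops \<Longrightarrow> T \<in> bounded_ops \<Longrightarrow> op_adj (S - T) = op_adj S - op_adj T"
  by (rule op_adj_eqI) (simp add: blinfun.diff_left cinner_diff_left cinner_diff_right cinner_op_adj)

lemma op_adj_scaleR: "T \<in> bounded_ops \<Longrightarrow> op_adj (r *\<^sub>R T) = r *\<^sub>R op_adj T"
  by (rule op_adj_eqI)
    (simp add: blinfun.scaleR_left scaleR_scaleC cinner_scaleC_left cinner_scaleC_right cinner_op_adj)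

locale vn_trace = vn_algebra A for A :: "'h::complex_hilbert oper set" +
  fixes tr :: "'h oper \<Rightarrow> complex"
  assumes trace: "is_trace A tr"
begin

lemma tr_add: "S \<in> A \<Longrightarrow> T \<in> A \<Longrightarrow> tr (S + T) = tr S + tr T"
  and tr_commute: "S \<in> A \<Longrightarrow> T \<in> A \<Longrightarrow> tr (S o\<^sub>L T) = tr (T o\<^sub>L S)"
  and tr_adj_self: "T \<in> A \<Longrightarrow> tr (op_adj T o\<^sub>L T) \<in> \<real>\<^sub>\<ge>\<^sub>0"
  using trace by (simp_all add: is_trace_def)

lemma tr_diff: "S \<in> A \<Longrightarrow> T \<in> A \<Longrightarrow> tr (S - T) = tr S - tr T"
  using tr_add[of "S - T" T] by (simp add: closed)

lemma tr_zero [simp]: "tr 0 = 0"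
  using tr_diff[of 0 0] by simp

lemma tr_sum: "(\<And>i. i \<in> I \<Longrightarrow> f i \<in> A) \<Longrightarrow> tr (sum f I) = (\<Sum>i\<in>I. tr (f i))"
  by (induction I rule: infinite_finite_induct) (simp_all add: tr_add closed)

text \<open>Symmetry of the trace for a rectangular pair: \<open>F\<close> has the diagonal of
  \<open>u v\<close> and \<open>G\<close> that of \<open>v u\<close>. It is the source of every
  equality of traces below.\<close>

lemma ptrace_swap:
  assumes u: "\<And>i j. i \<in> I \<Longrightarrow> j \<in> J \<Longrightarrow> u i j \<in> A" and v: "\<And>i j. i \<in> I \<Longrightarrow> j \<in> J \<Longrightarrow> v j i \<in> A"
    and F: "\<And>i. i \<in> I \<Longrightarrow> F i i = (\<Sum>j\<in>J. u i j o\<^sub>L v j i)"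
    and G: "\<And>j. j \<in> J \<Longrightarrow> G j j = (\<Sum>i\<in>I. v j i o\<^sub>L u i j)"
  shows "ptrace tr I F = ptrace tr J G"
proof -
  have "ptrace tr I F = (\<Sum>i\<in>I. \<Sum>j\<in>J. Re (tr (u i j o\<^sub>L v j i)))"
    unfolding ptrace_def using u v by (intro sum.cong refl) (simp add: F tr_sum closed)
  also have "\<dots> = (\<Sum>i\<in>I. \<Sum>j\<in>J. Re (tr (v j i o\<^sub>L u i j)))"
    using u v tr_commute by (intro sum.cong refl arg_cong[where f = Re]) blast
  also have "\<dots> = (\<Sum>j\<in>J. \<Sum>i\<in>I. Re (tr (v j i o\<^sub>L u i j)))" by (rule sum.swap)
  also have "\<dots> = ptrace tr J G"
    unfolding ptrace_def using u v by (intro sum.cong refl) (simp add: G tr_sum closed)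
  finally show ?thesis .
qed

lemma tr_proj_diag_nonneg:
  assumes P: "proj_on A I P" and i: "i \<in> I"
  shows "0 \<le> Re (tr (P i i))"
proof -
  note P = proj_onD[OF P]
  have "tr (P i i) = (\<Sum>k\<in>I. tr (op_adj (P k i) o\<^sub>L P k i))"
    using P(2)[OF i i] i P(1,3) by (subst tr_sum[symmetric]) (auto simp: closed cong: sum.cong)
  then show ?thesis
    using tr_adj_self P(1) i by (auto simp: complex_nonneg_Reals_iff intro!: sum_nonneg)
qed

text \<open>From \<open>F G = F\<close> and its adjoint \<open>G F = F\<close>, the difference
  \<open>G - F\<close> is again a projection matrix. A single diagonal entry is treated because
  \<open>tr_graph_corner\<close> compares just one corner of a block matrix.\<close>

lemma tr_proj_diag_mono:
  assumes F: "proj_on A I F" and G: "proj_on A I G"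
    and FG: "\<And>i j. i \<in> I \<Longrightarrow> j \<in> I \<Longrightarrow> (\<Sum>k\<in>I. F i k o\<^sub>L G k j) = F i j" and i: "i \<in> I"
  shows "Re (tr (F i i)) \<le> Re (tr (G i i))"
proof -
  note F = proj_onD[OF F] and G = proj_onD[OF G]
  have GF: "(\<Sum>k\<in>I. G i k o\<^sub>L F k j) = F i j" if "i \<in> I" "j \<in> I" for i j
  proof -
    have "op_adj (\<Sum>k\<in>I. F j k o\<^sub>L G k i) = (\<Sum>k\<in>I. G i k o\<^sub>L F k j)"
      using that F(1) G(1) by (simp add: op_adj_sum bounded_ops_compose bounded op_adj_compose F(3) G(3) cong: sum.cong)
    then show ?thesis using that by (simp add: FG F(3))
  qed
  have "proj_on A I (\<lambda>i j. G i j - F i j)"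
    unfolding proj_on_def
    by (auto simp: closed F(1,2,3) G(1,2,3) FG GF op_adj_diff bounded compose_diff_left compose_diff_right sum_subtractf)
  from tr_proj_diag_nonneg[OF this i] show ?thesis using i F(1) G(1) by (simp add: tr_diff)
qed

lemma ptrace_mono:
  assumes "proj_on A I F" "proj_on A I G"
    and "\<And>i j. i \<in> I \<Longrightarrow> j \<in> I \<Longrightarrow> (\<Sum>k\<in>I. F i k o\<^sub>L G k j) = F i j"
  shows "ptrace tr I F \<le> ptrace tr I G"
  unfolding ptrace_def by (intro sum_mono tr_proj_diag_mono[OF assms])

end

section \<open>Normal traces and directed infima\<close>

locale normal_vn_trace = vn_trace A tr for A :: "'h::complex_hilbert oper set" and tr +
  assumes normal: "normal_trace A tr"
begin

text \<open>The two-element directed set \<open>{0, T}\<close> turns normality into monotonicity.\<close>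

lemma tr_pos:
  assumes T: "T \<in> A" "op_pos T"
  shows "0 \<le> Re (tr T)"
proof -
  have p0: "op_pos 0" by (simp add: op_pos_def)
  have "Re (tr T) = (SUP S\<in>{0, T}. Re (tr S))"
    using normal[unfolded normal_trace_def, rule_format, of "{0, T}" T] T p0
    by (auto simp: op_le_def)
  then have "Re (tr T) = max 0 (Re (tr T))" by (simp add: cSup_eq_Max)
  then show ?thesis by linarith
qed

lemma tr_mono: "S \<in> A \<Longrightarrow> T \<in> A \<Longrightarrow> op_le S T \<Longrightarrow> Re (tr S) \<le> Re (tr T)"
  using tr_pos[of "T - S"] by (simp add: op_le_def closed tr_diff)

text \<open>Normality speaks of suprema of positive elements, so it is applied to the operators
  \<open>id_blinfun - g l\<close>. That \<open>id_blinfun - f\<close> is their supremum is tested on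
  vectors, where the quadratic forms of the \<open>g l\<close> come arbitrarily close to that of
  \<open>f\<close>.\<close>

lemma tr_directed_inf:
  assumes \<Lambda>: "\<Lambda> \<noteq> {}"
    and A: "f \<in> A" "\<And>l. l \<in> \<Lambda> \<Longrightarrow> g l \<in> A"
    and le: "\<And>l. l \<in> \<Lambda> \<Longrightarrow> op_le f (g l)" "\<And>l. l \<in> \<Lambda> \<Longrightarrow> op_le (g l) id_blinfun"
    and dir: "\<And>l m. l \<in> \<Lambda> \<Longrightarrow> m \<in> \<Lambda> \<Longrightarrow> \<exists>k\<in>\<Lambda>. op_le (g k) (g l) \<and> op_le (g k) (g m)"
    and inf: "\<And>\<eta> e. e > 0 \<Longrightarrow> \<exists>l\<in>\<Lambda>. Re (cinner (blinfun_apply (g l) \<eta>) \<eta>) \<le> Re (cinner (blinfun_apply f \<eta>) \<eta>) + e"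
    and e: "e > 0"
  shows "\<exists>l\<in>\<Lambda>. Re (tr (g l)) < Re (tr f) + e"
proof -
  let ?D = "(\<lambda>l. id_blinfun - g l) ` \<Lambda>"
  have up: "op_le (id_blinfun - f) t"
    if t: "t \<in> A" "\<And>l. l \<in> \<Lambda> \<Longrightarrow> op_le (id_blinfun - g l) t" for t
    unfolding op_le_def op_pos_def complex_nonneg_Reals_iff
  proof (intro allI conjI)
    fix \<eta>
    have eq: "cinner (blinfun_apply (t - (id_blinfun - f)) \<eta>) \<eta> =
        cinner (blinfun_apply (t - (id_blinfun - g l)) \<eta>) \<eta> - cinner (blinfun_apply (g l - f) \<eta>) \<eta>" for l
      by (simp add: blinfun.diff_left cinner_diff_left)
    have p: "Re (cinner (blinfun_apply (t - (id_blinfun - g l)) \<eta>) \<eta>) \<ge> 0"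
      "Im (cinner (blinfun_apply (t - (id_blinfun - g l)) \<eta>) \<eta>) = 0"
      "Im (cinner (blinfun_apply (g l - f) \<eta>) \<eta>) = 0" if "l \<in> \<Lambda>" for l
      using t(2)[OF that] le(1)[OF that] by (auto simp: op_le_def op_pos_def complex_nonneg_Reals_iff)
    show "Im (cinner (blinfun_apply (t - (id_blinfun - f)) \<eta>) \<eta>) = 0"
    proof -
      obtain l where "l \<in> \<Lambda>" using \<Lambda> by blast
      then show ?thesis unfolding eq[of l] using p by simp
    qed
    show "0 \<le> Re (cinner (blinfun_apply (t - (id_blinfun - f)) \<eta>) \<eta>)"
    proof (rule field_le_epsilon)
      fix e :: real assume "e > 0"
      then obtain l where l: "l \<in> \<Lambda>"
        "Re (cinner (blinfun_apply (g l) \<eta>) \<eta>) \<le> Re (cinner (blinfun_apply f \<eta>) \<eta>) + e" using inf by blast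
      have "Re (cinner (blinfun_apply (g l - f) \<eta>) \<eta>) \<le> e"
        using l(2) by (simp add: blinfun.diff_left cinner_diff_left)
      then show "0 \<le> Re (cinner (blinfun_apply (t - (id_blinfun - f)) \<eta>) \<eta>) + e"
        using p(1)[OF l(1)] unfolding eq[of l] by simp
    qed
  qed
  have "Re (tr (id_blinfun - f)) = (SUP S\<in>?D. Re (tr S))"
  proof (rule normal[unfolded normal_trace_def, rule_format], intro conjI ballI impI)
    show "?D \<noteq> {}" using \<Lambda> by simp
    show "?D \<subseteq> A" using A by (auto simp: closed)
    show "op_pos S" if "S \<in> ?D" for S using that le(2) by (auto simp: op_le_def)
    show "\<exists>U\<in>?D. op_le S U \<and> op_le T U" if "S \<in> ?D" "T \<in> ?D" for S T
    proof -
      obtain l m where lm: "l \<in> \<Lambda>" "m \<in> \<Lambda>" "S = id_blinfun - g l" "T = id_blinfun - g m" using \<open>S \<in> ?D\<close> \<open>T \<in> ?D\<close> by blast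
      obtain k where "k \<in> \<Lambda>" "op_le (g k) (g l)" "op_le (g k) (g m)" using dir lm by blast
      with lm show ?thesis by (intro bexI[of _ "id_blinfun - g k"]) (auto simp: op_le_def)
    qed
    show "id_blinfun - f \<in> A" using A by (simp add: closed)
    show "op_le S (id_blinfun - f)" if "S \<in> ?D" for S using that le(1) by (auto simp: op_le_def)
    show "op_le (id_blinfun - f) t" if "t \<in> A" "\<forall>S\<in>?D. op_le S t" for t
      using up[OF that(1)] that(2) by blast
  qed
  then have "(SUP S\<in>?D. Re (tr S)) > Re (tr (id_blinfun - f)) - e" using e by simp
  then obtain r where "r \<in> (\<lambda>S. Re (tr S)) ` ?D" "Re (tr (id_blinfun - f)) - e < r"
    using \<Lambda> by (elim less_cSupE) auto
  then obtain l where "l \<in> \<Lambda>" "Re (tr (id_blinfun - f)) - e < Re (tr (id_blinfun - g l))" by blast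
  then show ?thesis using A by (intro bexI[of _ l]) (simp_all add: tr_diff)
qed

text \<open>Each diagonal entry has its own approximating index; directedness supplies one index
  below all of these, since the entries are finitely many.\<close>

lemma ptrace_directed_inf:
  assumes I: "finite I" and \<Lambda>: "\<Lambda> \<noteq> {}"
    and A: "\<And>i. i \<in> I \<Longrightarrow> f i \<in> A" "\<And>l i. l \<in> \<Lambda> \<Longrightarrow> i \<in> I \<Longrightarrow> g l i \<in> A"
    and le: "\<And>l i. l \<in> \<Lambda> \<Longrightarrow> i \<in> I \<Longrightarrow> op_le (f i) (g l i)" "\<And>l i. l \<in> \<Lambda> \<Longrightarrow> i \<in> I \<Longrightarrow> op_le (g l i) id_blinfun"
    and dir: "\<And>l m. l \<in> \<Lambda> \<Longrightarrow> m \<in> \<Lambda> \<Longrightarrow> \<exists>k\<in>\<Lambda>. \<forall>i\<in>I. op_le (g k i) (g l i) \<and> op_le (g k i) (g m i)"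
    and inf: "\<And>i \<eta> e. i \<in> I \<Longrightarrow> e > 0 \<Longrightarrow>
      \<exists>l\<in>\<Lambda>. Re (cinner (blinfun_apply (g l i) \<eta>) \<eta>) \<le> Re (cinner (blinfun_apply (f i) \<eta>) \<eta>) + e"
    and e: "e > 0"
  shows "\<exists>l\<in>\<Lambda>. (\<Sum>i\<in>I. Re (tr (g l i))) < (\<Sum>i\<in>I. Re (tr (f i))) + e"
proof -
  \<comment> \<open>The added 1 keeps \<open>d\<close> positive when \<open>I\<close> is empty and
    makes \<open>card I\<close> times \<open>d\<close> strictly smaller than
    \<open>e\<close>.\<close>
  define d where "d = e / (real (card I) + 1)"
  have d: "d > 0" "real (card I) * d < e"
    using e by (simp_all add: d_def field_simps)
  have "\<exists>l\<in>\<Lambda>. Re (tr (g l i)) < Re (tr (f i)) + d" if i: "i \<in> I" for i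
  proof (rule tr_directed_inf)
    show "\<exists>k\<in>\<Lambda>. op_le (g k i) (g l i) \<and> op_le (g k i) (g m i)" if "l \<in> \<Lambda>" "m \<in> \<Lambda>" for l m
      using dir[OF that] i by blast
  qed (use i \<Lambda> A le inf d in blast)+
  then obtain l where l: "\<And>i. i \<in> I \<Longrightarrow> l i \<in> \<Lambda>" "\<And>i. i \<in> I \<Longrightarrow> Re (tr (g (l i) i)) < Re (tr (f i)) + d"
    by metis
  have "\<exists>k\<in>\<Lambda>. \<forall>j\<in>J. \<forall>i\<in>I. Re (tr (g k i)) \<le> Re (tr (g (l j) i))" if "J \<subseteq> I" for J
    using finite_subset[OF that I] that
  proof (induction J rule: finite_induct)
    case (insert j J)
    then obtain k where k: "k \<in> \<Lambda>" "\<And>j i. j \<in> J \<Longrightarrow> i \<in> I \<Longrightarrow> Re (tr (g k i)) \<le> Re (tr (g (l j) i))" by blast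
    obtain k' where k': "k' \<in> \<Lambda>" "\<forall>i\<in>I. op_le (g k' i) (g k i) \<and> op_le (g k' i) (g (l j) i)"
      using dir[OF k(1) l(1)] insert.prems by blast
    then have "\<forall>i\<in>I. Re (tr (g k' i)) \<le> Re (tr (g k i)) \<and> Re (tr (g k' i)) \<le> Re (tr (g (l j) i))"
      using tr_mono A(2) k(1) l(1) insert.prems by auto
    with k k'(1) show ?case by (intro bexI[of _ k']) force+
  qed (use \<Lambda> in blast)
  from this[of I] obtain k where k: "k \<in> \<Lambda>" "\<And>i. i \<in> I \<Longrightarrow> Re (tr (g k i)) \<le> Re (tr (g (l i) i))" by blast
  have "(\<Sum>i\<in>I. Re (tr (g k i))) \<le> (\<Sum>i\<in>I. Re (tr (f i)) + d)"
    using k(2) l(2) by (intro sum_mono) (meson less_imp_le order_trans)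
  also have "\<dots> < (\<Sum>i\<in>I. Re (tr (f i))) + e" using d by (simp add: sum.distrib)
  finally show ?thesis using k(1) by blast
qed

end

section \<open>Operator inequalities between diagonal entries\<close>

context vn_algebra
begin

lemma op_le_diagI:
  assumes "finite I" "finite J" "proj_on A I F" "proj_on A J G" "i \<in> I" "j \<in> J"
    and "\<And>\<eta>. hnorm2 I (mat_apply I F (\<lambda>k. if k = i then \<eta> else 0)) \<le> hnorm2 J (mat_apply J G (\<lambda>k. if k = j then \<eta> else 0))"
  shows "op_le (F i i) (G j j)"
  using assms(7)
  by (simp add: op_le_def op_pos_def blinfun.diff_left cinner_diff_left complex_nonneg_Reals_iff
      cinner_proj_on_diag[OF vN assms(1,3,5)] cinner_proj_on_diag[OF vN assms(2,4,6)])

lemma ann_lower: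
  assumes "finite I" "\<forall>b\<in>S. \<forall>i\<in>I. b i \<in> A" "is_ann A I S F"
    and c: "\<And>\<omega>. \<omega> \<in> col_range S \<Longrightarrow> c \<le> hnorm2 I (\<lambda>i. \<xi> i - \<omega> i)"
  shows "c \<le> hnorm2 I (mat_apply I F \<xi>)"
proof (rule field_le_epsilon)
  fix e :: real assume "e > 0"
  then show "c \<le> hnorm2 I (mat_apply I F \<xi>) + e"
    using ann_approx[OF vN assms(1,2,3), of e \<xi>] c by fastforce
qed

lemma op_le_ann_id:
  assumes "finite I" "\<forall>b\<in>S. \<forall>i\<in>I. b i \<in> A" "is_ann A I S F" "i \<in> I"
  shows "op_le (F i i) id_blinfun"
proof -
  have "hnorm2 I (mat_apply I F (\<lambda>k. if k = i then \<eta> else 0)) \<le> (norm \<eta>)\<^sup>2" for \<eta>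
  proof -
    have "hnorm2 I (\<lambda>k. if k = i then \<eta> else 0) = (\<Sum>k\<in>I. if i = k then (norm \<eta>)\<^sup>2 else 0)"
      unfolding hnorm2_def by (intro sum.cong) auto
    also have "\<dots> = (norm \<eta>)\<^sup>2" using assms(1,4) by simp
    finally show ?thesis
      using ann_upper[OF vN assms(1,2,3) col_range.zero, of "\<lambda>k. if k = i then \<eta> else 0"] by simp
  qed
  then show ?thesis
    by (simp add: op_le_def op_pos_def blinfun.diff_left cinner_diff_left complex_nonneg_Reals_iff
      cinner_proj_on_diag[OF vN assms(1) is_annD(1)[OF assms(3)] assms(4)] cinner_self)
qed

end

lemma col_range_matrix:
  assumes "finite J" "\<omega> \<in> col_range ((\<lambda>j i. V i j) ` J)"
  shows "\<exists>\<zeta>. \<omega> = (\<lambda>i. \<Sum>j\<in>J. blinfun_apply (V i j) (\<zeta> j))"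
  using assms(2)
proof (induction rule: col_range.induct)
  case (step b \<omega> \<eta>)
  then obtain \<zeta> j where \<zeta>: "\<omega> = (\<lambda>i. \<Sum>j\<in>J. blinfun_apply (V i j) (\<zeta> j))" and j: "j \<in> J" "b = (\<lambda>i. V i j)"
    by blast
  have *: "blinfun_apply (V i j) \<eta> + (\<Sum>j\<in>J. blinfun_apply (V i j) (\<zeta> j))
      = (\<Sum>k\<in>J. blinfun_apply (V i k) (\<zeta> k + (if k = j then \<eta> else 0)))" for i
  proof -
    have "(\<Sum>k\<in>J. blinfun_apply (V i k) (if k = j then \<eta> else 0)) = (\<Sum>k\<in>J. if j = k then blinfun_apply (V i k) \<eta> else 0)"
      by (intro sum.cong) auto
    also have "\<dots> = blinfun_apply (V i j) \<eta>" using assms(1) j by simp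
    finally show ?thesis by (simp add: blinfun.add_right sum.distrib)
  qed
  show ?case
    by (intro exI[of _ "\<lambda>k. \<zeta> k + (if k = j then \<eta> else 0)"] ext) (simp only: \<zeta> j(2) *)
qed (auto intro: exI[of _ "\<lambda>_. 0"])

text \<open>The subset \<open>K\<close> varies for the induction. With \<open>K = J\<close> this is
  converse to \<open>col_range_matrix\<close>: the span of finitely many columns is the range of the
  matrix.\<close>

lemma matrix_col_range:
  assumes "finite K" "K \<subseteq> J"
  shows "(\<lambda>i. \<Sum>j\<in>K. blinfun_apply (V i j) (\<zeta> j)) \<in> col_range ((\<lambda>j i. V i j) ` J)"
  using assms
proof (induction K rule: finite_induct)
  case (insert j K)
  then show ?case using col_range.step[of "\<lambda>i. V i j" "(\<lambda>j i. V i j) ` J" _ "\<zeta> j"] by simp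
qed (auto intro: col_range.zero)

lemma hnorm2_Plus:
  "finite I \<Longrightarrow> finite J \<Longrightarrow> hnorm2 (I <+> J) \<xi> = hnorm2 I (\<lambda>i. \<xi> (Inl i)) + hnorm2 J (\<lambda>j. \<xi> (Inr j))"
  by (simp add: hnorm2_def sum.Plus comp_def)

section \<open>Rank-nullity for matrices over a finite von Neumann algebra\<close>

abbreviation mat_cols :: "'j set \<Rightarrow> ('i \<Rightarrow> 'j \<Rightarrow> 'c) \<Rightarrow> ('i \<Rightarrow> 'c) set" where
  "mat_cols J V \<equiv> (\<lambda>j i. V i j) ` J"

lemma is_ann_cong:
  assumes "is_ann A I (mat_cols J V) F" "\<And>i j. i \<in> I \<Longrightarrow> j \<in> J \<Longrightarrow> V i j = V' i j"
  shows "is_ann A I (mat_cols J V') F"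
  using assms by (simp add: is_ann_def cong: sum.cong)

definition blk_l :: "('i \<Rightarrow> 'i \<Rightarrow> 'h::complex_hilbert oper) \<Rightarrow> 'i + 'j \<Rightarrow> 'i + 'j \<Rightarrow> 'h oper" where
  "blk_l N x y = (case x of Inl i \<Rightarrow> (case y of Inl k \<Rightarrow> N i k | Inr _ \<Rightarrow> 0) | Inr _ \<Rightarrow> 0)"

definition blk_r :: "('j \<Rightarrow> 'j \<Rightarrow> 'h::complex_hilbert oper) \<Rightarrow> 'i + 'j \<Rightarrow> 'i + 'j \<Rightarrow> 'h oper" where
  "blk_r N x y = (case x of Inr i \<Rightarrow> (case y of Inr k \<Rightarrow> N i k | Inl _ \<Rightarrow> 0) | Inl _ \<Rightarrow> 0)"

lemma blk_simps [simp]: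
  "blk_l N (Inl i) (Inl k) = N i k" "blk_l N (Inr j) y = 0" "blk_l N x (Inr j) = 0"
  "blk_r N' (Inr j') (Inr l) = N' j' l" "blk_r N' (Inl i') z = 0" "blk_r N' w (Inl i') = 0"
  by (auto simp: blk_l_def blk_r_def split: sum.splits)

lemma sum_Plus:
  fixes g :: "'a + 'b \<Rightarrow> 'c::comm_monoid_add"
  shows "finite I \<Longrightarrow> finite J \<Longrightarrow> sum g (I <+> J) = (\<Sum>i\<in>I. g (Inl i)) + (\<Sum>j\<in>J. g (Inr j))"
  by (simp add: sum.Plus comp_def)

lemma sum_compose_delta:
  assumes "finite I" "k \<in> I"
  shows "(\<Sum>i\<in>I. f i o\<^sub>L (if i = k then T else 0)) = f k o\<^sub>L T"
    and "(\<Sum>i\<in>I. (if i = k then T' else 0) o\<^sub>L g i) = T' o\<^sub>L g k"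
proof -
  have "(\<Sum>i\<in>I. f i o\<^sub>L (if i = k then T else 0)) = (\<Sum>i\<in>I. if k = i then f i o\<^sub>L T else 0)"
    by (intro sum.cong) auto
  then show "(\<Sum>i\<in>I. f i o\<^sub>L (if i = k then T else 0)) = f k o\<^sub>L T" using assms by simp
  have "(\<Sum>i\<in>I. (if i = k then T' else 0) o\<^sub>L g i) = (\<Sum>i\<in>I. if k = i then T' o\<^sub>L g i else 0)"
    by (intro sum.cong) auto
  then show "(\<Sum>i\<in>I. (if i = k then T' else 0) o\<^sub>L g i) = T' o\<^sub>L g k" using assms by simp
qed

lemma sum_compose_delta':
  assumes "finite I" "k \<in> I"
  shows "(\<Sum>i\<in>I. (if k = i then T else 0) o\<^sub>L f i) = T o\<^sub>L f k"
  using sum_compose_delta(2)[OF assms, of T f] by (simp add: eq_commute)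

context vn_algebra
begin

lemma proj_on_compl:
  assumes I: "finite I" and G: "proj_on A I G"
  shows "proj_on A I (\<lambda>x y. (if x = y then id_blinfun else 0) - G x y)"
proof -
  note G = proj_onD[OF G]
  show ?thesis
    unfolding proj_on_def
  proof (intro ballI conjI)
    fix i j assume ij: "i \<in> I" "j \<in> I"
    show "(if i = j then id_blinfun else 0) - G i j \<in> A" using ij G(1) by (simp add: closed)
    show "op_adj ((if j = i then id_blinfun else 0) - G j i) = (if i = j then id_blinfun else 0) - G i j"
      using ij G(1,3) bounded by (simp add: op_adj_diff bounded_ops_id bounded_ops_zero)
    show "(\<Sum>k\<in>I. ((if i = k then id_blinfun else 0) - G i k) o\<^sub>L ((if k = j then id_blinfun else 0) - G k j)) =
        (if i = j then id_blinfun else 0) - G i j"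
      using ij G(2)
      by (simp add: compose_diff_left compose_diff_right sum_subtractf sum_compose_delta sum_compose_delta' I)
  qed
qed

lemma proj_on_blk_l: "finite I \<Longrightarrow> finite J \<Longrightarrow> proj_on A I N \<Longrightarrow> proj_on A (I <+> J) (blk_l N)"
  by (auto simp: proj_on_def sum_Plus)

lemma proj_on_blk_r: "finite I \<Longrightarrow> finite J \<Longrightarrow> proj_on A J N \<Longrightarrow> proj_on A (I <+> J) (blk_r N)"
  by (auto simp: proj_on_def sum_Plus)

end

context vn_trace
begin

lemma ptrace_blk_l: "finite I \<Longrightarrow> finite J \<Longrightarrow> ptrace tr (I <+> J) (blk_l N) = ptrace tr I N"
  by (simp add: ptrace_def sum_Plus)

lemma ptrace_blk_r: "finite I \<Longrightarrow> finite J \<Longrightarrow> ptrace tr (I <+> J) (blk_r N) = ptrace tr J N"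
  by (simp add: ptrace_def sum_Plus)

end

text \<open>The annihilator of the columns of \<open>graph_mat s V\<close> is the module of all rows \<open>(y, s y V)\<close>.\<close>

definition graph_mat :: "real \<Rightarrow> ('i \<Rightarrow> 'j \<Rightarrow> 'h::complex_hilbert oper) \<Rightarrow> 'i + 'j \<Rightarrow> 'j \<Rightarrow> 'h oper" where
  "graph_mat s V x j = (case x of Inl i \<Rightarrow> s *\<^sub>R V i j | Inr k \<Rightarrow> if k = j then - id_blinfun else 0)"

text \<open>The rows \<open>(1, s V)\<close>, a basis of the module just described: a row of it is
  recovered from its left part.\<close>

definition graph_row :: "real \<Rightarrow> ('i \<Rightarrow> 'j \<Rightarrow> 'h::complex_hilbert oper) \<Rightarrow> 'i \<Rightarrow> 'i + 'j \<Rightarrow> 'h oper" where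
  "graph_row s V i x = (case x of Inl k \<Rightarrow> if i = k then id_blinfun else 0 | Inr j \<Rightarrow> s *\<^sub>R V i j)"

context vn_trace
begin

context
  fixes I :: "'i set" and J :: "'j set" and V :: "'i \<Rightarrow> 'j \<Rightarrow> 'h oper" and s :: real and G
  assumes I: "finite I" and J: "finite J" and V: "\<And>i j. i \<in> I \<Longrightarrow> j \<in> J \<Longrightarrow> V i j \<in> A"
    and G: "is_ann A (I <+> J) (mat_cols J (graph_mat s V)) G"
begin

lemma graph_row_mem: "i \<in> I \<Longrightarrow> x \<in> I <+> J \<Longrightarrow> graph_row s V i x \<in> A"
  using V by (auto simp: graph_row_def closed)

text \<open>Row \<open>x\<close> of \<open>G\<close> is killed by the columns of
  \<open>graph_mat s V\<close>, so its right part is \<open>s\<close> times its left part times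
  \<open>V\<close>.\<close>

lemma ann_graph_left:
  assumes x: "x \<in> I <+> J" and y: "y \<in> I <+> J"
  shows "(\<Sum>i\<in>I. G x (Inl i) o\<^sub>L graph_row s V i y) = G x y"
  using y
proof (rule PlusE)
  fix k assume "k \<in> I" "y = Inl k"
  then show ?thesis by (simp add: graph_row_def sum_compose_delta I)
next
  fix j assume j: "j \<in> J" "y = Inr j"
  have "(\<Sum>z\<in>I <+> J. G x z o\<^sub>L graph_mat s V z j) = 0"
    using is_annD(2)[OF G, of "\<lambda>z. graph_mat s V z j"] x j by blast
  then have "(\<Sum>i\<in>I. G x (Inl i) o\<^sub>L (s *\<^sub>R V i j)) + (G x (Inr j) o\<^sub>L (- id_blinfun)) = 0"
    using j by (simp add: sum_Plus I J graph_mat_def sum_compose_delta)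
  then show ?thesis using j by (simp add: graph_row_def compose_minus_right)
qed

lemma ann_graph_right:
  assumes i: "i \<in> I" and y: "y \<in> I <+> J"
  shows "(\<Sum>x\<in>I <+> J. graph_row s V i x o\<^sub>L G x y) = graph_row s V i y"
proof (rule is_annD(3)[OF G _ _ y])
  show "graph_row s V i x \<in> bounded_ops" if "x \<in> I <+> J" for x
    using graph_row_mem[OF i that] by (rule bounded)
  show "(\<Sum>x\<in>I <+> J. graph_row s V i x o\<^sub>L b x) = 0" if "b \<in> mat_cols J (graph_mat s V)" for b
  proof -
    obtain j where j: "j \<in> J" "b = (\<lambda>x. graph_mat s V x j)" using \<open>b \<in> _\<close> by blast
    have "(\<Sum>x\<in>I <+> J. graph_row s V i x o\<^sub>L b x) = s *\<^sub>R V i j + ((s *\<^sub>R V i j) o\<^sub>L (- id_blinfun))"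
      using i j by (simp add: sum_Plus I J graph_row_def graph_mat_def sum_compose_delta sum_compose_delta')
    then show ?thesis by (simp add: compose_minus_right)
  qed
qed

text \<open>With \<open>u\<close> the left columns of \<open>G\<close> and \<open>v\<close> the
  graph rows, the two preceding lemmas give \<open>u v = G\<close> and \<open>v u = 1\<close>. Hence
  the trace depends neither on \<open>s\<close> nor on \<open>V\<close>.\<close>

lemma ptrace_graph: "ptrace tr (I <+> J) G = real (card I) * Re (tr id_blinfun)"
proof -
  note GA = proj_onD[OF is_annD(1)[OF G]]
  have "ptrace tr (I <+> J) G = ptrace tr I (\<lambda>i k. id_blinfun)"
  proof (rule ptrace_swap)
    show "G x (Inl i) \<in> A" if "x \<in> I <+> J" "i \<in> I" for x i using GA(1) that by blast
    show "graph_row s V i x \<in> A" if "x \<in> I <+> J" "i \<in> I" for x i using graph_row_mem that by blast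
    show "G x x = (\<Sum>i\<in>I. G x (Inl i) o\<^sub>L graph_row s V i x)" if "x \<in> I <+> J" for x
      using ann_graph_left[OF that that] by simp
    show "id_blinfun = (\<Sum>x\<in>I <+> J. graph_row s V i x o\<^sub>L G x (Inl i))" if "i \<in> I" for i
      using ann_graph_right[OF that, of "Inl i"] that by (simp add: graph_row_def InlI)
  qed
  then show ?thesis by (simp add: ptrace_def)
qed

text \<open>By self-adjointness, the lower rows of \<open>G\<close> are \<open>s\<close> times the
  adjoint of \<open>V\<close> times the upper rows, and \<open>N\<close> kills the adjoint of
  \<open>V\<close>. So \<open>N\<close>, placed in the lower corner, is orthogonal to
  \<open>G\<close> and therefore below \<open>1 - G\<close>.\<close>

lemma tr_graph_corner:
  assumes N: "is_ann A J (mat_cols I (\<lambda>j i. op_adj (V i j))) N" and j: "j \<in> J"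
  shows "Re (tr (N j j)) + Re (tr (G (Inr j) (Inr j))) \<le> Re (tr id_blinfun)"
proof -
  note GA = proj_onD[OF is_annD(1)[OF G]] and NA = proj_onD[OF is_annD(1)[OF N]]
  let ?E = "\<lambda>x y. (if x = y then id_blinfun else 0) - G x y"
  have fin: "finite (I <+> J)" using I J by simp
  have NG: "(\<Sum>k\<in>J. N j k o\<^sub>L G (Inr k) z) = 0" if j: "j \<in> J" and z: "z \<in> I <+> J" for j z
  proof -
    have "G (Inr k) z = (\<Sum>i\<in>I. s *\<^sub>R (op_adj (V i k) o\<^sub>L G (Inl i) z))" if k: "k \<in> J" for k
    proof -
      have "G (Inr k) z = op_adj (\<Sum>i\<in>I. G z (Inl i) o\<^sub>L graph_row s V i (Inr k))"
        using ann_graph_left[of z "Inr k"] GA(3)[of "Inr k" z] z k by (simp add: InrI)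
      also have "\<dots> = (\<Sum>i\<in>I. op_adj (G z (Inl i) o\<^sub>L graph_row s V i (Inr k)))"
        using z k by (intro op_adj_sum bounded closed GA(1) graph_row_mem) auto
      also have "\<dots> = (\<Sum>i\<in>I. s *\<^sub>R (op_adj (V i k) o\<^sub>L G (Inl i) z))"
        using z k GA(1,3) V by (intro sum.cong refl)
          (simp add: graph_row_def op_adj_compose op_adj_scaleR bounded closed compose_scaleR_left InlI)
      finally show ?thesis .
    qed
    then have "(\<Sum>k\<in>J. N j k o\<^sub>L G (Inr k) z) = (\<Sum>k\<in>J. \<Sum>i\<in>I. s *\<^sub>R ((N j k o\<^sub>L op_adj (V i k)) o\<^sub>L G (Inl i) z))"
      by (intro sum.cong refl) (simp add: compose_sum_right compose_scaleR_right compose_assoc)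
    also have "\<dots> = (\<Sum>i\<in>I. \<Sum>k\<in>J. s *\<^sub>R ((N j k o\<^sub>L op_adj (V i k)) o\<^sub>L G (Inl i) z))" by (rule sum.swap)
    also have "\<dots> = (\<Sum>i\<in>I. s *\<^sub>R ((\<Sum>k\<in>J. N j k o\<^sub>L op_adj (V i k)) o\<^sub>L G (Inl i) z))"
      by (simp add: compose_sum_left scaleR_sum_right)
    also have "\<dots> = 0"
      using is_annD(2)[OF N, of "\<lambda>k. op_adj (V i k)" j for i] j by (intro sum.neutral) auto
    finally show ?thesis .
  qed
  have "Re (tr (blk_r N (Inr j :: 'i + 'j) (Inr j))) \<le> Re (tr (?E (Inr j) (Inr j)))"
  proof (rule tr_proj_diag_mono[OF proj_on_blk_r[OF I J is_annD(1)[OF N]] proj_on_compl[OF fin is_annD(1)[OF G]]])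
    show "Inr j \<in> I <+> J" using j by auto
    show "(\<Sum>y\<in>I <+> J. blk_r N x y o\<^sub>L ?E y z) = blk_r N x z" if "x \<in> I <+> J" "z \<in> I <+> J" for x z
      using that(1)
    proof (rule PlusE)
      fix l assume l: "l \<in> J" "x = Inr l"
      have "(\<Sum>y\<in>I <+> J. blk_r N x y o\<^sub>L (if y = z then id_blinfun else 0)) = blk_r N x z"
        using that fin by (simp add: sum_compose_delta)
      moreover have "(\<Sum>y\<in>I <+> J. blk_r N x y o\<^sub>L G y z) = 0"
        using NG[OF l(1) that(2)] l by (simp add: sum_Plus I J)
      ultimately show ?thesis by (simp add: compose_diff_right sum_subtractf)
    qed simp
  qed
  then show ?thesis using GA(1)[of "Inr j" "Inr j"] j by (simp add: tr_diff closed InrI)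
qed

end

end

context normal_vn_trace
begin

text \<open>The quadratic form of the upper diagonal entry of \<open>G s\<close> is the infimum over
  \<open>\<zeta>\<close> of \<open>Q\<close>, that is of the squared distance from
  \<open>s V \<zeta>\<close> plus the squared norm of \<open>\<zeta>\<close>. Replacing
  \<open>\<zeta>\<close> by \<open>\<zeta> / s\<close> shows that it decreases, as \<open>s\<close>
  grows, to the squared distance from the range of \<open>V\<close>, which is the form of
  \<open>N\<close>.\<close>

lemma graph_limit:
  fixes I :: "'i set" and J :: "'j set"
  assumes I: "finite I" and J: "finite J" and V: "\<And>i j. i \<in> I \<Longrightarrow> j \<in> J \<Longrightarrow> V i j \<in> A"
    and N: "is_ann A I (mat_cols J V) N"
    and G: "\<And>s. is_ann A (I <+> J) (mat_cols J (graph_mat s V)) (G s)"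
    and e: "e > 0"
  shows "\<exists>s. (\<Sum>i\<in>I. Re (tr (G s (Inl i) (Inl i)))) < ptrace tr I N + e"
proof -
  have fin: "finite (I <+> J)" using I J by simp
  note GA = is_annD(1)[OF G] and NA = is_annD(1)[OF N]
  have VN: "\<forall>b\<in>mat_cols J V. \<forall>i\<in>I. b i \<in> A" using V by auto
  have VG: "\<forall>b\<in>mat_cols J (graph_mat s V). \<forall>x\<in>I <+> J. b x \<in> A" for s
    using V by (auto simp: graph_mat_def closed)
  define \<delta> where "\<delta> i \<eta> = (\<lambda>k. if k = i then \<eta> else 0)" for i :: 'i and \<eta> :: 'h
  define \<delta>' where "\<delta>' i \<eta> = (\<lambda>k::'i + 'j. if k = Inl i then \<eta> else 0)" for i and \<eta> :: 'h
  define V\<zeta> where "V\<zeta> \<zeta> i = (\<Sum>j\<in>J. blinfun_apply (V i j) (\<zeta> j))" for \<zeta> i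
  define nN where "nN i \<eta> = hnorm2 I (mat_apply I N (\<delta> i \<eta>))" for i \<eta>
  define nG where "nG s i \<eta> = hnorm2 (I <+> J) (mat_apply (I <+> J) (G s) (\<delta>' i \<eta>))" for s i \<eta>
  define Q where "Q s i \<eta> \<zeta> = hnorm2 I (\<lambda>k. \<delta> i \<eta> k - s *\<^sub>R V\<zeta> \<zeta> k) + hnorm2 J \<zeta>" for s i \<eta> \<zeta>
  have Q: "hnorm2 (I <+> J) (\<lambda>x. \<delta>' i \<eta> x - (\<Sum>j\<in>J. blinfun_apply (graph_mat s V x j) (\<zeta> j))) = Q s i \<eta> \<zeta>" for s i \<eta> \<zeta>
  proof -
    have "(\<Sum>j\<in>J. blinfun_apply (graph_mat s V (Inr k) j) (\<zeta> j)) = - \<zeta> k" if "k \<in> J" for k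
    proof -
      have "(\<Sum>j\<in>J. blinfun_apply (graph_mat s V (Inr k) j) (\<zeta> j)) = (\<Sum>j\<in>J. if k = j then - \<zeta> j else 0)"
        by (intro sum.cong) (auto simp: graph_mat_def blinfun.minus_left)
      then show ?thesis using that J by simp
    qed
    moreover have "(\<Sum>j\<in>J. blinfun_apply (graph_mat s V (Inl k) j) (\<zeta> j)) = s *\<^sub>R V\<zeta> \<zeta> k" for k
      by (simp add: graph_mat_def V\<zeta>_def blinfun.scaleR_left scaleR_sum_right)
    ultimately show ?thesis
      by (simp add: hnorm2_Plus I J Q_def \<delta>_def \<delta>'_def) (simp add: hnorm2_def)
  qed
  have G_up: "nG s i \<eta> \<le> Q s i \<eta> \<zeta>" for s i \<eta> \<zeta>
    using ann_upper[OF vN fin VG G matrix_col_range[OF J order_refl], of s "\<delta>' i \<eta>" \<zeta>]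
    by (simp add: Q nG_def)
  have G_low: "c \<le> nG s i \<eta>" if "\<And>\<zeta>. c \<le> Q s i \<eta> \<zeta>" for s i \<eta> c
    unfolding nG_def
  proof (rule ann_lower[OF fin VG G])
    fix \<omega> assume "\<omega> \<in> col_range (mat_cols J (graph_mat s V))"
    from col_range_matrix[OF J this] obtain \<zeta> where
      "\<omega> = (\<lambda>x. \<Sum>j\<in>J. blinfun_apply (graph_mat s V x j) (\<zeta> j))" by blast
    then show "c \<le> hnorm2 (I <+> J) (\<lambda>x. \<delta>' i \<eta> x - \<omega> x)" using that[of \<zeta>] by (simp add: Q)
  qed
  have N_up: "nN i \<eta> \<le> hnorm2 I (\<lambda>k. \<delta> i \<eta> k - V\<zeta> \<zeta> k)" for i \<eta> \<zeta>
    using ann_upper[OF vN I VN N matrix_col_range[OF J order_refl], of "\<delta> i \<eta>" \<zeta>]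
    by (simp add: V\<zeta>_def nN_def)
  have sc: "V\<zeta> (\<lambda>j. r *\<^sub>R \<zeta> j) k = r *\<^sub>R V\<zeta> \<zeta> k" for r \<zeta> k
    by (simp add: V\<zeta>_def blinfun.scaleR_right scaleR_sum_right)
  have nsc: "hnorm2 J (\<lambda>j. r *\<^sub>R \<zeta> j) = r\<^sup>2 * hnorm2 J \<zeta>" for r and \<zeta> :: "'j \<Rightarrow> 'h"
    by (simp add: hnorm2_def power_mult_distrib sum_distrib_left)
  have NleG: "nN i \<eta> \<le> nG s i \<eta>" for s i \<eta>
  proof (rule G_low)
    fix \<zeta>
    show "nN i \<eta> \<le> Q s i \<eta> \<zeta>"
      using N_up[of i \<eta> "\<lambda>j. s *\<^sub>R \<zeta> j"] by (simp add: Q_def sc add_increasing2)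
  qed
  have mono: "nG t i \<eta> \<le> nG s i \<eta>" if "0 < s" "s \<le> t" for s t i \<eta>
  proof (rule G_low)
    fix \<zeta>
    \<comment> \<open>Rescaling \<open>\<zeta>\<close> undoes the change from \<open>s\<close> to
      \<open>t\<close> in the first summand of \<open>Q\<close> and shrinks the second.\<close>
    have "nG t i \<eta> \<le> Q t i \<eta> (\<lambda>j. (s / t) *\<^sub>R \<zeta> j)" by (rule G_up)
    also have "\<dots> = hnorm2 I (\<lambda>k. \<delta> i \<eta> k - s *\<^sub>R V\<zeta> \<zeta> k) + (s / t)\<^sup>2 * hnorm2 J \<zeta>"
      using that by (simp add: Q_def sc nsc)
    also have "\<dots> \<le> Q s i \<eta> \<zeta>"
    proof -
      have "(s / t)\<^sup>2 \<le> 1" using that by (simp add: power_le_one)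
      then show ?thesis by (simp add: Q_def mult_left_le_one_le)
    qed
    finally show "nG t i \<eta> \<le> Q s i \<eta> \<zeta>" .
  qed
  have diagN: "cinner (blinfun_apply (N i i) \<eta>) \<eta> = of_real (nN i \<eta>)" if "i \<in> I" for i \<eta>
    using cinner_proj_on_diag[OF vN I NA that] by (simp add: nN_def \<delta>_def)
  have diagG: "cinner (blinfun_apply (G s (Inl i) (Inl i)) \<eta>) \<eta> = of_real (nG s i \<eta>)" if "i \<in> I" for s i \<eta>
    using cinner_proj_on_diag[OF vN fin GA, of "Inl i"] that by (simp add: nG_def \<delta>'_def InlI)
  have "\<exists>s\<in>{0<..}. (\<Sum>i\<in>I. Re (tr (G s (Inl i) (Inl i)))) < (\<Sum>i\<in>I. Re (tr (N i i))) + e"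
  proof (rule ptrace_directed_inf[OF I])
    show "{0::real<..} \<noteq> {}" by (auto intro: exI[of _ 1])
    show "N i i \<in> A" if "i \<in> I" for i using proj_onD(1)[OF NA that that] .
    show "G s (Inl i) (Inl i) \<in> A" if "i \<in> I" for s i using proj_onD(1)[OF GA] that by blast
    show "op_le (N i i) (G s (Inl i) (Inl i))" if "i \<in> I" for s i
      using that NleG[of i _ s]
      by (simp add: op_le_def op_pos_def blinfun.diff_left cinner_diff_left diagN diagG complex_nonneg_Reals_iff)
    show "op_le (G s (Inl i) (Inl i)) id_blinfun" if "i \<in> I" for s i
      using op_le_ann_id[OF fin VG G] that by blast
    show "\<exists>k\<in>{0<..}. \<forall>i\<in>I. op_le (G k (Inl i) (Inl i)) (G l (Inl i) (Inl i)) \<and> op_le (G k (Inl i) (Inl i)) (G m (Inl i) (Inl i))"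
      if "l \<in> {0<..}" "m \<in> {0<..}" for l m
      using that mono[of l "max l m"] mono[of m "max l m"]
      by (intro bexI[of _ "max l m"])
        (auto simp: op_le_def op_pos_def blinfun.diff_left cinner_diff_left diagG complex_nonneg_Reals_iff)
    fix i \<eta> and e :: real assume i: "i \<in> I" and e: "0 < e"
    obtain \<omega> where "\<omega> \<in> col_range (mat_cols J V)" "hnorm2 I (\<lambda>k. \<delta> i \<eta> k - \<omega> k) < nN i \<eta> + e / 2"
      using ann_approx[OF vN I VN N, of "e / 2" "\<delta> i \<eta>"] e by (auto simp: nN_def)
    moreover from col_range_matrix[OF J this(1)] obtain \<zeta> where "\<omega> = V\<zeta> \<zeta>" unfolding V\<zeta>_def by blast
    ultimately have \<zeta>: "hnorm2 I (\<lambda>k. \<delta> i \<eta> k - V\<zeta> \<zeta> k) < nN i \<eta> + e / 2" by simp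
    define H where "H = hnorm2 J \<zeta>"
    \<comment> \<open>Large enough for \<open>H / s\<^sup>2 \<le> e / 2\<close>; starting from 1
      ensures \<open>s \<le> s\<^sup>2\<close>.\<close>
    define s where "s = 1 + 2 * H / e"
    have H: "H \<ge> 0" by (simp add: H_def)
    have s: "s \<ge> 1" using H e by (simp add: s_def)
    have "H * 2 \<le> s * e" using e by (simp add: s_def field_simps)
    also have "\<dots> \<le> s\<^sup>2 * e" using s e by (simp add: power2_eq_square)
    finally have "(1 / s)\<^sup>2 * H \<le> e / 2" using s by (simp add: power_divide field_simps)
    have "nG s i \<eta> \<le> Q s i \<eta> (\<lambda>j. (1 / s) *\<^sub>R \<zeta> j)" by (rule G_up)
    also have "\<dots> = hnorm2 I (\<lambda>k. \<delta> i \<eta> k - V\<zeta> \<zeta> k) + (1 / s)\<^sup>2 * H"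
      using s by (simp add: Q_def sc nsc H_def)
    also have "\<dots> \<le> nN i \<eta> + e" using \<zeta> \<open>(1 / s)\<^sup>2 * H \<le> e / 2\<close> by simp
    finally have "nG s i \<eta> \<le> nN i \<eta> + e" .
    then show "\<exists>s\<in>{0<..}. Re (cinner (blinfun_apply (G s (Inl i) (Inl i)) \<eta>) \<eta>)
        \<le> Re (cinner (blinfun_apply (N i i) \<eta>) \<eta>) + e"
      using s i by (intro bexI[of _ s]) (auto simp: diagN diagG)
  qed (use e in auto)
  then show ?thesis by (auto simp: ptrace_def)
qed

text \<open>The trace of the graph projection is \<open>card I\<close> times that of the identity,
  whatever \<open>s\<close> is. Its lower corner leaves room for \<open>N'\<close>, and its upper
  corner comes arbitrarily close to \<open>N\<close> in trace.\<close>

lemma rank_le: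
  assumes I: "finite I" and J: "finite J" and V: "\<And>i j. i \<in> I \<Longrightarrow> j \<in> J \<Longrightarrow> V i j \<in> A"
    and N: "is_ann A I (mat_cols J V) N" and N': "is_ann A J (mat_cols I (\<lambda>j i. op_adj (V i j))) N'"
  shows "real (card I) * Re (tr id_blinfun) - ptrace tr I N \<le> real (card J) * Re (tr id_blinfun) - ptrace tr J N'"
proof -
  have fin: "finite (I <+> J)" using I J by simp
  have VG: "\<forall>b\<in>mat_cols J (graph_mat s V). \<forall>x\<in>I <+> J. b x \<in> A" for s
    using V by (auto simp: graph_mat_def closed)
  obtain G where G: "\<And>s. is_ann A (I <+> J) (mat_cols J (graph_mat s V)) (G s)"
    using ann_exists[OF vN fin VG] by metis
  have "real (card I) * Re (tr id_blinfun) + ptrace tr J N' \<le> ptrace tr I N + real (card J) * Re (tr id_blinfun)"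
  proof (rule field_le_epsilon)
    fix e :: real assume "e > 0"
    from graph_limit[OF I J V N G this] obtain s where
      s: "(\<Sum>i\<in>I. Re (tr (G s (Inl i) (Inl i)))) < ptrace tr I N + e" by blast
    have "(\<Sum>j\<in>J. Re (tr (N' j j)) + Re (tr (G s (Inr j) (Inr j)))) \<le> (\<Sum>j\<in>J. Re (tr id_blinfun))"
      by (intro sum_mono tr_graph_corner[OF I J V G N'])
    moreover have "ptrace tr (I <+> J) (G s) = (\<Sum>i\<in>I. Re (tr (G s (Inl i) (Inl i)))) + (\<Sum>j\<in>J. Re (tr (G s (Inr j) (Inr j))))"
      by (simp add: ptrace_def sum_Plus I J)
    ultimately show "real (card I) * Re (tr id_blinfun) + ptrace tr J N'
        \<le> ptrace tr I N + real (card J) * Re (tr id_blinfun) + e"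
      using s ptrace_graph[OF I J V G, of s] by (simp add: sum.distrib ptrace_def[of tr J N'])
  qed
  then show ?thesis by linarith
qed

text \<open>The common value is the rank of \<open>V\<close>, computed from rows and from columns;
  the reverse inequality is \<open>rank_le\<close> for the adjoint matrix.\<close>

theorem rank_nullity:
  assumes I: "finite I" and J: "finite J" and V: "\<And>i j. i \<in> I \<Longrightarrow> j \<in> J \<Longrightarrow> V i j \<in> A"
    and N: "is_ann A I (mat_cols J V) N" and N': "is_ann A J (mat_cols I (\<lambda>j i. op_adj (V i j))) N'"
  shows "real (card I) * Re (tr id_blinfun) - ptrace tr I N = real (card J) * Re (tr id_blinfun) - ptrace tr J N'"
proof (rule antisym)
  have "is_ann A I (mat_cols J (\<lambda>i j. op_adj (op_adj (V i j)))) N"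
    using N by (rule is_ann_cong) (simp add: op_adj_op_adj V bounded)
  from rank_le[OF J I _ N' this] V
  show "real (card J) * Re (tr id_blinfun) - ptrace tr J N' \<le> real (card I) * Re (tr id_blinfun) - ptrace tr I N"
    by (simp add: closed)
qed (rule rank_le[OF assms])

text \<open>Annihilators of finite subsets decrease as the subset grows, and unions make them
  directed. A vector near the optimum in the span of \<open>S\<close> already lies in the span of a
  finite subset, so the distances converge and normality applies.\<close>

lemma ann_directed_inf:
  assumes I: "finite I" and S: "\<forall>b\<in>S. \<forall>i\<in>I. b i \<in> A" and F: "is_ann A I S F" and e: "e > 0"
  shows "\<exists>S0 F0. finite S0 \<and> S0 \<subseteq> S \<and> is_ann A I S0 F0 \<and> ptrace tr I F0 < ptrace tr I F + e"
proof -
  let ?\<Lambda> = "{S0. finite S0 \<and> S0 \<subseteq> S}"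
  have S0: "\<forall>b\<in>S0. \<forall>i\<in>I. b i \<in> A" if "S0 \<in> ?\<Lambda>" for S0 using S that by blast
  have "\<forall>S0\<in>?\<Lambda>. \<exists>F. is_ann A I S0 F" using ann_exists[OF vN I S0] by blast
  then obtain G where G: "\<And>S0. S0 \<in> ?\<Lambda> \<Longrightarrow> is_ann A I S0 (G S0)" by metis
  have up: "hnorm2 I (mat_apply I (G S1) \<xi>) \<le> hnorm2 I (mat_apply I (G S0) \<xi>)"
    if "S0 \<subseteq> S1" "S1 \<in> ?\<Lambda>" for S0 S1 \<xi>
  proof -
    have S0': "S0 \<in> ?\<Lambda>" using that finite_subset by auto
    show ?thesis
      using ann_upper[OF vN I S0 G[OF that(2)]] that col_range_mono[of _ S0 S1]
      by (intro ann_lower[OF I S0[OF S0'] G[OF S0']]) blast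
  qed
  have up': "hnorm2 I (mat_apply I F \<xi>) \<le> hnorm2 I (mat_apply I (G S0) \<xi>)" if "S0 \<in> ?\<Lambda>" for S0 \<xi>
    using ann_upper[OF vN I S F] that col_range_mono[of _ S0 S]
    by (intro ann_lower[OF I S0[OF that] G[OF that]]) blast
  have "\<exists>S0\<in>?\<Lambda>. (\<Sum>i\<in>I. Re (tr (G S0 i i))) < (\<Sum>i\<in>I. Re (tr (F i i))) + e"
  proof (rule ptrace_directed_inf[OF I])
    show "?\<Lambda> \<noteq> {}" by blast
    show "F i i \<in> A" if "i \<in> I" for i using proj_onD(1)[OF is_annD(1)[OF F] that that] .
    show "G S0 i i \<in> A" if "S0 \<in> ?\<Lambda>" "i \<in> I" for S0 i using proj_onD(1)[OF is_annD(1)[OF G]] that by blast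
    show "op_le (F i i) (G S0 i i)" if "S0 \<in> ?\<Lambda>" "i \<in> I" for S0 i
      using up'[OF that(1)] by (intro op_le_diagI[OF I I is_annD(1)[OF F] is_annD(1)[OF G]] that) auto
    show "op_le (G S0 i i) id_blinfun" if "S0 \<in> ?\<Lambda>" "i \<in> I" for S0 i
      using op_le_ann_id[OF I S0[OF that(1)] G[OF that(1)] that(2)] .
    show "\<exists>k\<in>?\<Lambda>. \<forall>i\<in>I. op_le (G k i i) (G l i i) \<and> op_le (G k i i) (G m i i)"
      if "l \<in> ?\<Lambda>" "m \<in> ?\<Lambda>" for l m
    proof (intro bexI[of _ "l \<union> m"] ballI conjI)
      show lm: "l \<union> m \<in> ?\<Lambda>" using that by blast
      fix i assume i: "i \<in> I"
      show "op_le (G (l \<union> m) i i) (G l i i)"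
        using up[of l "l \<union> m"] lm
        by (intro op_le_diagI[OF I I is_annD(1)[OF G[OF lm]] is_annD(1)[OF G[OF that(1)]] i i]) auto
      show "op_le (G (l \<union> m) i i) (G m i i)"
        using up[of m "l \<union> m"] lm
        by (intro op_le_diagI[OF I I is_annD(1)[OF G[OF lm]] is_annD(1)[OF G[OF that(2)]] i i]) auto
    qed
    fix i and \<eta> :: 'h and e :: real assume i: "i \<in> I" and e: "0 < e"
    let ?\<xi> = "\<lambda>k. if k = i then \<eta> else 0"
    obtain \<omega> where \<omega>: "\<omega> \<in> col_range S" "hnorm2 I (\<lambda>k. ?\<xi> k - \<omega> k) < hnorm2 I (mat_apply I F ?\<xi>) + e"
      using ann_approx[OF vN I S F e, of ?\<xi>] by blast
    obtain S0 where S0': "S0 \<in> ?\<Lambda>" "\<omega> \<in> col_range S0" using col_range_finite[OF \<omega>(1)] by blast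
    have "hnorm2 I (mat_apply I (G S0) ?\<xi>) \<le> hnorm2 I (mat_apply I F ?\<xi>) + e"
      using ann_upper[OF vN I S0 G, OF S0'(1) S0'(1) S0'(2), of ?\<xi>] \<omega>(2) by simp
    then show "\<exists>l\<in>?\<Lambda>. Re (cinner (blinfun_apply (G l i i) \<eta>) \<eta>) \<le> Re (cinner (blinfun_apply (F i i) \<eta>) \<eta>) + e"
      using S0'(1) cinner_proj_on_diag[OF vN I is_annD(1)[OF G[OF S0'(1)]] i]
        cinner_proj_on_diag[OF vN I is_annD(1)[OF F] i]
      by (intro bexI[of _ S0]) auto
  qed (use e in auto)
  then show ?thesis using G unfolding ptrace_def by blast
qed

text \<open>The block matrix \<open>U = ((1 - q, W), (0, -x))\<close> has the same nullity as \<open>x\<close>, because a row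
  \<open>(y, z)\<close> killed by \<open>U\<close> satisfies \<open>y q = y\<close> and \<open>y W = z x\<close>, so that \<open>y = 0\<close>; and the projection
  \<open>(q, 0)\<close> is killed by its adjoint. Comparing the two by rank-nullity gives the bound.\<close>

lemma ptrace_le_ann_finite:
  assumes K: "finite K" and I: "finite I" and L: "finite L" and q: "proj_on A K q"
    and W: "\<And>k i. k \<in> K \<Longrightarrow> i \<in> I \<Longrightarrow> W k i \<in> A" and x: "\<And>l i. l \<in> L \<Longrightarrow> i \<in> I \<Longrightarrow> x l i \<in> A"
    and inj: "\<And>y z. (\<And>k. k \<in> K \<Longrightarrow> y k \<in> A) \<Longrightarrow> (\<And>l. l \<in> L \<Longrightarrow> z l \<in> A) \<Longrightarrow>
      (\<And>k. k \<in> K \<Longrightarrow> (\<Sum>j\<in>K. y j o\<^sub>L q j k) = y k) \<Longrightarrow>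
      (\<And>i. i \<in> I \<Longrightarrow> (\<Sum>k\<in>K. y k o\<^sub>L W k i) = (\<Sum>l\<in>L. z l o\<^sub>L x l i)) \<Longrightarrow> (\<forall>k\<in>K. y k = 0)"
    and N: "is_ann A I (mat_cols L (\<lambda>i l. op_adj (x l i))) N"
  shows "ptrace tr K q \<le> ptrace tr I N"
proof -
  note q' = proj_onD[OF q]
  define U where "U a b = (case a of
      Inl k \<Rightarrow> (case b of Inl k' \<Rightarrow> (if k = k' then id_blinfun else 0) - q k k' | Inr i \<Rightarrow> W k i)
    | Inr l \<Rightarrow> (case b of Inl _ \<Rightarrow> 0 | Inr i \<Rightarrow> - x l i))" for a b
  have UA: "U a b \<in> A" if "a \<in> K <+> L" "b \<in> K <+> I" for a b
    using that W x q'(1) by (auto simp: U_def closed)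
  have fin: "finite (K <+> L)" "finite (K <+> I)" using K I L by auto
  obtain M where M: "is_ann A (K <+> L) (mat_cols (K <+> I) U) M"
    using ann_exists[OF vN fin(1), of "mat_cols (K <+> I) U"] UA by auto
  obtain M' where M': "is_ann A (K <+> I) (mat_cols (K <+> L) (\<lambda>b a. op_adj (U a b))) M'"
    using ann_exists[OF vN fin(2), of "mat_cols (K <+> L) (\<lambda>b a. op_adj (U a b))"] UA by (auto simp: closed)
  obtain X where X: "is_ann A L (mat_cols I x) X"
    using ann_exists[OF vN L, of "mat_cols I x"] x by auto
  have MA: "M a b \<in> A" if "a \<in> K <+> L" "b \<in> K <+> L" for a b
    using proj_onD(1)[OF is_annD(1)[OF M]] that .
  have rows: "(\<forall>k\<in>K. M a (Inl k) = 0) \<and> (\<forall>i\<in>I. (\<Sum>l\<in>L. M a (Inr l) o\<^sub>L x l i) = 0)" if a: "a \<in> K <+> L" for a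
  proof -
    have z: "(\<Sum>b\<in>K <+> L. M a b o\<^sub>L U b c) = 0" if "c \<in> K <+> I" for c
      using is_annD(2)[OF M imageI[OF that] a] .
    have 1: "(\<Sum>k\<in>K. M a (Inl k) o\<^sub>L W k i) = (\<Sum>l\<in>L. M a (Inr l) o\<^sub>L x l i)" if "i \<in> I" for i
      using z[of "Inr i"] that by (simp add: sum_Plus K L U_def compose_minus_right sum_negf InrI)
    have 0: "\<forall>k\<in>K. M a (Inl k) = 0"
    proof (rule inj)
      show "(\<Sum>j\<in>K. M a (Inl j) o\<^sub>L q j k) = M a (Inl k)" if "k \<in> K" for k
        using z[of "Inl k"] that
        by (simp add: sum_Plus K L U_def compose_diff_right sum_subtractf sum_compose_delta InlI)
    qed (use 1 MA a in auto)
    with 1 show ?thesis by simp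
  qed
  have "ptrace tr (K <+> L) M \<le> ptrace tr (K <+> L) (blk_r X)"
  proof (rule ptrace_mono[OF is_annD(1)[OF M] proj_on_blk_r[OF K L is_annD(1)[OF X]]])
    fix a b assume a: "a \<in> K <+> L" and b: "b \<in> K <+> L"
    show "(\<Sum>c\<in>K <+> L. M a c o\<^sub>L blk_r X c b) = M a b"
      using b
    proof (rule PlusE)
      fix l assume l: "l \<in> L" "b = Inr l"
      have "(\<Sum>m\<in>L. M a (Inr m) o\<^sub>L X m l) = M a (Inr l)"
        using rows[OF a] MA[OF a] l(1) by (intro is_annD(3)[OF X]) (auto intro: bounded)
      then show ?thesis using l by (simp add: sum_Plus K L)
    qed (use rows[OF a] in \<open>simp add: sum_Plus K L\<close>)
  qed
  then have MX: "ptrace tr (K <+> L) M \<le> ptrace tr L X" by (simp add: ptrace_blk_r K L)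
  \<comment> \<open>The adjoint of \<open>U\<close> kills the rows of \<open>q\<close>: for the
    columns from \<open>K\<close> because \<open>q (1 - q) = 0\<close>, for those from
    \<open>L\<close> because the lower left block of \<open>U\<close> is zero.\<close>
  have "ptrace tr (K <+> I) (blk_l q) \<le> ptrace tr (K <+> I) M'"
  proof (rule ptrace_mono[OF proj_on_blk_l[OF K I q] is_annD(1)[OF M']])
    fix a b assume a: "a \<in> K <+> I" and b: "b \<in> K <+> I"
    show "(\<Sum>c\<in>K <+> I. blk_l q a c o\<^sub>L M' c b) = blk_l q a b"
    proof (rule is_annD(3)[OF M' _ _ b])
      show "blk_l q a c \<in> bounded_ops" if "c \<in> K <+> I" for c
        using a that q'(1) by (auto simp: bounded bounded_ops_zero)
      fix d assume "d \<in> mat_cols (K <+> L) (\<lambda>b a. op_adj (U a b))"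
      then obtain u where u: "u \<in> K <+> L" "d = (\<lambda>c. op_adj (U u c))" by blast
      have *: "(\<Sum>c\<in>K. q k c o\<^sub>L op_adj (U u (Inl c))) = 0" if k: "k \<in> K" for k
        using u(1)
      proof (rule PlusE)
        fix m assume m: "m \<in> K" "u = Inl m"
        have "(\<Sum>c\<in>K. q k c o\<^sub>L op_adj (U u (Inl c))) = (\<Sum>c\<in>K. q k c o\<^sub>L ((if c = m then id_blinfun else 0) - q c m))"
        proof (intro sum.cong refl arg_cong[where f = "\<lambda>T. q k _ o\<^sub>L T"])
          fix c assume "c \<in> K"
          then show "op_adj (U u (Inl c)) = (if c = m then id_blinfun else 0) - q c m"
            using m q'(1,3) bounded by (simp add: U_def op_adj_diff bounded_ops_id bounded_ops_zero)
        qed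
        then show ?thesis using m k q'(2) by (simp add: compose_diff_right sum_subtractf sum_compose_delta K)
      qed (simp add: U_def)
      show "(\<Sum>c\<in>K <+> I. blk_l q a c o\<^sub>L d c) = 0"
        using a * by (auto simp: sum_Plus K I u(2))
    qed
  qed
  then have "ptrace tr K q \<le> ptrace tr (K <+> I) M'" by (simp add: ptrace_blk_l K I)
  \<comment> \<open>Rank-nullity for \<open>U\<close> expresses the trace of \<open>M'\<close> as
    that of \<open>M\<close> plus \<open>card I - card L\<close> copies of the trace of the
    identity; rank-nullity for \<open>x\<close> relates \<open>N\<close> to \<open>X\<close> in the
    same way.\<close>
  moreover have "real (card K + card L) * Re (tr id_blinfun) - ptrace tr (K <+> L) M
      = real (card K + card I) * Re (tr id_blinfun) - ptrace tr (K <+> I) M'"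
    using rank_nullity[OF fin UA M M'] by (simp add: card_Plus K L I)
  moreover have "real (card L) * Re (tr id_blinfun) - ptrace tr L X = real (card I) * Re (tr id_blinfun) - ptrace tr I N"
    using rank_nullity[OF L I x X N] .
  ultimately show ?thesis using MX by (simp add: algebra_simps)
qed

text \<open>The annihilator of all relations is approximated in trace by annihilators of finitely
  many, for which the finite case applies; hence \<open>inj\<close> speaks of finite
  \<open>L\<close>.\<close>

theorem ptrace_le_ann:
  assumes K: "finite K" and I: "finite I" and q: "proj_on A K q"
    and W: "\<And>k i. k \<in> K \<Longrightarrow> i \<in> I \<Longrightarrow> W k i \<in> A" and R: "\<forall>c\<in>R. \<forall>i\<in>I. c i \<in> A"
    and inj: "\<And>y L z. finite L \<Longrightarrow> L \<subseteq> R \<Longrightarrow> (\<And>k. k \<in> K \<Longrightarrow> y k \<in> A) \<Longrightarrow> (\<And>l. l \<in> L \<Longrightarrow> z l \<in> A) \<Longrightarrow>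
      (\<And>k. k \<in> K \<Longrightarrow> (\<Sum>j\<in>K. y j o\<^sub>L q j k) = y k) \<Longrightarrow>
      (\<And>i. i \<in> I \<Longrightarrow> (\<Sum>k\<in>K. y k o\<^sub>L W k i) = (\<Sum>l\<in>L. z l o\<^sub>L l i)) \<Longrightarrow> (\<forall>k\<in>K. y k = 0)"
    and F: "is_ann A I ((\<lambda>c i. op_adj (c i)) ` R) F"
  shows "ptrace tr K q \<le> ptrace tr I F"
proof (rule field_le_epsilon)
  fix e :: real assume "e > 0"
  have "\<forall>b\<in>(\<lambda>c i. op_adj (c i)) ` R. \<forall>i\<in>I. b i \<in> A" using R by (simp add: closed)
  from ann_directed_inf[OF I this F \<open>e > 0\<close>] obtain S0 F0 where
    S0: "finite S0" "S0 \<subseteq> (\<lambda>c i. op_adj (c i)) ` R" "is_ann A I S0 F0" "ptrace tr I F0 < ptrace tr I F + e" by blast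
  obtain L where L: "finite L" "L \<subseteq> R" "S0 = (\<lambda>c i. op_adj (c i)) ` L"
    using finite_subset_image[OF S0(1,2)] by blast
  have "ptrace tr K q \<le> ptrace tr I F0"
  \<comment> \<open>The finite set of relations indexes itself: row \<open>l\<close> of the matrix
    is \<open>l\<close>.\<close>
  proof (rule ptrace_le_ann_finite[where x = "\<lambda>l. l" and W = W, OF K I L(1) q])
    show "W k i \<in> A" if "k \<in> K" "i \<in> I" for k i using W that .
    show "l i \<in> A" if "l \<in> L" "i \<in> I" for l i using R L(2) that by blast
    show "is_ann A I (mat_cols L (\<lambda>i l. op_adj (l i))) F0" using S0(3) L(3) by simp
  qed (rule inj[OF L(1,2)])
  with S0(4) show "ptrace tr K q \<le> ptrace tr I F + e" by simp
qed

end

section \<open>Induction of modules along a ring inclusion\<close>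

abbreviation tcar :: "('a, 'r) ring_scheme \<Rightarrow> ('a, 'm) module \<Rightarrow> (('a \<times> 'm) \<Rightarrow>\<^sub>0 int) set" where
  "tcar R M \<equiv> {u. Poly_Mapping.keys u \<subseteq> carrier R \<times> carrier M}"

definition tcl :: "('a, 'r) ring_scheme \<Rightarrow> ('a, 's) ring_scheme \<Rightarrow> ('a, 'm) module \<Rightarrow>
    (('a \<times> 'm) \<Rightarrow>\<^sub>0 int) \<Rightarrow> (('a \<times> 'm) \<Rightarrow>\<^sub>0 int) set" where
  "tcl R S M u = tensor_rel R S M #>\<^bsub>tensor_free R M\<^esub> u"

abbreviation fmap :: "('m \<Rightarrow> 'n) \<Rightarrow> (('a \<times> 'm) \<Rightarrow>\<^sub>0 int) \<Rightarrow> (('a \<times> 'n) \<Rightarrow>\<^sub>0 int)" where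
  "fmap f \<equiv> frag_extend (\<lambda>(a, x). frag_of (a, f x))"

abbreviation ract :: "('a, 'r) ring_scheme \<Rightarrow> 'a \<Rightarrow> (('a \<times> 'm) \<Rightarrow>\<^sub>0 int) \<Rightarrow> (('a \<times> 'm) \<Rightarrow>\<^sub>0 int)" where
  "ract R r \<equiv> frag_extend (\<lambda>(a, x). frag_of (r \<otimes>\<^bsub>R\<^esub> a, x))"

lemma tcar_diff: "u \<in> tcar R M \<Longrightarrow> v \<in> tcar R M \<Longrightarrow> u - v \<in> tcar R M"
  using keys_diff[of u v] by blast

lemma tcar_add: "u \<in> tcar R M \<Longrightarrow> v \<in> tcar R M \<Longrightarrow> u + v \<in> tcar R M"
  using keys_add[of u v] by blast

lemma left_module_abelian_group: "left_module S M \<Longrightarrow> abelian_group M"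
  by (simp add: left_module_def)

locale ring_inclusion = ring R for R :: "('a, 'r) ring_scheme" +
  fixes S :: "('a, 's) ring_scheme"
  assumes inclusion: "carrier S \<subseteq> carrier R"
begin

section \<open>Cosets of the tensor relations\<close>

context
  fixes M :: "('a, 'm) module"
  assumes M: "left_module S M"
begin

lemma tensor_rel_gens: "({frag_of (a \<oplus>\<^bsub>R\<^esub> b, x) - frag_of (a, x) - frag_of (b, x) | a b x.
          a \<in> carrier R \<and> b \<in> carrier R \<and> x \<in> carrier M} \<union>
      {frag_of (a, x \<oplus>\<^bsub>M\<^esub> y) - frag_of (a, x) - frag_of (a, y) | a x y.
          a \<in> carrier R \<and> x \<in> carrier M \<and> y \<in> carrier M} \<union>
      {frag_of (a \<otimes>\<^bsub>R\<^esub> s, x) - frag_of (a, s \<odot>\<^bsub>M\<^esub> x) | a s x.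
          a \<in> carrier R \<and> s \<in> carrier S \<and> x \<in> carrier M}) \<subseteq> tcar R M"
  (is "?G \<subseteq> _")
proof
  interpret M: left_module S M by (rule M)
  fix h assume "h \<in> ?G"
  then consider
    a b x where "h = frag_of (a \<oplus>\<^bsub>R\<^esub> b, x) - frag_of (a, x) - frag_of (b, x)"
      "a \<in> carrier R" "b \<in> carrier R" "x \<in> carrier M"
  | a x y where "h = frag_of (a, x \<oplus>\<^bsub>M\<^esub> y) - frag_of (a, x) - frag_of (a, y)"
      "a \<in> carrier R" "x \<in> carrier M" "y \<in> carrier M"
  | a s x where "h = frag_of (a \<otimes>\<^bsub>R\<^esub> s, x) - frag_of (a, s \<odot>\<^bsub>M\<^esub> x)"
      "a \<in> carrier R" "s \<in> carrier S" "x \<in> carrier M"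
    by blast
  then show "h \<in> tcar R M"
  proof cases
    case 1 show ?thesis unfolding 1(1) by (intro tcar_diff) (use 1 in auto)
  next
    case 2 show ?thesis unfolding 2(1) by (intro tcar_diff) (use 2 in auto)
  next
    case 3 show ?thesis unfolding 3(1)
      by (intro tcar_diff) (use 3 inclusion M.smult_closed in auto)
  qed
qed

lemma tensor_rel_subgroup: "subgroup (tensor_rel R S M) (tensor_free R M)"
proof -
  interpret F: group "tensor_free R M" by (simp add: tensor_free_def)
  have "tcar R M = carrier (tensor_free R M)" by (auto simp: tensor_free_def)
  then show ?thesis
    unfolding tensor_rel_def using tensor_rel_gens by (intro F.generate_is_subgroup) simp
qed

lemma tensor_rel_tcar: "u \<in> tensor_rel R S M \<Longrightarrow> u \<in> tcar R M"
  using subgroup.mem_carrier[OF tensor_rel_subgroup, of u] by (simp add: tensor_free_def)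

lemma tensor_rel_zero: "0 \<in> tensor_rel R S M"
  using subgroup.one_closed[OF tensor_rel_subgroup] by (simp add: tensor_free_def)

lemma tensor_rel_add: "u \<in> tensor_rel R S M \<Longrightarrow> v \<in> tensor_rel R S M \<Longrightarrow> u + v \<in> tensor_rel R S M"
  using subgroup.m_closed[OF tensor_rel_subgroup, of u v] by (simp add: tensor_free_def)

lemma tensor_rel_minus: "v \<in> tensor_rel R S M \<Longrightarrow> - v \<in> tensor_rel R S M"
  using subgroup.m_inv_closed[OF tensor_rel_subgroup, of v] tensor_rel_tcar[of v]
  by (simp add: tensor_free_def)

text \<open>Differences alone suffice as induction step: inverses arise as \<open>0 - h\<close> and
  sums as \<open>u - (0 - v)\<close>. This matches the shape of
  \<open>frag_induction\<close>.\<close>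

lemma tensor_rel_induct [consumes 1, case_names zero diff add_left add_right balanced]:
  assumes u: "u \<in> tensor_rel R S M"
    and zero: "P 0"
    and diff: "\<And>u v. u \<in> tensor_rel R S M \<Longrightarrow> v \<in> tensor_rel R S M \<Longrightarrow> P u \<Longrightarrow> P v \<Longrightarrow> P (u - v)"
    and 1: "\<And>a b x. a \<in> carrier R \<Longrightarrow> b \<in> carrier R \<Longrightarrow> x \<in> carrier M \<Longrightarrow>
      P (frag_of (a \<oplus>\<^bsub>R\<^esub> b, x) - frag_of (a, x) - frag_of (b, x))"
    and 2: "\<And>a x y. a \<in> carrier R \<Longrightarrow> x \<in> carrier M \<Longrightarrow> y \<in> carrier M \<Longrightarrow>
      P (frag_of (a, x \<oplus>\<^bsub>M\<^esub> y) - frag_of (a, x) - frag_of (a, y))"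
    and 3: "\<And>a s x. a \<in> carrier R \<Longrightarrow> s \<in> carrier S \<Longrightarrow> x \<in> carrier M \<Longrightarrow>
      P (frag_of (a \<otimes>\<^bsub>R\<^esub> s, x) - frag_of (a, s \<odot>\<^bsub>M\<^esub> x))"
  shows "P u"
proof -
  have "u \<in> tensor_rel R S M \<and> P u"
    using u unfolding tensor_rel_def
  proof (induction rule: generate.induct)
    case one
    then show ?case using zero generate.one[of "tensor_free R M"] by (simp add: tensor_free_def)
  next
    case (incl h)
    have "P h" using incl by (elim UnE CollectE exE conjE) (simp_all only: 1 2 3)
    then show ?case using generate.incl[OF incl] by blast
  next
    case (inv h)
    have "h \<in> tcar R M" using subsetD[OF tensor_rel_gens inv] .
    then have h: "inv\<^bsub>tensor_free R M\<^esub> h = 0 - h" by (simp add: tensor_free_def)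
    have "P h" using inv by (elim UnE CollectE exE conjE) (simp_all only: 1 2 3)
    moreover have "h \<in> tensor_rel R S M" unfolding tensor_rel_def by (rule generate.incl[OF inv])
    ultimately have "P (0 - h)" by (intro diff tensor_rel_zero zero)
    then have "P (inv\<^bsub>tensor_free R M\<^esub> h)" by (simp only: h)
    then show ?case using generate.inv[OF inv] by blast
  next
    case (eng u v)
    then have "u \<in> tensor_rel R S M" "v \<in> tensor_rel R S M" "P u" "P v" by (simp_all add: tensor_rel_def)
    then have "P (u - (0 - v))"
      using tensor_rel_minus by (intro diff zero tensor_rel_zero) simp_all
    then show ?case using eng generate.eng[of u "tensor_free R M" _ v] by (simp add: tensor_free_def)
  qed
  then show ?thesis ..
qed

lemma tensor_rel_left: "a \<in> carrier R \<Longrightarrow> b \<in> carrier R \<Longrightarrow> x \<in> carrier M \<Longrightarrow>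
    frag_of (a \<oplus>\<^bsub>R\<^esub> b, x) - frag_of (a, x) - frag_of (b, x) \<in> tensor_rel R S M"
  unfolding tensor_rel_def by (rule generate.incl) blast

lemma tensor_rel_right: "a \<in> carrier R \<Longrightarrow> x \<in> carrier M \<Longrightarrow> y \<in> carrier M \<Longrightarrow>
    frag_of (a, x \<oplus>\<^bsub>M\<^esub> y) - frag_of (a, x) - frag_of (a, y) \<in> tensor_rel R S M"
  unfolding tensor_rel_def by (rule generate.incl) blast

lemma tensor_rel_balanced: "a \<in> carrier R \<Longrightarrow> s \<in> carrier S \<Longrightarrow> x \<in> carrier M \<Longrightarrow>
    frag_of (a \<otimes>\<^bsub>R\<^esub> s, x) - frag_of (a, s \<odot>\<^bsub>M\<^esub> x) \<in> tensor_rel R S M"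
  unfolding tensor_rel_def by (rule generate.incl) blast

lemma tensor_rel_diff: "u \<in> tensor_rel R S M \<Longrightarrow> v \<in> tensor_rel R S M \<Longrightarrow> u - v \<in> tensor_rel R S M"
  using tensor_rel_add[of u "- v"] tensor_rel_minus by simp

lemma mem_tcl: "w \<in> tcl R S M u \<longleftrightarrow> w - u \<in> tensor_rel R S M"
proof -
  have "w \<in> tcl R S M u \<longleftrightarrow> (\<exists>t\<in>tensor_rel R S M. w = t + u)"
    by (auto simp: tcl_def r_coset_def tensor_free_def)
  then show ?thesis by force
qed

lemma tcl_eq_iff: "tcl R S M u = tcl R S M v \<longleftrightarrow> u - v \<in> tensor_rel R S M"
proof
  assume "tcl R S M u = tcl R S M v"
  then have "u \<in> tcl R S M v" using mem_tcl[of u u] tensor_rel_zero by simp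
  then show "u - v \<in> tensor_rel R S M" by (simp add: mem_tcl)
next
  assume uv: "u - v \<in> tensor_rel R S M"
  show "tcl R S M u = tcl R S M v"
  proof (intro Set.set_eqI iffI)
    fix w
    show "w \<in> tcl R S M v" if "w \<in> tcl R S M u"
      using tensor_rel_add[OF that[unfolded mem_tcl] uv] by (simp add: mem_tcl)
    show "w \<in> tcl R S M u" if "w \<in> tcl R S M v"
      using tensor_rel_diff[OF that[unfolded mem_tcl] uv] by (simp add: mem_tcl)
  qed
qed

lemma carrier_induced: "carrier (induced_module R S M) = tcl R S M ` tcar R M"
  by (auto simp: induced_module_def FactGroup_def RCOSETS_def tcl_def tensor_free_def)

lemma zero_induced: "\<zero>\<^bsub>induced_module R S M\<^esub> = tcl R S M 0"
  using mem_tcl[of _ 0] by (auto simp: induced_module_def FactGroup_def)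

lemma add_induced: "tcl R S M u \<oplus>\<^bsub>induced_module R S M\<^esub> tcl R S M v = tcl R S M (u + v)"
proof -
  have "w \<in> tcl R S M (u + v) \<longleftrightarrow> (\<exists>p\<in>tcl R S M u. \<exists>q\<in>tcl R S M v. w = p + q)" for w
  proof
    assume "w \<in> tcl R S M (u + v)"
    then have "w - v \<in> tcl R S M u" by (simp add: mem_tcl algebra_simps)
    moreover have "v \<in> tcl R S M v" using tensor_rel_zero by (simp add: mem_tcl)
    ultimately show "\<exists>p\<in>tcl R S M u. \<exists>q\<in>tcl R S M v. w = p + q" by force
  next
    assume "\<exists>p\<in>tcl R S M u. \<exists>q\<in>tcl R S M v. w = p + q"
    then obtain p q where pq: "p - u \<in> tensor_rel R S M" "q - v \<in> tensor_rel R S M" "w = p + q"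
      by (auto simp: mem_tcl)
    have "w - (u + v) = (p - u) + (q - v)" using pq(3) by simp
    then show "w \<in> tcl R S M (u + v)" unfolding mem_tcl using tensor_rel_add[OF pq(1,2)] by (simp only:)
  qed
  then show ?thesis
    by (auto simp: induced_module_def FactGroup_def set_mult_def tensor_free_def)
qed

end

text \<open>An additive map of formal sums that preserves the relations descends to cosets, and then
  the union over representatives is a union of equal cosets. It serves both the scalar action and
  the induced maps.\<close>

lemma UN_tcl:
  assumes M: "left_module S M" and N: "left_module S N"
    and \<phi>: "\<forall>u v. \<phi> (u - v) = \<phi> u - \<phi> v" "\<And>t. t \<in> tensor_rel R S M \<Longrightarrow> \<phi> t \<in> tensor_rel R S N"
  shows "(\<Union>v\<in>tcl R S M u. tensor_rel R S N #>\<^bsub>tensor_free R N\<^esub> \<phi> v) = tcl R S N (\<phi> u)"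
proof -
  have "tcl R S N (\<phi> v) = tcl R S N (\<phi> u)" if "v \<in> tcl R S M u" for v
    using that \<phi>(2)[of "v - u"] by (simp add: mem_tcl[OF M] tcl_eq_iff[OF N] \<phi>(1))
  moreover have "u \<in> tcl R S M u"
    unfolding mem_tcl[OF M] diff_self by (rule tensor_rel_zero[OF M])
  ultimately have "(\<Union>v\<in>tcl R S M u. tcl R S N (\<phi> v)) = tcl R S N (\<phi> u)"
    by blast
  then show ?thesis by (simp only: tcl_def)
qed

lemma ract_tcar: "r \<in> carrier R \<Longrightarrow> u \<in> tcar R M \<Longrightarrow> ract R r u \<in> tcar R M"
  using keys_frag_extend[of "\<lambda>(a, x). frag_of (r \<otimes>\<^bsub>R\<^esub> a, x)" u] by (fastforce simp: keys_frag_of)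

lemma fmap_tcar: "f \<in> carrier M \<rightarrow> carrier N \<Longrightarrow> u \<in> tcar R M \<Longrightarrow> fmap f u \<in> tcar R N"
  using keys_frag_extend[of "\<lambda>(a, x). frag_of (a, f x)" u] by (fastforce simp: keys_frag_of)

lemma ract_tensor_rel:
  assumes M: "left_module S M" and r: "r \<in> carrier R"
  shows "t \<in> tensor_rel R S M \<Longrightarrow> ract R r t \<in> tensor_rel R S M"
proof (induction rule: tensor_rel_induct[OF M, consumes 1, case_names zero diff add_left add_right balanced])
  case (add_left a b x)
  then show ?case using r tensor_rel_left[OF M, of "r \<otimes>\<^bsub>R\<^esub> a" "r \<otimes>\<^bsub>R\<^esub> b" x]
    by (simp add: frag_extend_diff r_distr)
next
  case (balanced a s x)
  then show ?case using r tensor_rel_balanced[OF M, of "r \<otimes>\<^bsub>R\<^esub> a" s x] inclusion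
    by (simp add: frag_extend_diff m_assoc subset_iff)
qed (use r M in \<open>simp_all add: frag_extend_diff tensor_rel_diff tensor_rel_zero tensor_rel_right\<close>)

lemma fmap_tensor_rel:
  assumes M: "left_module S M" and N: "left_module S N" and f: "f \<in> lmod_hom S M N"
  shows "t \<in> tensor_rel R S M \<Longrightarrow> fmap f t \<in> tensor_rel R S N"
proof (induction rule: tensor_rel_induct[OF M, consumes 1, case_names zero diff add_left add_right balanced])
  case (add_right a x y)
  then show ?case using f tensor_rel_right[OF N, of a "f x" "f y"]
    by (auto simp: frag_extend_diff lmod_hom_def)
next
  case (balanced a s x)
  then show ?case using f tensor_rel_balanced[OF N, of a s "f x"]
    by (auto simp: frag_extend_diff lmod_hom_def)
qed (use f N in \<open>auto simp add: lmod_hom_def frag_extend_diff tensor_rel_diff tensor_rel_zero intro!: tensor_rel_left\<close>)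

lemma smult_induced:
  assumes "left_module S M" "r \<in> carrier R"
  shows "r \<odot>\<^bsub>induced_module R S M\<^esub> tcl R S M u = tcl R S M (ract R r u)"
proof -
  have "\<And>t. t \<in> tensor_rel R S M \<Longrightarrow> ract R r t \<in> tensor_rel R S M"
    by (rule ract_tensor_rel[OF assms])
  from UN_tcl[OF assms(1,1) _ this, where u = u] show ?thesis by (simp add: induced_module_def frag_extend_diff)
qed

lemma induced_map_tcl:
  assumes "left_module S M" "left_module S N" "f \<in> lmod_hom S M N"
  shows "induced_map R S N f (tcl R S M u) = tcl R S N (fmap f u)"
proof -
  have "\<And>t. t \<in> tensor_rel R S M \<Longrightarrow> fmap f t \<in> tensor_rel R S N"
    by (rule fmap_tensor_rel[OF assms])
  from UN_tcl[OF assms(1,2) _ this, where u = u] show ?thesis by (simp add: induced_map_def frag_extend_diff)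
qed

text \<open>For identities that hold only modulo relations: the difference of two additive
  extensions need be checked on generators only.\<close>

lemma frag_extend_diff_tensor_rel:
  assumes "\<And>a x. a \<in> carrier R \<Longrightarrow> x \<in> carrier M \<Longrightarrow> frag_extend f (frag_of (a, x)) - frag_extend g (frag_of (a, x)) \<in> tensor_rel R S M"
    and M: "left_module S M" and "u \<in> tcar R M"
  shows "frag_extend f u - frag_extend g u \<in> tensor_rel R S M"
proof -
  have "Poly_Mapping.keys u \<subseteq> carrier R \<times> carrier M" using assms by simp
  then show ?thesis
  proof (induction u rule: frag_induction)
    case (diff u v)
    then show ?case using tensor_rel_diff[OF M, of "frag_extend f u - frag_extend g u" "frag_extend f v - frag_extend g v"]
      by (simp add: frag_extend_diff algebra_simps)
  qed (use assms tensor_rel_zero[OF M] in auto)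
qed

theorem left_module_induced:
  assumes M: "left_module S M"
  shows "left_module R (induced_module R S M)"
proof -
  interpret M: left_module S M by fact
  have "abelian_group (induced_module R S M)"
  proof (rule abelian_groupI)
    show "\<exists>y\<in>carrier (induced_module R S M). y \<oplus>\<^bsub>induced_module R S M\<^esub> x = \<zero>\<^bsub>induced_module R S M\<^esub>"
      if x: "x \<in> carrier (induced_module R S M)" for x
    proof -
      obtain u where u: "u \<in> tcar R M" "x = tcl R S M u"
        using x unfolding carrier_induced[OF M] by blast
      have "- u \<in> tcar R M" using u(1) by simp
      then show ?thesis
        unfolding u(2) zero_induced[OF M] carrier_induced[OF M]
        by (intro bexI[of _ "tcl R S M (- u)"] imageI) (simp add: add_induced[OF M])
    qed
    show "\<zero>\<^bsub>induced_module R S M\<^esub> \<in> carrier (induced_module R S M)"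
      unfolding zero_induced[OF M] carrier_induced[OF M] by (rule imageI) simp
  next
    fix x y assume "x \<in> carrier (induced_module R S M)" "y \<in> carrier (induced_module R S M)"
    then obtain u v where uv: "u \<in> tcar R M" "x = tcl R S M u" "v \<in> tcar R M" "y = tcl R S M v"
      unfolding carrier_induced[OF M] by blast
    show "x \<oplus>\<^bsub>induced_module R S M\<^esub> y \<in> carrier (induced_module R S M)"
      unfolding uv add_induced[OF M] carrier_induced[OF M] using tcar_add[OF uv(1,3)] by (rule imageI)
    show "x \<oplus>\<^bsub>induced_module R S M\<^esub> y = y \<oplus>\<^bsub>induced_module R S M\<^esub> x"
      unfolding uv add_induced[OF M] by (simp add: add.commute)
    show "\<zero>\<^bsub>induced_module R S M\<^esub> \<oplus>\<^bsub>induced_module R S M\<^esub> x = x"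
      unfolding uv zero_induced[OF M] add_induced[OF M] by simp
    fix z assume "z \<in> carrier (induced_module R S M)"
    then obtain w where w: "w \<in> tcar R M" "z = tcl R S M w"
      unfolding carrier_induced[OF M] by blast
    show "x \<oplus>\<^bsub>induced_module R S M\<^esub> y \<oplus>\<^bsub>induced_module R S M\<^esub> z =
        x \<oplus>\<^bsub>induced_module R S M\<^esub> (y \<oplus>\<^bsub>induced_module R S M\<^esub> z)"
      unfolding uv w add_induced[OF M] by (simp add: add.assoc)
  qed
  then have ag: "abelian_group (induced_module R S M)" .
  show ?thesis
  proof (intro left_module.intro left_module_axioms.intro)
    show "ring R" by (rule ring_axioms)
    show "abelian_group (induced_module R S M)" by (rule ag)
    fix a x assume a: "a \<in> carrier R" and x: "x \<in> carrier (induced_module R S M)"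
    then obtain u where u: "u \<in> tcar R M" "x = tcl R S M u"
      unfolding carrier_induced[OF M] by blast
    show "a \<odot>\<^bsub>induced_module R S M\<^esub> x \<in> carrier (induced_module R S M)"
      using ract_tcar[OF a u(1)] u(2) a by (simp add: smult_induced[OF M] carrier_induced[OF M])
    { fix b assume b: "b \<in> carrier R"
      \<comment> \<open>Additivity in the scalar is the one module law that fails on
        representatives; the others hold before passing to cosets.\<close>
      have "ract R (a \<oplus>\<^bsub>R\<^esub> b) u - frag_extend (\<lambda>p. (case p of (c, x) \<Rightarrow> frag_of (a \<otimes>\<^bsub>R\<^esub> c, x)) + (case p of (c, x) \<Rightarrow> frag_of (b \<otimes>\<^bsub>R\<^esub> c, x))) u \<in> tensor_rel R S M"
        by (rule frag_extend_diff_tensor_rel[OF _ M u(1)])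
          (use a b tensor_rel_left[OF M] in \<open>simp add: l_distr diff_diff_eq\<close>)
      moreover have "frag_extend (\<lambda>p. f p + g p) u = frag_extend f u + frag_extend g u" for f g :: "'a \<times> 'b \<Rightarrow> ('a \<times> 'b) \<Rightarrow>\<^sub>0 int"
        by (simp add: frag_extend_def frag_cmul_distrib2 sum.distrib)
      ultimately show "(a \<oplus>\<^bsub>R\<^esub> b) \<odot>\<^bsub>induced_module R S M\<^esub> x =
          a \<odot>\<^bsub>induced_module R S M\<^esub> x \<oplus>\<^bsub>induced_module R S M\<^esub> b \<odot>\<^bsub>induced_module R S M\<^esub> x"
        using a b u by (simp add: smult_induced[OF M] add_induced[OF M] tcl_eq_iff[OF M])
      have "ract R (a \<otimes>\<^bsub>R\<^esub> b) u = ract R a (ract R b u)"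
        using u(1)[unfolded mem_Collect_eq]
        by (induction u rule: frag_induction) (use a b in \<open>auto simp: frag_extend_diff m_assoc\<close>)
      then show "(a \<otimes>\<^bsub>R\<^esub> b) \<odot>\<^bsub>induced_module R S M\<^esub> x =
          a \<odot>\<^bsub>induced_module R S M\<^esub> (b \<odot>\<^bsub>induced_module R S M\<^esub> x)"
        using a b u by (simp add: smult_induced[OF M])
    }
    { fix y assume "y \<in> carrier (induced_module R S M)"
      then obtain v where v: "v \<in> tcar R M" "y = tcl R S M v"
      unfolding carrier_induced[OF M] by blast
      show "a \<odot>\<^bsub>induced_module R S M\<^esub> (x \<oplus>\<^bsub>induced_module R S M\<^esub> y) =
          a \<odot>\<^bsub>induced_module R S M\<^esub> x \<oplus>\<^bsub>induced_module R S M\<^esub> a \<odot>\<^bsub>induced_module R S M\<^esub> y"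
        using a u v by (simp add: smult_induced[OF M] add_induced[OF M] frag_extend_add)
    }
  next
    fix x assume x: "x \<in> carrier (induced_module R S M)"
    then obtain u where u: "u \<in> tcar R M" "x = tcl R S M u"
      unfolding carrier_induced[OF M] by blast
    have "ract R \<one>\<^bsub>R\<^esub> u = u"
      using u(1)[unfolded mem_Collect_eq]
      by (induction u rule: frag_induction) (auto simp: frag_extend_diff)
    then show "\<one>\<^bsub>R\<^esub> \<odot>\<^bsub>induced_module R S M\<^esub> x = x"
      using u by (simp add: smult_induced[OF M])
  qed
qed

lemma fmap_id:
  assumes "u \<in> tcar R M" "\<And>x. x \<in> carrier M \<Longrightarrow> f x = x"
  shows "fmap f u = u"
proof -
  have "Poly_Mapping.keys u \<subseteq> carrier R \<times> carrier M" using assms by simp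
  then show ?thesis by (induction u rule: frag_induction) (auto simp: frag_extend_diff assms)
qed

lemma fmap_comp: "fmap g (fmap f u) = fmap (g \<circ> f) u"
proof -
  have "Poly_Mapping.keys u \<subseteq> UNIV" by simp
  then show ?thesis by (induction u rule: frag_induction) (auto simp: frag_extend_diff)
qed

lemma fmap_ract: "fmap f (ract R r u) = ract R r (fmap f u)"
proof -
  have "Poly_Mapping.keys u \<subseteq> UNIV" by simp
  then show ?thesis by (induction u rule: frag_induction) (auto simp: frag_extend_diff)
qed

theorem induced_map_hom:
  assumes M: "left_module S M" and N: "left_module S N" and f: "f \<in> lmod_hom S M N"
  shows "induced_map R S N f \<in> lmod_hom R (induced_module R S M) (induced_module R S N)"
proof -
  have fc: "f \<in> carrier M \<rightarrow> carrier N" using f by (simp add: lmod_hom_def)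
  note [simp] = carrier_induced[OF M] carrier_induced[OF N] induced_map_tcl[OF M N f]
    add_induced[OF M] add_induced[OF N] smult_induced[OF M] smult_induced[OF N]
  show ?thesis
    unfolding lmod_hom_def using fmap_tcar[OF fc]
    by (auto simp: frag_extend_add fmap_ract intro!: imageI)
qed

theorem induced_map_id:
  assumes M: "left_module S M" and X: "X \<in> carrier (induced_module R S M)"
  shows "induced_map R S M (\<lambda>x. x) X = X"
proof -
  have "(\<lambda>x. x) \<in> lmod_hom S M M" by (auto simp: lmod_hom_def)
  then show ?thesis using X by (auto simp: carrier_induced[OF M] induced_map_tcl[OF M M] fmap_id)
qed

lemma lmod_hom_comp: "f \<in> lmod_hom S L M \<Longrightarrow> g \<in> lmod_hom S M N \<Longrightarrow> g \<circ> f \<in> lmod_hom S L N"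
  unfolding lmod_hom_def by (auto simp: Pi_iff)

theorem induced_map_comp:
  assumes L: "left_module S L" and M: "left_module S M" and N: "left_module S N"
    and f: "f \<in> lmod_hom S L M" and g: "g \<in> lmod_hom S M N" and X: "X \<in> carrier (induced_module R S L)"
  shows "induced_map R S N (g \<circ> f) X = induced_map R S N g (induced_map R S M f X)"
  using X by (auto simp: carrier_induced[OF L] induced_map_tcl[OF L N lmod_hom_comp[OF f g]]
      induced_map_tcl[OF L M f] induced_map_tcl[OF M N g] fmap_comp)

end

subsection \<open>Right exactness\<close>

lemma lmod_homD:
  assumes "f \<in> lmod_hom R M N"
  shows "x \<in> carrier M \<Longrightarrow> f x \<in> carrier N"
    and "x \<in> carrier M \<Longrightarrow> y \<in> carrier M \<Longrightarrow> f (x \<oplus>\<^bsub>M\<^esub> y) = f x \<oplus>\<^bsub>N\<^esub> f y"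
    and "a \<in> carrier R \<Longrightarrow> x \<in> carrier M \<Longrightarrow> f (a \<odot>\<^bsub>M\<^esub> x) = a \<odot>\<^bsub>N\<^esub> f x"
  using assms by (auto simp: lmod_hom_def)

lemma lmod_hom_zero:
  assumes "abelian_group M" "abelian_group N" "f \<in> lmod_hom R M N"
  shows "f \<zero>\<^bsub>M\<^esub> = \<zero>\<^bsub>N\<^esub>"
proof -
  interpret M: abelian_group M by fact
  interpret N: abelian_group N by fact
  have "f \<zero>\<^bsub>M\<^esub> \<oplus>\<^bsub>N\<^esub> f \<zero>\<^bsub>M\<^esub> = f \<zero>\<^bsub>M\<^esub>"
    using lmod_homD(2)[OF assms(3), of "\<zero>\<^bsub>M\<^esub>" "\<zero>\<^bsub>M\<^esub>"] by simp
  then show ?thesis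
    using lmod_homD(1)[OF assms(3), of "\<zero>\<^bsub>M\<^esub>"] by (simp add: N.add.l_cancel_one')
qed

lemma lmod_hom_minus:
  assumes "abelian_group M" "abelian_group N" "f \<in> lmod_hom R M N" "x \<in> carrier M"
  shows "f (\<ominus>\<^bsub>M\<^esub> x) = \<ominus>\<^bsub>N\<^esub> f x"
proof -
  interpret M: abelian_group M by fact
  interpret N: abelian_group N by fact
  have "f (\<ominus>\<^bsub>M\<^esub> x) \<oplus>\<^bsub>N\<^esub> f x = \<zero>\<^bsub>N\<^esub>"
    using lmod_homD(2)[OF assms(3), of "\<ominus>\<^bsub>M\<^esub> x" x] assms(4)
    by (simp add: M.l_neg lmod_hom_zero[OF assms(1-3)])
  then show ?thesis
    using lmod_homD(1)[OF assms(3)] assms(4) by (metis M.a_inv_closed N.minus_equality)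
qed

lemma a_kernel_iff: "x \<in> a_kernel M N g \<longleftrightarrow> x \<in> carrier M \<and> g x = \<zero>\<^bsub>N\<^esub>"
  by (simp add: a_kernel_def kernel_def)

context ring_inclusion
begin

text \<open>A set-theoretic section \<open>s\<close> of \<open>g\<close> yields a candidate inverse
  modulo \<open>Im\<close>, the image of \<open>f\<close> together with the relations. In general
  \<open>s\<close> is neither additive nor linear, but its defects lie in the kernel of
  \<open>g\<close>, which is the image of \<open>f\<close>, and so disappear modulo
  \<open>Im\<close>.\<close>

lemma fmap_right_exact:
  assumes L: "left_module S L" and M: "left_module S M" and N: "left_module S N"
    and f: "f \<in> lmod_hom S L M" and g: "g \<in> lmod_hom S M N"
    and ker: "f ` carrier L = a_kernel M N g" and surj: "g ` carrier M = carrier N"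
    and u: "u \<in> tcar R M" "fmap g u \<in> tensor_rel R S N"
  shows "\<exists>w\<in>tcar R L. u - fmap f w \<in> tensor_rel R S M"
proof -
  interpret MA: abelian_group M using M by (rule left_module_abelian_group)
  interpret NA: abelian_group N using N by (rule left_module_abelian_group)
  interpret MM: left_module S M by (rule M)
  interpret NN: left_module S N by (rule N)
  define Im where "Im = {u. \<exists>w\<in>tcar R L. u - fmap f w \<in> tensor_rel R S M}"
  have Im_diff: "u - v \<in> Im" if uv: "u \<in> Im" "v \<in> Im" for u v
  proof -
    obtain w z where w: "w \<in> tcar R L" "u - fmap f w \<in> tensor_rel R S M"
      and z: "z \<in> tcar R L" "v - fmap f z \<in> tensor_rel R S M" using uv by (auto simp: Im_def)
    have "(u - v) - fmap f (w - z) = (u - fmap f w) - (v - fmap f z)" by (simp add: frag_extend_diff)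
    then have "(u - v) - fmap f (w - z) \<in> tensor_rel R S M"
      using tensor_rel_diff[OF M w(2) z(2)] by (simp only:)
    then show ?thesis unfolding Im_def using tcar_diff[OF w(1) z(1)] by blast
  qed
  have Im_T: "u \<in> Im" if "u \<in> tensor_rel R S M" for u
    using that by (auto simp: Im_def intro!: exI[of _ 0])
  have Im_minus: "- v \<in> Im" if "v \<in> Im" for v
    using Im_diff[OF Im_T[OF tensor_rel_zero[OF M]] that] by simp
  have Im_add: "u + v \<in> Im" if "u \<in> Im" "v \<in> Im" for u v
    using Im_diff[OF that(1) Im_minus[OF that(2)]] by simp
  define s where "s = inv_into (carrier M) g"
  have s: "s n \<in> carrier M" "g (s n) = n" if "n \<in> carrier N" for n
    using that surj by (auto simp: s_def inv_into_into f_inv_into_f)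
  text \<open>Two elements of \<open>M\<close> with the same image under \<open>g\<close> differ by an element of \<open>f(L)\<close>.\<close>
  have key: "frag_of (a, x) - frag_of (a, y) \<in> Im"
    if a: "a \<in> carrier R" and xy: "x \<in> carrier M" "y \<in> carrier M" "g x = g y" for a x y
  proof -
    have "x \<ominus>\<^bsub>M\<^esub> y \<in> a_kernel M N g"
      using xy lmod_homD[OF g] lmod_hom_minus[OF left_module_abelian_group[OF M] left_module_abelian_group[OF N] g]
      by (simp add: a_kernel_iff a_minus_def NA.r_neg)
    then obtain l where l: "l \<in> carrier L" "f l = x \<ominus>\<^bsub>M\<^esub> y" using ker by (metis imageE)
    have x: "y \<oplus>\<^bsub>M\<^esub> f l = x" using xy l(2) by (simp add: a_minus_def MA.a_lcomm MA.r_neg)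
    have "frag_of (a, x) - frag_of (a, y) - frag_of (a, f l) \<in> tensor_rel R S M"
      using tensor_rel_right[OF M a xy(2), of "f l"] lmod_homD(1)[OF f l(1)] x by simp
    then show ?thesis
      unfolding Im_def using a l(1) by (intro CollectI bexI[of _ "frag_of (a, l)"]) (simp_all add: keys_frag_of)
  qed
  have gs: "g (s x \<oplus>\<^bsub>M\<^esub> s y) = x \<oplus>\<^bsub>N\<^esub> y" if "x \<in> carrier N" "y \<in> carrier N" for x y
    using that s lmod_homD(2)[OF g] by simp
  have T_Im: "fmap s v \<in> Im" if "v \<in> tensor_rel R S N" for v
    using that
  proof (induction rule: tensor_rel_induct[OF N, consumes 1, case_names zero diff add_left add_right balanced])
    case zero then show ?case using Im_T[OF tensor_rel_zero[OF M]] by simp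
  next
    case (diff u v) then show ?case using Im_diff by (simp add: frag_extend_diff)
  next
    case (add_left a b x)
    then show ?case using Im_T[OF tensor_rel_left[OF M, of a b "s x"]] s by (simp add: frag_extend_diff)
  next
    case (add_right a x y)
    have "(frag_of (a, s (x \<oplus>\<^bsub>N\<^esub> y)) - frag_of (a, s x \<oplus>\<^bsub>M\<^esub> s y)) +
        (frag_of (a, s x \<oplus>\<^bsub>M\<^esub> s y) - frag_of (a, s x) - frag_of (a, s y)) \<in> Im"
      using add_right s gs by (intro Im_add key Im_T tensor_rel_right[OF M]) auto
    then show ?case by (simp add: frag_extend_diff frag_extend_add algebra_simps)
  next
    case (balanced a t x)
    have "(frag_of (a \<otimes>\<^bsub>R\<^esub> t, s x) - frag_of (a, t \<odot>\<^bsub>M\<^esub> s x)) +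
        (frag_of (a, t \<odot>\<^bsub>M\<^esub> s x) - frag_of (a, s (t \<odot>\<^bsub>N\<^esub> x))) \<in> Im"
      using balanced s lmod_homD(3)[OF g] NN.smult_closed[of t x]
      by (intro Im_add key Im_T tensor_rel_balanced[OF M] MM.smult_closed) (auto intro: NN.smult_closed)
    then show ?case by (simp add: frag_extend_diff)
  qed
  \<comment> \<open>Modulo \<open>Im\<close>, going down by \<open>g\<close> and back by
    \<open>s\<close> changes nothing; for the given \<open>u\<close> the round trip passes through a
    relation.\<close>
  have "u - fmap s (fmap g u) \<in> Im"
    using u(1)[unfolded mem_Collect_eq]
  proof (induction u rule: frag_induction)
    case zero then show ?case using Im_T[OF tensor_rel_zero[OF M]] by simp
  next
    case (one p)
    then show ?case using key[of "fst p" "snd p" "s (g (snd p))"] s lmod_homD(1)[OF g] by auto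
  next
    case (diff u v)
    then show ?case using Im_diff[of "u - fmap s (fmap g u)" "v - fmap s (fmap g v)"]
      by (simp add: frag_extend_diff algebra_simps)
  qed
  then have "u - fmap s (fmap g u) + fmap s (fmap g u) \<in> Im" using T_Im[OF u(2)] by (rule Im_add)
  then show ?thesis by (simp add: Im_def)
qed

theorem induced_right_exact:
  assumes L: "left_module S L" and M: "left_module S M" and N: "left_module S N"
    and f: "f \<in> lmod_hom S L M" and g: "g \<in> lmod_hom S M N"
    and ker: "f ` carrier L = a_kernel M N g" and surj: "g ` carrier M = carrier N"
  shows "induced_map R S M f ` carrier (induced_module R S L) =
      a_kernel (induced_module R S M) (induced_module R S N) (induced_map R S N g)"
    and "induced_map R S N g ` carrier (induced_module R S M) = carrier (induced_module R S N)"
proof -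
  note maps = induced_map_tcl[OF L M f] induced_map_tcl[OF M N g]
  have fc: "f \<in> carrier L \<rightarrow> carrier M" and gc: "g \<in> carrier M \<rightarrow> carrier N"
    using f g by (simp_all add: lmod_hom_def)
  have gf: "fmap g (fmap f w) \<in> tensor_rel R S N" if "w \<in> tcar R L" for w
    using that[unfolded mem_Collect_eq]
  proof (induction w rule: frag_induction)
    case (one p)
    obtain a l where p: "p = (a, l)" "a \<in> carrier R" "l \<in> carrier L" using one by auto
    then have "g (f l) = \<zero>\<^bsub>N\<^esub>" using ker a_kernel_iff[of "f l" M N g] by blast
    moreover have "frag_of (a, \<zero>\<^bsub>N\<^esub>) \<in> tensor_rel R S N"
    proof -
      interpret NA: abelian_group N using N by (rule left_module_abelian_group)
      show ?thesis using tensor_rel_minus[OF N tensor_rel_right[OF N p(2), of "\<zero>\<^bsub>N\<^esub>" "\<zero>\<^bsub>N\<^esub>"]] by simp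
    qed
    ultimately show ?case by (simp add: p(1))
  next
    case (diff a b)
    then show ?case using tensor_rel_diff[OF N] by (simp add: frag_extend_diff)
  qed (simp add: tensor_rel_zero[OF N])
  show "induced_map R S M f ` carrier (induced_module R S L) =
      a_kernel (induced_module R S M) (induced_module R S N) (induced_map R S N g)" (is "?A = ?B")
  proof (rule Set.equalityI; rule subsetI)
    fix X assume "X \<in> ?A"
    then obtain w where w: "w \<in> tcar R L" "X = tcl R S M (fmap f w)"
      unfolding carrier_induced[OF L] using maps(1) by blast
    then show "X \<in> ?B"
      using fmap_tcar[OF fc w(1)] gf[OF w(1)]
      by (auto simp: a_kernel_iff carrier_induced[OF M] maps zero_induced[OF N] tcl_eq_iff[OF N])
  next
    fix X assume "X \<in> ?B"
    then have "X \<in> carrier (induced_module R S M)" and X0: "induced_map R S N g X = \<zero>\<^bsub>induced_module R S N\<^esub>"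
      by (simp_all add: a_kernel_iff)
    then obtain u where u: "u \<in> tcar R M" "X = tcl R S M u" unfolding carrier_induced[OF M] by blast
    have "fmap g u \<in> tensor_rel R S N"
      using X0 unfolding u(2) maps zero_induced[OF N] tcl_eq_iff[OF N] by simp
    from fmap_right_exact[OF assms u(1) this] obtain w where
      w: "w \<in> tcar R L" "u - fmap f w \<in> tensor_rel R S M" by blast
    then have "X = induced_map R S M f (tcl R S L w)" unfolding u(2) maps tcl_eq_iff[OF M] by simp
    then show "X \<in> ?A" unfolding carrier_induced[OF L] using w(1) by blast
  qed
  show "induced_map R S N g ` carrier (induced_module R S M) = carrier (induced_module R S N)"
  proof (rule Set.equalityI; rule subsetI)
    fix X assume "X \<in> induced_map R S N g ` carrier (induced_module R S M)"
    then show "X \<in> carrier (induced_module R S N)"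
      using lmod_homD(1)[OF induced_map_hom[OF M N g]] by blast
  next
    fix X assume "X \<in> carrier (induced_module R S N)"
    then obtain v where v: "v \<in> tcar R N" "X = tcl R S N v" unfolding carrier_induced[OF N] by blast
    define s where "s = inv_into (carrier M) g"
    have s: "s \<in> carrier N \<rightarrow> carrier M" "\<And>n. n \<in> carrier N \<Longrightarrow> (g \<circ> s) n = n"
      using surj by (auto simp: s_def inv_into_into f_inv_into_f)
    have "X = induced_map R S N g (tcl R S M (fmap s v))"
      unfolding v(2) maps fmap_comp using fmap_id[OF v(1) s(2)] by simp
    then show "X \<in> induced_map R S N g ` carrier (induced_module R S M)"
      unfolding carrier_induced[OF M] using fmap_tcar[OF s(1) v(1)] by blast
  qed
qed

end

subsection \<open>Linear combinations\<close>

lemma op_ring_simps [simp]: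
  "carrier (op_ring A) = A" "x \<otimes>\<^bsub>op_ring A\<^esub> y = x o\<^sub>L y" "x \<oplus>\<^bsub>op_ring A\<^esub> y = x + y"
  "\<one>\<^bsub>op_ring A\<^esub> = id_blinfun" "\<zero>\<^bsub>op_ring A\<^esub> = 0"
  by (simp_all add: op_ring_def)

lemma (in vn_algebra) ring_op_ring: "ring (op_ring A)"
proof (rule ringI)
  show "abelian_group (op_ring A)"
  proof (rule abelian_groupI)
    show "\<exists>y\<in>carrier (op_ring A). y \<oplus>\<^bsub>op_ring A\<^esub> x = \<zero>\<^bsub>op_ring A\<^esub>" if "x \<in> carrier (op_ring A)" for x
      using that minus_mem by (intro bexI[of _ "- x"]) auto
  qed (auto simp: closed)
  show "monoid (op_ring A)"
    by (rule monoidI) (auto simp: closed compose_assoc)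
qed (auto simp: compose_add_left compose_add_right)

definition lc :: "('a, 'm) module \<Rightarrow> 'i set \<Rightarrow> ('i \<Rightarrow> 'a) \<Rightarrow> ('i \<Rightarrow> 'm) \<Rightarrow> 'm" where
  "lc M I c g = finsum M (\<lambda>i. c i \<odot>\<^bsub>M\<^esub> g i) I"

text \<open>Modules over the operator ring: scalars form a type class, so that linear combinations of
  scalars are ordinary sums.\<close>

locale op_module = vn_algebra A + M: left_module "op_ring A" M
  for A :: "'h::complex_hilbert oper set" and M :: "('h oper, 'm) module"
begin

lemma smult_zero_left: "x \<in> carrier M \<Longrightarrow> 0 \<odot>\<^bsub>M\<^esub> x = \<zero>\<^bsub>M\<^esub>"
proof -
  assume x: "x \<in> carrier M"
  have "0 \<odot>\<^bsub>M\<^esub> x \<oplus>\<^bsub>M\<^esub> 0 \<odot>\<^bsub>M\<^esub> x = 0 \<odot>\<^bsub>M\<^esub> x"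
    using M.smult_l_distr[of 0 0 x] x by simp
  then show ?thesis using M.smult_closed[of 0 x] x by (simp add: M.add.l_cancel_one')
qed

lemma smult_zero_right: "a \<in> A \<Longrightarrow> a \<odot>\<^bsub>M\<^esub> \<zero>\<^bsub>M\<^esub> = \<zero>\<^bsub>M\<^esub>"
proof -
  assume a: "a \<in> A"
  have "a \<odot>\<^bsub>M\<^esub> \<zero>\<^bsub>M\<^esub> \<oplus>\<^bsub>M\<^esub> a \<odot>\<^bsub>M\<^esub> \<zero>\<^bsub>M\<^esub> = a \<odot>\<^bsub>M\<^esub> \<zero>\<^bsub>M\<^esub>"
    using M.smult_r_distr[of a "\<zero>\<^bsub>M\<^esub>" "\<zero>\<^bsub>M\<^esub>"] a by simp
  then show ?thesis using M.smult_closed[of a "\<zero>\<^bsub>M\<^esub>"] a by (simp add: M.add.l_cancel_one')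
qed

lemma smult_mem: "a \<in> A \<Longrightarrow> x \<in> carrier M \<Longrightarrow> a \<odot>\<^bsub>M\<^esub> x \<in> carrier M"
  using M.smult_closed by simp

lemma smult_minus_one: "w \<in> carrier M \<Longrightarrow> (- id_blinfun) \<odot>\<^bsub>M\<^esub> w = \<ominus>\<^bsub>M\<^esub> w"
proof -
  assume w: "w \<in> carrier M"
  have "w \<oplus>\<^bsub>M\<^esub> (- id_blinfun) \<odot>\<^bsub>M\<^esub> w = \<zero>\<^bsub>M\<^esub>"
    using M.smult_l_distr[of id_blinfun "- id_blinfun" w] M.smult_one[OF w] w
    by (simp add: closed smult_zero_left)
  then show "(- id_blinfun) \<odot>\<^bsub>M\<^esub> w = \<ominus>\<^bsub>M\<^esub> w"
    using w smult_mem[of "- id_blinfun" w] by (metis M.minus_equality M.a_comm id_mem minus_mem)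
qed

lemma lc_closed: "(\<And>i. i \<in> I \<Longrightarrow> c i \<in> A) \<Longrightarrow> (\<And>i. i \<in> I \<Longrightarrow> g i \<in> carrier M) \<Longrightarrow> lc M I c g \<in> carrier M"
  unfolding lc_def by (intro M.finsum_closed) (auto intro: smult_mem)

lemma lc_cong: "I = J \<Longrightarrow> (\<And>i. i \<in> J \<Longrightarrow> c' i \<in> A) \<Longrightarrow> (\<And>i. i \<in> J \<Longrightarrow> g' i \<in> carrier M) \<Longrightarrow>
   (\<And>i. i \<in> J \<Longrightarrow> c i = c' i) \<Longrightarrow> (\<And>i. i \<in> J \<Longrightarrow> g i = g' i) \<Longrightarrow> lc M I c g = lc M J c' g'"
  unfolding lc_def by (intro M.finsum_cong') (auto intro: smult_mem)

lemma lc_empty [simp]: "lc M {} c g = \<zero>\<^bsub>M\<^esub>"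
  by (simp add: lc_def)

lemma lc_insert:
  assumes "finite I" "k \<notin> I" "c k \<in> A" "g k \<in> carrier M"
    "\<And>i. i \<in> I \<Longrightarrow> c i \<in> A" "\<And>i. i \<in> I \<Longrightarrow> g i \<in> carrier M"
  shows "lc M (insert k I) c g = c k \<odot>\<^bsub>M\<^esub> g k \<oplus>\<^bsub>M\<^esub> lc M I c g"
  unfolding lc_def using assms by (intro M.finsum_insert) (auto intro: smult_mem)

lemma lc_add:
  assumes "\<And>i. i \<in> I \<Longrightarrow> c i \<in> A" "\<And>i. i \<in> I \<Longrightarrow> d i \<in> A" "\<And>i. i \<in> I \<Longrightarrow> g i \<in> carrier M"
  shows "lc M I (\<lambda>i. c i + d i) g = lc M I c g \<oplus>\<^bsub>M\<^esub> lc M I d g"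
proof -
  have "lc M I (\<lambda>i. c i + d i) g = finsum M (\<lambda>i. c i \<odot>\<^bsub>M\<^esub> g i \<oplus>\<^bsub>M\<^esub> d i \<odot>\<^bsub>M\<^esub> g i) I"
    unfolding lc_def using assms M.smult_l_distr
    by (intro M.finsum_cong') (auto intro!: M.add.m_closed smult_mem)
  also have "\<dots> = lc M I c g \<oplus>\<^bsub>M\<^esub> lc M I d g"
    unfolding lc_def using assms by (intro M.finsum_addf) (auto intro: smult_mem)
  finally show ?thesis .
qed

lemma lc_smult:
  assumes "finite I" "a \<in> A" "\<And>i. i \<in> I \<Longrightarrow> c i \<in> A" "\<And>i. i \<in> I \<Longrightarrow> g i \<in> carrier M"
  shows "lc M I (\<lambda>i. a o\<^sub>L c i) g = a \<odot>\<^bsub>M\<^esub> lc M I c g"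
  using assms
proof (induction I rule: finite_induct)
  case empty then show ?case by (simp add: smult_zero_right)
next
  case (insert k I)
  have [simp]: "lc M I c g \<in> carrier M" using insert by (intro lc_closed) auto
  show ?case
    using insert M.smult_assoc[of a "c k" "g k"] M.smult_r_distr[of a "c k \<odot>\<^bsub>M\<^esub> g k" "lc M I c g"]
    by (simp add: lc_insert closed smult_mem)
qed

lemma lc_zero: "finite I \<Longrightarrow> (\<And>i. i \<in> I \<Longrightarrow> g i \<in> carrier M) \<Longrightarrow> lc M I (\<lambda>i. 0) g = \<zero>\<^bsub>M\<^esub>"
  by (induction I rule: finite_induct) (simp_all add: lc_insert smult_zero_left)

lemma lc_delta:
  assumes "finite I" "k \<in> I" "\<And>i. i \<in> I \<Longrightarrow> g i \<in> carrier M" "a \<in> A"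
  shows "lc M I (\<lambda>i. if i = k then a else 0) g = a \<odot>\<^bsub>M\<^esub> g k"
proof -
  have "lc M (insert k (I - {k})) (\<lambda>i. if i = k then a else 0) g =
      a \<odot>\<^bsub>M\<^esub> g k \<oplus>\<^bsub>M\<^esub> lc M (I - {k}) (\<lambda>i. if i = k then a else 0) g"
    using assms by (subst lc_insert) auto
  also have "lc M (I - {k}) (\<lambda>i. if i = k then a else 0) g = lc M (I - {k}) (\<lambda>i. 0) g"
    using assms by (intro lc_cong) auto
  also have "\<dots> = \<zero>\<^bsub>M\<^esub>" using assms by (intro lc_zero) auto
  finally show ?thesis using assms smult_mem by (simp add: insert_absorb)
qed

text \<open>Associativity \<open>(b c) g = b (c g)\<close> for a row, a matrix and a column of
  module elements; every change of generators below has this shape.\<close>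

lemma lc_compose:
  assumes "finite I" "finite K" "\<And>k. k \<in> K \<Longrightarrow> b k \<in> A" "\<And>k i. k \<in> K \<Longrightarrow> i \<in> I \<Longrightarrow> c k i \<in> A"
    "\<And>i. i \<in> I \<Longrightarrow> g i \<in> carrier M"
  shows "lc M I (\<lambda>i. \<Sum>k\<in>K. b k o\<^sub>L c k i) g = lc M K b (\<lambda>k. lc M I (c k) g)"
  using assms(2-4)
proof (induction K rule: finite_induct)
  case empty then show ?case using assms by (simp add: lc_zero)
next
  case (insert k K)
  have "lc M I (\<lambda>i. \<Sum>k\<in>insert k K. b k o\<^sub>L c k i) g =
      lc M I (\<lambda>i. (b k o\<^sub>L c k i) + (\<Sum>k\<in>K. b k o\<^sub>L c k i)) g"
    using insert by simp
  also have "\<dots> = b k \<odot>\<^bsub>M\<^esub> lc M I (c k) g \<oplus>\<^bsub>M\<^esub> lc M K b (\<lambda>k. lc M I (c k) g)"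
    using insert assms by (subst lc_add) (auto simp: closed lc_smult)
  also have "\<dots> = lc M (insert k K) b (\<lambda>k. lc M I (c k) g)"
    using insert assms by (subst lc_insert) (auto intro!: lc_closed)
  finally show ?case .
qed

lemma lc_hom:
  assumes N: "op_module A N" and f: "f \<in> lmod_hom (op_ring A) M N" and "finite I"
    "\<And>i. i \<in> I \<Longrightarrow> c i \<in> A" "\<And>i. i \<in> I \<Longrightarrow> g i \<in> carrier M"
  shows "f (lc M I c g) = lc N I c (\<lambda>i. f (g i))"
proof -
  interpret N: op_module A N by fact
  show ?thesis
    using assms(3-)
  proof (induction I rule: finite_induct)
    case empty
    then show ?case
      using lmod_hom_zero[OF left_module_abelian_group left_module_abelian_group f]
        M.left_module_axioms N.M.left_module_axioms by simp
  next
    case (insert k I)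
    then show ?case
      using lmod_homD[OF f] by (simp add: lc_insert N.lc_insert lc_closed smult_mem)
  qed
qed

text \<open>The finitely supported function \<open>C\<close> on the module, read as a formal combination of elements,
  has the value \<open>z\<close>.\<close>

definition evaluates :: "('m \<Rightarrow> 'h oper) \<Rightarrow> 'm \<Rightarrow> bool" where
  "evaluates C z \<longleftrightarrow> (\<exists>X. finite X \<and> X \<subseteq> carrier M \<and> (\<forall>m. C m \<in> A) \<and> (\<forall>m. m \<notin> X \<longrightarrow> C m = 0) \<and>
     lc M X C (\<lambda>m. m) = z)"

lemma lc_superset:
  assumes "finite Y" "X \<subseteq> Y" "Y \<subseteq> carrier M" "\<And>m. C m \<in> A" "\<And>m. m \<notin> X \<Longrightarrow> C m = 0"
  shows "lc M Y C (\<lambda>m. m) = lc M X C (\<lambda>m. m)"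
proof -
  have "lc M (X \<union> Z) C (\<lambda>m. m) = lc M X C (\<lambda>m. m)" if "finite Z" "Z \<subseteq> Y" for Z
    using that
  proof (induction Z rule: finite_induct)
    case (insert z Z)
    have fin: "finite (X \<union> Z)" using assms finite_subset insert by auto
    show ?case
    proof (cases "z \<in> X")
      case True then show ?thesis using insert by (simp add: insert_absorb)
    next
      case False
      have "lc M (insert z (X \<union> Z)) C (\<lambda>m. m) = C z \<odot>\<^bsub>M\<^esub> z \<oplus>\<^bsub>M\<^esub> lc M (X \<union> Z) C (\<lambda>m. m)"
        using insert fin False assms by (intro lc_insert) auto
      also have "\<dots> = lc M X C (\<lambda>m. m)"
      proof -
        have "lc M X C (\<lambda>m. m) \<in> carrier M" "z \<in> carrier M" using assms insert by (auto intro!: lc_closed)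
        then show ?thesis using insert assms False by (simp add: smult_zero_left)
      qed
      finally show ?thesis by simp
    qed
  qed simp
  from this[of Y] assms show ?thesis by (simp add: Un_absorb1)
qed

lemma evaluates_unique: "evaluates C z \<Longrightarrow> evaluates C w \<Longrightarrow> z = w"
proof -
  assume "evaluates C z" "evaluates C w"
  then obtain X Y where X: "finite X" "X \<subseteq> carrier M" "\<And>m. C m \<in> A" "\<And>m. m \<notin> X \<Longrightarrow> C m = 0" "lc M X C (\<lambda>m. m) = z"
    and Y: "finite Y" "Y \<subseteq> carrier M" "\<And>m. m \<notin> Y \<Longrightarrow> C m = 0" "lc M Y C (\<lambda>m. m) = w"
    unfolding evaluates_def by metis
  have "lc M (X \<union> Y) C (\<lambda>m. m) = z" using lc_superset[of "X \<union> Y" X C] X Y by simp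
  moreover have "lc M (X \<union> Y) C (\<lambda>m. m) = w" using lc_superset[of "X \<union> Y" Y C] X Y by simp
  ultimately show ?thesis by simp
qed

lemma evaluates_closed: "evaluates C z \<Longrightarrow> z \<in> carrier M"
  unfolding evaluates_def by (auto intro!: lc_closed)

lemma evaluates_mem: "evaluates C z \<Longrightarrow> C m \<in> A"
  unfolding evaluates_def by auto

lemma evaluates_zero: "evaluates (\<lambda>m. 0) \<zero>\<^bsub>M\<^esub>"
  unfolding evaluates_def by (auto intro: exI[of _ "{}"])

lemma evaluates_delta: "b \<in> A \<Longrightarrow> x \<in> carrier M \<Longrightarrow> evaluates (\<lambda>m. if m = x then b else 0) (b \<odot>\<^bsub>M\<^esub> x)"
  unfolding evaluates_def using lc_delta[of "{x}" x "\<lambda>m. m" b] by (intro exI[of _ "{x}"]) auto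

lemma evaluates_add:
  assumes "evaluates C z" "evaluates D w"
  shows "evaluates (\<lambda>m. C m + D m) (z \<oplus>\<^bsub>M\<^esub> w)"
proof -
  obtain X where X: "finite X" "X \<subseteq> carrier M" "\<And>m. C m \<in> A" "\<And>m. m \<notin> X \<Longrightarrow> C m = 0" "lc M X C (\<lambda>m. m) = z"
    using assms(1) unfolding evaluates_def by metis
  obtain Y where Y: "finite Y" "Y \<subseteq> carrier M" "\<And>m. D m \<in> A" "\<And>m. m \<notin> Y \<Longrightarrow> D m = 0" "lc M Y D (\<lambda>m. m) = w"
    using assms(2) unfolding evaluates_def by metis
  have "lc M (X \<union> Y) (\<lambda>m. C m + D m) (\<lambda>m. m) = lc M (X \<union> Y) C (\<lambda>m. m) \<oplus>\<^bsub>M\<^esub> lc M (X \<union> Y) D (\<lambda>m. m)"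
    using X Y by (intro lc_add) auto
  also have "\<dots> = z \<oplus>\<^bsub>M\<^esub> w"
    using lc_superset[of "X \<union> Y" X C] lc_superset[of "X \<union> Y" Y D] X Y by simp
  finally show ?thesis unfolding evaluates_def using X Y by (intro exI[of _ "X \<union> Y"]) (auto simp: closed)
qed

lemma evaluates_smult:
  assumes "evaluates C z" "b \<in> A"
  shows "evaluates (\<lambda>m. b o\<^sub>L C m) (b \<odot>\<^bsub>M\<^esub> z)"
proof -
  obtain X where X: "finite X" "X \<subseteq> carrier M" "\<And>m. C m \<in> A" "\<And>m. m \<notin> X \<Longrightarrow> C m = 0" "lc M X C (\<lambda>m. m) = z"
    using assms(1) unfolding evaluates_def by metis
  have "lc M X (\<lambda>m. b o\<^sub>L C m) (\<lambda>m. m) = b \<odot>\<^bsub>M\<^esub> z"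
    using X assms by (subst lc_smult) auto
  then show ?thesis unfolding evaluates_def using X assms by (intro exI[of _ X]) (auto simp: closed)
qed

lemma evaluates_lc:
  assumes "finite K" "\<And>k. k \<in> K \<Longrightarrow> evaluates (C k) (z k)" "\<And>k. k \<in> K \<Longrightarrow> b k \<in> A"
  shows "evaluates (\<lambda>m. \<Sum>k\<in>K. b k o\<^sub>L C k m) (lc M K b z)"
  using assms
proof (induction K rule: finite_induct)
  case (insert k K)
  then have "evaluates (\<lambda>m. (b k o\<^sub>L C k m) + (\<Sum>k\<in>K. b k o\<^sub>L C k m)) (b k \<odot>\<^bsub>M\<^esub> z k \<oplus>\<^bsub>M\<^esub> lc M K b z)"
    by (intro evaluates_add evaluates_smult) auto
  moreover have "lc M (insert k K) b z = b k \<odot>\<^bsub>M\<^esub> z k \<oplus>\<^bsub>M\<^esub> lc M K b z"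
    using insert evaluates_closed by (intro lc_insert) blast+
  ultimately show ?case using insert by simp
qed (simp add: evaluates_zero)

lemma evaluates_diff:
  assumes "evaluates C z" "evaluates D w"
  shows "evaluates (\<lambda>m. C m - D m) (z \<ominus>\<^bsub>M\<^esub> w)"
proof -
  have w: "w \<in> carrier M" using assms evaluates_closed by blast
  show ?thesis
    using smult_minus_one[OF w] evaluates_add[OF assms(1) evaluates_smult[OF assms(2), of "- id_blinfun"]]
    by (simp add: closed compose_minus_left a_minus_def)
qed

end

section \<open>Flatness\<close>

lemma (in abelian_group) minus_eq_zeroD:
  assumes "x \<in> carrier G" "y \<in> carrier G" "x \<ominus> y = \<zero>"
  shows "x = y"
proof -
  have "x = (x \<ominus> y) \<oplus> y" using assms(1,2) by (simp add: a_minus_def a_assoc l_neg)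
  then show ?thesis using assms by simp
qed

text \<open>Sends the generator \<open>(a, x)\<close> to \<open>a\<close> in position
  \<open>x\<close>: the formal sum is pushed to the free \<open>A\<close>-module on the set of
  elements of \<open>M\<close>, where additivity in the scalar already holds.\<close>

definition coef :: "(('h oper \<times> 'm) \<Rightarrow>\<^sub>0 int) \<Rightarrow> 'm \<Rightarrow> 'h::complex_hilbert oper" where
  "coef u m = (\<Sum>k\<in>Poly_Mapping.keys u. if snd k = m then real_of_int (Poly_Mapping.lookup u k) *\<^sub>R fst k else 0)"

lemma coef_superset:
  assumes "finite K" "Poly_Mapping.keys u \<subseteq> K"
  shows "coef u m = (\<Sum>k\<in>K. if snd k = m then real_of_int (Poly_Mapping.lookup u k) *\<^sub>R fst k else 0)"
  unfolding coef_def using assms by (intro sum.mono_neutral_left) (auto simp: in_keys_iff)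

lemma coef_diff: "coef (u - v) m = coef u m - coef v m"
proof -
  let ?K = "Poly_Mapping.keys u \<union> Poly_Mapping.keys v"
  have "Poly_Mapping.keys (u - v) \<subseteq> ?K" by (rule keys_diff)
  then show ?thesis
    by (subst (1 2 3) coef_superset[of ?K]) (auto simp: lookup_minus scaleR_left_diff_distrib sum_subtractf[symmetric] intro!: sum.cong)
qed

lemma coef_zero [simp]: "coef 0 m = 0"
  by (simp add: coef_def)

lemma coef_add: "coef (u + v) m = coef u m + coef v m"
  using coef_diff[of "u + v" v m] by (simp add: algebra_simps)

lemma coef_sum: "coef (sum f I) m = (\<Sum>i\<in>I. coef (f i) m)"
  by (induction I rule: infinite_finite_induct) (simp_all add: coef_add)

lemma coef_frag_of [simp]: "coef (frag_of (a, x)) m = (if m = x then a else 0)"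
  by (simp add: coef_def keys_frag_of)

section \<open>Tensors over an inclusion of von Neumann algebras\<close>

locale vn_inclusion = A: vn_algebra A + B: vn_algebra B
  for A B :: "'h::complex_hilbert oper set" +
  assumes subset: "B \<subseteq> A"

sublocale vn_inclusion \<subseteq> ring_inclusion "op_ring A" "op_ring B"
  using A.ring_op_ring subset by (simp add: ring_inclusion_def ring_inclusion_axioms_def)

context vn_inclusion
begin

abbreviation ind :: "('h oper, 'm) module \<Rightarrow> ('h oper, (('h oper \<times> 'm) \<Rightarrow>\<^sub>0 int) set) module" where
  "ind M \<equiv> induced_module (op_ring A) (op_ring B) M"

definition unit_map :: "('h oper, 'm) module \<Rightarrow> 'm \<Rightarrow> (('h oper \<times> 'm) \<Rightarrow>\<^sub>0 int) set" where
  "unit_map M x = tcl (op_ring A) (op_ring B) M (frag_of (id_blinfun, x))"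

context
  fixes M :: "('h oper, 'm) module"
  assumes M: "left_module (op_ring B) M"
begin

lemma op_module_B: "op_module B M"
  using M B.vn_algebra_axioms by (simp add: op_module_def)

lemma op_module_ind: "op_module A (ind M)"
  using left_module_induced[OF M] A.vn_algebra_axioms by (simp add: op_module_def)

interpretation M: op_module B M by (rule op_module_B)
interpretation N: op_module A "ind M" by (rule op_module_ind)

lemma unit_map_closed: "x \<in> carrier M \<Longrightarrow> unit_map M x \<in> carrier (ind M)"
  unfolding unit_map_def carrier_induced[OF M] by (intro imageI) (simp add: keys_frag_of)

lemma smult_unit_map: "a \<in> A \<Longrightarrow> a \<odot>\<^bsub>ind M\<^esub> unit_map M x = tcl (op_ring A) (op_ring B) M (frag_of (a, x))"
  by (simp add: unit_map_def smult_induced[OF M])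

lemma unit_map_add:
  "x \<in> carrier M \<Longrightarrow> y \<in> carrier M \<Longrightarrow> unit_map M (x \<oplus>\<^bsub>M\<^esub> y) = unit_map M x \<oplus>\<^bsub>ind M\<^esub> unit_map M y"
  unfolding unit_map_def add_induced[OF M] tcl_eq_iff[OF M]
  using tensor_rel_right[OF M, of id_blinfun x y] by (simp add: diff_diff_eq)

lemma unit_map_smult:
  assumes "b \<in> B" "x \<in> carrier M"
  shows "unit_map M (b \<odot>\<^bsub>M\<^esub> x) = b \<odot>\<^bsub>ind M\<^esub> unit_map M x"
proof -
  have "b \<in> A" using assms subset by blast
  then show ?thesis
    unfolding smult_unit_map[OF \<open>b \<in> A\<close>] unfolding unit_map_def tcl_eq_iff[OF M]
    using tensor_rel_minus[OF M tensor_rel_balanced[OF M, of id_blinfun b x]] assms by simp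
qed

lemma unit_map_zero: "unit_map M \<zero>\<^bsub>M\<^esub> = \<zero>\<^bsub>ind M\<^esub>"
  using unit_map_smult[of 0 "\<zero>\<^bsub>M\<^esub>"] unit_map_closed[of "\<zero>\<^bsub>M\<^esub>"]
  by (simp add: M.smult_zero_left N.smult_zero_left)

lemma unit_map_lc:
  assumes "finite I" "\<And>i. i \<in> I \<Longrightarrow> d i \<in> B" "\<And>i. i \<in> I \<Longrightarrow> g i \<in> carrier M"
  shows "unit_map M (lc M I d g) = lc (ind M) I d (\<lambda>i. unit_map M (g i))"
  using assms
proof (induction I rule: finite_induct)
  case (insert k I)
  then have "unit_map M (d k \<odot>\<^bsub>M\<^esub> g k \<oplus>\<^bsub>M\<^esub> lc M I d g)
      = d k \<odot>\<^bsub>ind M\<^esub> unit_map M (g k) \<oplus>\<^bsub>ind M\<^esub> lc (ind M) I d (\<lambda>i. unit_map M (g i))"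
    by (simp add: unit_map_add unit_map_smult M.smult_mem M.lc_closed)
  moreover have "lc M (insert k I) d g = d k \<odot>\<^bsub>M\<^esub> g k \<oplus>\<^bsub>M\<^esub> lc M I d g"
    using insert by (intro M.lc_insert) auto
  moreover have "lc (ind M) (insert k I) d (\<lambda>i. unit_map M (g i))
      = d k \<odot>\<^bsub>ind M\<^esub> unit_map M (g k) \<oplus>\<^bsub>ind M\<^esub> lc (ind M) I d (\<lambda>i. unit_map M (g i))"
    using insert subset by (intro N.lc_insert) (auto intro: unit_map_closed)
  ultimately show ?case by simp
qed (simp add: unit_map_zero)

lemma lc_unit_map:
  assumes "finite I" "\<And>i. i \<in> I \<Longrightarrow> y i \<in> A" "\<And>i. i \<in> I \<Longrightarrow> g i \<in> carrier M"
  shows "lc (ind M) I y (\<lambda>i. unit_map M (g i)) = tcl (op_ring A) (op_ring B) M (\<Sum>i\<in>I. frag_of (y i, g i))"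
  using assms
proof (induction I rule: finite_induct)
  case (insert k I)
  then show ?case
    by (simp add: N.lc_insert unit_map_closed smult_unit_map add_induced[OF M])
qed (simp add: zero_induced[OF M])

text \<open>Integer coefficients are absorbed into the scalars, a negative one by
  \<open>(- a, x)\<close> in place of minus \<open>(a, x)\<close>. Lists are used because generators
  may repeat.\<close>

lemma ind_element:
  assumes X: "X \<in> carrier (ind M)"
  shows "\<exists>(n::nat) y g. (\<forall>i<n. y i \<in> A \<and> g i \<in> carrier M) \<and> X = lc (ind M) {..<n} y (\<lambda>i. unit_map M (g i))"
proof -
  obtain u where u: "Poly_Mapping.keys u \<subseteq> A \<times> carrier M" "X = tcl (op_ring A) (op_ring B) M u"
    using X unfolding carrier_induced[OF M] by auto
  let ?P = "\<lambda>u. \<exists>ps. set ps \<subseteq> A \<times> carrier M \<and> u - sum_list (map frag_of ps) \<in> tensor_rel (op_ring A) (op_ring B) M"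
  have neg: "\<exists>qs. set qs \<subseteq> A \<times> carrier M \<and>
      sum_list (map frag_of ps) + sum_list (map frag_of qs) \<in> tensor_rel (op_ring A) (op_ring B) M"
    if "set ps \<subseteq> A \<times> carrier M" for ps
    using that
  proof (induction ps)
    case Nil
    then show ?case by (intro exI[of _ "[]"]) (simp add: tensor_rel_zero[OF M])
  next
    case (Cons p ps)
    then obtain qs a x where qs: "set qs \<subseteq> A \<times> carrier M" "p = (a, x)" "a \<in> A" "x \<in> carrier M"
      "sum_list (map frag_of ps) + sum_list (map frag_of qs) \<in> tensor_rel (op_ring A) (op_ring B) M" by auto
    \<comment> \<open>Since \<open>0 + 0 = 0\<close>, additivity in the scalar makes
      \<open>(0, x)\<close> a relation up to sign; with it, \<open>(a, x)\<close> and
      \<open>(- a, x)\<close> cancel.\<close>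
    have 0: "- frag_of (0, x) \<in> tensor_rel (op_ring A) (op_ring B) M"
      using tensor_rel_left[OF M, of 0 0 x] qs by simp
    have "frag_of (0, x) - frag_of (a, x) - frag_of (- a, x) \<in> tensor_rel (op_ring A) (op_ring B) M"
      using tensor_rel_left[OF M, of a "- a" x] qs by (simp add: A.closed)
    from tensor_rel_add[OF M this 0]
    have "- (frag_of (a, x) + frag_of (- a, x)) \<in> tensor_rel (op_ring A) (op_ring B) M" by simp
    from tensor_rel_diff[OF M qs(5) this]
    have "sum_list (map frag_of (p # ps)) + sum_list (map frag_of ((- a, x) # qs)) \<in> tensor_rel (op_ring A) (op_ring B) M"
      by (rule back_subst[of "\<lambda>v. v \<in> _"]) (simp add: qs(2))
    then show ?case using qs by (intro exI[of _ "(- a, x) # qs"]) (simp add: A.closed)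
  qed
  have "?P u"
    using u(1)
  proof (induction u rule: frag_induction)
    case zero then show ?case by (intro exI[of _ "[]"]) (simp add: tensor_rel_zero[OF M])
  next
    case (one p) then show ?case by (intro exI[of _ "[p]"]) (simp add: tensor_rel_zero[OF M])
  next
    case (diff u v)
    then obtain ps qs where ps: "set ps \<subseteq> A \<times> carrier M" "u - sum_list (map frag_of ps) \<in> tensor_rel (op_ring A) (op_ring B) M"
      and qs: "set qs \<subseteq> A \<times> carrier M" "v - sum_list (map frag_of qs) \<in> tensor_rel (op_ring A) (op_ring B) M" by blast
    obtain rs where rs: "set rs \<subseteq> A \<times> carrier M"
      "sum_list (map frag_of qs) + sum_list (map frag_of rs) \<in> tensor_rel (op_ring A) (op_ring B) M"
      using neg[OF qs(1)] by blast
    have "u - v - sum_list (map frag_of (ps @ rs)) =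
      (u - sum_list (map frag_of ps)) - (v - sum_list (map frag_of qs)) - (sum_list (map frag_of qs) + sum_list (map frag_of rs))"
      by simp
    also have "\<dots> \<in> tensor_rel (op_ring A) (op_ring B) M"
      by (intro tensor_rel_diff[OF M] ps qs rs)
    finally show ?case using ps(1) rs(1) by (intro exI[of _ "ps @ rs"]) simp
  qed
  then obtain ps where ps: "set ps \<subseteq> A \<times> carrier M" "u - sum_list (map frag_of ps) \<in> tensor_rel (op_ring A) (op_ring B) M" by blast
  have "sum_list (map frag_of ps) = (\<Sum>i<length ps. frag_of (fst (ps ! i), snd (ps ! i)))"
    by (simp add: sum_list_sum_nth atLeast0LessThan)
  moreover have mem: "fst (ps ! i) \<in> A \<and> snd (ps ! i) \<in> carrier M" if "i < length ps" for i
    using ps(1) nth_mem[OF that] by (metis mem_Times_iff subsetD)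
  ultimately have "X = lc (ind M) {..<length ps} (\<lambda>i. fst (ps ! i)) (\<lambda>i. unit_map M (snd (ps ! i)))"
    using ps(2) mem by (subst lc_unit_map) (simp_all add: u(2) tcl_eq_iff[OF M])
  then show ?thesis using mem
    by (intro exI[of _ "length ps"] exI[of _ "\<lambda>i. fst (ps ! i)"] exI[of _ "\<lambda>i. snd (ps ! i)"]) auto
qed

text \<open>In the free \<open>A\<close>-module on \<open>M\<close>, additivity in the scalar
  becomes trivial, and the other two kinds of relations become \<open>a C\<close> with
  \<open>C\<close> a formal combination over \<open>B\<close> of value zero.\<close>

lemma coef_tensor_rel:
  assumes "u \<in> tensor_rel (op_ring A) (op_ring B) M"
  shows "\<exists>ps. (\<forall>(a, C)\<in>set ps. a \<in> A \<and> M.evaluates C \<zero>\<^bsub>M\<^esub>) \<and>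
    (\<forall>m. coef u m = sum_list (map (\<lambda>(a, C). a o\<^sub>L C m) ps))"
  using assms
proof (induction rule: tensor_rel_induct[OF M, consumes 1, case_names zero diff add_left add_right balanced])
  case zero
  show ?case by (intro exI[of _ "[]"]) simp
next
  case (diff u v)
  then obtain ps qs where ps: "\<forall>(a, C)\<in>set ps. a \<in> A \<and> M.evaluates C \<zero>\<^bsub>M\<^esub>"
      "\<forall>m. coef u m = sum_list (map (\<lambda>(a, C). a o\<^sub>L C m) ps)"
    and qs: "\<forall>(a, C)\<in>set qs. a \<in> A \<and> M.evaluates C \<zero>\<^bsub>M\<^esub>"
      "\<forall>m. coef v m = sum_list (map (\<lambda>(a, C). a o\<^sub>L C m) qs)" by blast
  have "sum_list (map (\<lambda>(a, C). a o\<^sub>L C m) (map (\<lambda>(a, C). (- a, C)) qs)) = - sum_list (map (\<lambda>(a, C). a o\<^sub>L C m) qs)" for m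
    by (induction qs) (auto simp: compose_minus_left)
  then show ?case
    using ps qs by (intro exI[of _ "ps @ map (\<lambda>(a, C). (- a, C)) qs"]) (auto simp: coef_diff A.closed)
next
  case (add_left a b x)
  show ?case by (intro exI[of _ "[]"]) (simp add: coef_diff)
next
  case (add_right a x y)
  let ?C = "\<lambda>m. (if m = x \<oplus>\<^bsub>M\<^esub> y then id_blinfun else 0) - (if m = x then id_blinfun else 0) - (if m = y then id_blinfun else 0)"
  have "M.evaluates ?C (id_blinfun \<odot>\<^bsub>M\<^esub> (x \<oplus>\<^bsub>M\<^esub> y) \<ominus>\<^bsub>M\<^esub> id_blinfun \<odot>\<^bsub>M\<^esub> x \<ominus>\<^bsub>M\<^esub> id_blinfun \<odot>\<^bsub>M\<^esub> y)"
    using add_right by (intro M.evaluates_diff M.evaluates_delta) auto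
  moreover have "id_blinfun \<odot>\<^bsub>M\<^esub> (x \<oplus>\<^bsub>M\<^esub> y) \<ominus>\<^bsub>M\<^esub> id_blinfun \<odot>\<^bsub>M\<^esub> x \<ominus>\<^bsub>M\<^esub> id_blinfun \<odot>\<^bsub>M\<^esub> y = \<zero>\<^bsub>M\<^esub>"
  proof -
    have "x \<oplus>\<^bsub>M\<^esub> y \<ominus>\<^bsub>M\<^esub> x \<ominus>\<^bsub>M\<^esub> y = (x \<oplus>\<^bsub>M\<^esub> y) \<oplus>\<^bsub>M\<^esub> (\<ominus>\<^bsub>M\<^esub> x \<oplus>\<^bsub>M\<^esub> \<ominus>\<^bsub>M\<^esub> y)"
      using add_right by (simp add: a_minus_def M.M.a_assoc)
    also have "\<ominus>\<^bsub>M\<^esub> x \<oplus>\<^bsub>M\<^esub> \<ominus>\<^bsub>M\<^esub> y = \<ominus>\<^bsub>M\<^esub> (x \<oplus>\<^bsub>M\<^esub> y)" using add_right by (simp add: M.M.minus_add)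
    also have "(x \<oplus>\<^bsub>M\<^esub> y) \<oplus>\<^bsub>M\<^esub> \<dots> = \<zero>\<^bsub>M\<^esub>" using add_right by (simp add: M.M.r_neg)
    finally show ?thesis
      using add_right M.M.smult_one[of x] M.M.smult_one[of y] M.M.smult_one[of "x \<oplus>\<^bsub>M\<^esub> y"] by simp
  qed
  ultimately show ?case
    using add_right by (intro exI[of _ "[(a, ?C)]"]) (auto simp: coef_diff compose_diff_right)
next
  case (balanced a s x)
  let ?C = "\<lambda>m. (if m = x then s else 0) - (if m = s \<odot>\<^bsub>M\<^esub> x then id_blinfun else 0)"
  have "M.evaluates ?C (s \<odot>\<^bsub>M\<^esub> x \<ominus>\<^bsub>M\<^esub> id_blinfun \<odot>\<^bsub>M\<^esub> (s \<odot>\<^bsub>M\<^esub> x))"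
    using balanced by (intro M.evaluates_diff M.evaluates_delta) (auto intro: M.smult_mem)
  moreover have "s \<odot>\<^bsub>M\<^esub> x \<ominus>\<^bsub>M\<^esub> id_blinfun \<odot>\<^bsub>M\<^esub> (s \<odot>\<^bsub>M\<^esub> x) = \<zero>\<^bsub>M\<^esub>"
    using balanced M.M.smult_one[of "s \<odot>\<^bsub>M\<^esub> x"] M.smult_mem[of s x] by (simp add: a_minus_def M.M.r_neg)
  ultimately show ?case
    using balanced by (intro exI[of _ "[(a, ?C)]"]) (auto simp: coef_diff compose_diff_right)
qed

text \<open>The equational criterion of flatness. Membership of the vanishing tensor in the relations
  expresses \<open>y\<close>, extended by zero on an infinite set of redundant generators \<open>m\<close>, as a combination
  \<open>\<alpha> C\<close> of relations over \<open>B\<close>; the annihilator projection \<open>F\<close> of the redundant columns fixes \<open>\<alpha>\<close>, and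
  \<open>F C\<close> consists of relations among the \<open>g i\<close> alone.\<close>

theorem equational_criterion:
  fixes y :: "'i \<Rightarrow> 'h oper"
  assumes I: "finite I" and y: "\<And>i. i \<in> I \<Longrightarrow> y i \<in> A" and g: "\<And>i. i \<in> I \<Longrightarrow> g i \<in> carrier M"
    and zero: "lc (ind M) I y (\<lambda>i. unit_map M (g i)) = \<zero>\<^bsub>ind M\<^esub>"
  shows "\<exists>(K :: (nat + 'i) set) \<alpha> d. finite K \<and> (\<forall>k\<in>K. \<alpha> k \<in> A) \<and> (\<forall>k\<in>K. \<forall>i\<in>I. d k i \<in> B) \<and>
    (\<forall>k\<in>K. lc M I (d k) g = \<zero>\<^bsub>M\<^esub>) \<and> (\<forall>i\<in>I. y i = (\<Sum>k\<in>K. \<alpha> k o\<^sub>L d k i))"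
proof -
  define u where "u = (\<Sum>i\<in>I. frag_of (y i, g i))"
  have "u \<in> tensor_rel (op_ring A) (op_ring B) M"
    using zero lc_unit_map[OF I y g] unfolding u_def by (simp add: zero_induced[OF M] tcl_eq_iff[OF M])
  from coef_tensor_rel[OF this] obtain ps where
    ps: "\<forall>(a, C)\<in>set ps. a \<in> A \<and> M.evaluates C \<zero>\<^bsub>M\<^esub>"
    "\<forall>m. coef u m = sum_list (map (\<lambda>(a, C). a o\<^sub>L C m) ps)" by blast
  define n where "n = length ps"
  \<comment> \<open>One row for each of the \<open>n\<close> relations and one for each generator
    \<open>g i\<close>. The signs in \<open>\<alpha>\<close> turn the expression of \<open>y\<close>
    by relations into the single equation \<open>\<alpha> C = 0\<close>.\<close>
  define K where "K = {..<n} <+> I"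
  define \<alpha> where "\<alpha> k = (case k of Inl j \<Rightarrow> - fst (ps ! j) | Inr i \<Rightarrow> y i)" for k
  \<comment> \<open>\<open>c k\<close> and \<open>C k\<close> describe the same element of
    \<open>M\<close>: \<open>c k\<close> as a combination of the \<open>g i\<close>,
    \<open>C k\<close> as a formal combination of elements of \<open>M\<close>.\<close>
  define c where "c k i = (case k of Inl j \<Rightarrow> 0 | Inr i' \<Rightarrow> if i = i' then (id_blinfun :: 'h oper) else 0)" for k :: "nat + 'i" and i
  define C where "C k m = (case k of Inl j \<Rightarrow> snd (ps ! j) m | Inr i \<Rightarrow> if m = g i then id_blinfun else 0)" for k m
  have K: "finite K" using I by (simp add: K_def)
  have psj: "fst (ps ! j) \<in> A" "M.evaluates (snd (ps ! j)) \<zero>\<^bsub>M\<^esub>" if "j < n" for j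
    using ps(1) nth_mem[of j ps] that by (auto simp: n_def split_beta)
  have \<alpha>: "\<alpha> k \<in> A" if "k \<in> K" for k
    using that psj y by (auto simp: K_def \<alpha>_def A.closed)
  have cB: "c k i \<in> B" for k i
    by (auto simp: c_def split: sum.split)
  have ev: "M.evaluates (C k) (lc M I (c k) g)" if k: "k \<in> K" for k
    using k unfolding K_def
  proof (rule PlusE)
    fix j assume j: "j \<in> {..<n}" "k = Inl j"
    then have "lc M I (c k) g = \<zero>\<^bsub>M\<^esub>" unfolding c_def using M.lc_zero[OF I g] by simp
    moreover have "C k = snd (ps ! j)" using j by (simp add: C_def fun_eq_iff)
    ultimately show ?thesis using psj(2)[of j] j by simp
  next
    fix i assume i: "i \<in> I" "k = Inr i"
    then have "lc M I (c k) g = id_blinfun \<odot>\<^bsub>M\<^esub> g i"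
      unfolding c_def using M.lc_delta[OF I i(1) g, where a = id_blinfun] by simp
    moreover have "C k = (\<lambda>m. if m = g i then id_blinfun else 0)" using i by (simp add: C_def fun_eq_iff)
    ultimately show ?thesis using M.evaluates_delta[of id_blinfun "g i"] g[OF i(1)] by simp
  qed
  have CB: "C k m \<in> B" if "k \<in> K" for k m using M.evaluates_mem[OF ev[OF that]] .
  have \<alpha>C: "(\<Sum>k\<in>K. \<alpha> k o\<^sub>L C k m) = 0" for m
  proof -
    have "coef u m = (\<Sum>j<n. fst (ps ! j) o\<^sub>L snd (ps ! j) m)"
      by (simp add: ps(2) sum_list_sum_nth atLeast0LessThan n_def split_beta)
    moreover have "coef u m = (\<Sum>i\<in>I. y i o\<^sub>L (if m = g i then id_blinfun else 0))"
      unfolding u_def coef_sum by (intro sum.cong) auto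
    ultimately show ?thesis
      by (simp add: K_def sum_Plus I \<alpha>_def C_def compose_minus_left sum_negf)
  qed
  obtain F where F: "is_ann B K (range (\<lambda>m k. C k m)) F"
    using ann_exists[OF B.vN K, of "range (\<lambda>m k. C k m)"] CB by auto
  have FB: "F k l \<in> B" if "k \<in> K" "l \<in> K" for k l using proj_onD(1)[OF is_annD(1)[OF F] that] .
  have \<alpha>F: "(\<Sum>k\<in>K. \<alpha> k o\<^sub>L F k l) = \<alpha> l" if "l \<in> K" for l
    using \<alpha>C that by (intro is_annD(3)[OF F]) (auto intro: A.bounded \<alpha>)
  define d where "d k i = (\<Sum>l\<in>K. F k l o\<^sub>L c l i)" for k i
  have d0: "lc M I (d k) g = \<zero>\<^bsub>M\<^esub>" if k: "k \<in> K" for k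
  proof -
    \<comment> \<open>Row \<open>k\<close> of \<open>F C\<close> is zero as a formal combination, so
      its value is zero; \<open>evaluates_unique\<close> carries this over to row \<open>k\<close>
      of \<open>F c\<close>, which is \<open>d k\<close>.\<close>
    have "M.evaluates (\<lambda>m. \<Sum>l\<in>K. F k l o\<^sub>L C l m) (lc M K (F k) (\<lambda>l. lc M I (c l) g))"
      using FB k by (intro M.evaluates_lc[OF K ev]) auto
    moreover have "(\<lambda>m. \<Sum>l\<in>K. F k l o\<^sub>L C l m) = (\<lambda>m. 0)"
      using is_annD(2)[OF F _ k] by (auto simp: fun_eq_iff)
    ultimately have "lc M K (F k) (\<lambda>l. lc M I (c l) g) = \<zero>\<^bsub>M\<^esub>"
      using M.evaluates_unique[OF _ M.evaluates_zero] by simp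
    moreover have "lc M I (d k) g = lc M K (F k) (\<lambda>l. lc M I (c l) g)"
      unfolding d_def using FB k cB g by (intro M.lc_compose[OF I K]) auto
    ultimately show ?thesis by simp
  qed
  have dy: "y i = (\<Sum>k\<in>K. \<alpha> k o\<^sub>L d k i)" if i: "i \<in> I" for i
  proof -
    have "(\<Sum>k\<in>K. \<alpha> k o\<^sub>L d k i) = (\<Sum>k\<in>K. \<Sum>l\<in>K. (\<alpha> k o\<^sub>L F k l) o\<^sub>L c l i)"
      by (simp add: d_def compose_sum_right compose_assoc)
    also have "\<dots> = (\<Sum>l\<in>K. (\<Sum>k\<in>K. \<alpha> k o\<^sub>L F k l) o\<^sub>L c l i)"
      unfolding compose_sum_left by (rule sum.swap)
    also have "\<dots> = (\<Sum>l\<in>K. \<alpha> l o\<^sub>L c l i)" by (simp add: \<alpha>F)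
    also have "\<dots> = (\<Sum>i'\<in>I. y i' o\<^sub>L (if i = i' then id_blinfun else 0))"
      by (simp add: K_def sum_Plus I \<alpha>_def c_def)
    also have "\<dots> = y i" using sum_compose_delta(1)[OF I i, of y id_blinfun] by (simp add: eq_commute)
    finally show ?thesis by simp
  qed
  have dB: "d k i \<in> B" if "k \<in> K" for k i
    unfolding d_def using FB that cB by (intro B.sum_mem B.compose_mem) auto
  show ?thesis
    by (intro exI[of _ K] exI[of _ \<alpha>] exI[of _ d] conjI ballI K \<alpha> d0 dy dB)
qed

text \<open>Converse of the criterion, by
  \<open>(\<alpha> d) g = \<alpha> (d g) = 0\<close>.\<close>

lemma lc_unit_map_zeroI:
  assumes "finite I" "finite K" "\<And>k. k \<in> K \<Longrightarrow> \<alpha> k \<in> A" "\<And>k i. k \<in> K \<Longrightarrow> i \<in> I \<Longrightarrow> d k i \<in> B"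
    "\<And>i. i \<in> I \<Longrightarrow> g i \<in> carrier M" "\<And>k. k \<in> K \<Longrightarrow> lc M I (d k) g = \<zero>\<^bsub>M\<^esub>"
    and y: "\<And>i. i \<in> I \<Longrightarrow> y i = (\<Sum>k\<in>K. \<alpha> k o\<^sub>L d k i)"
  shows "lc (ind M) I y (\<lambda>i. unit_map M (g i)) = \<zero>\<^bsub>ind M\<^esub>"
proof -
  have dA: "d k i \<in> A" if "k \<in> K" "i \<in> I" for k i using assms(4)[OF that] subset by blast
  have z: "lc (ind M) I (d k) (\<lambda>i. unit_map M (g i)) = \<zero>\<^bsub>ind M\<^esub>" if "k \<in> K" for k
    using unit_map_lc[of I "d k" g] assms that by (simp add: unit_map_zero)
  have "lc (ind M) I y (\<lambda>i. unit_map M (g i)) = lc (ind M) I (\<lambda>i. \<Sum>k\<in>K. \<alpha> k o\<^sub>L d k i) (\<lambda>i. unit_map M (g i))"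
    using assms dA by (intro N.lc_cong) (auto intro!: A.closed unit_map_closed)
  also have "\<dots> = lc (ind M) K \<alpha> (\<lambda>k. lc (ind M) I (d k) (\<lambda>i. unit_map M (g i)))"
    using assms dA by (intro N.lc_compose) (auto intro: unit_map_closed)
  also have "\<dots> = lc (ind M) K \<alpha> (\<lambda>k. \<zero>\<^bsub>ind M\<^esub>)"
    using assms(3) by (intro N.lc_cong) (simp_all add: z)
  also have "\<dots> = \<zero>\<^bsub>ind M\<^esub>"
    using assms(2,3)
  proof (induction K rule: finite_induct)
    case (insert k K)
    then show ?case by (simp add: N.lc_insert N.smult_zero_right)
  qed simp
  finally show ?thesis .
qed

text \<open>If \<open>1 \<otimes> x = 0\<close>, then \<open>1 = \<alpha> d\<close> for a row \<open>\<alpha>\<close> over \<open>A\<close> and a column \<open>d\<close> of annihilators of \<open>x\<close>.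
  Cutting \<open>\<alpha>\<close> down by the range projection of \<open>d\<close> makes it commute with \<open>B'\<close>, i.e. moves it into \<open>B\<close>.\<close>

theorem unit_map_faithful:
  assumes x: "x \<in> carrier M" and x0: "unit_map M x = \<zero>\<^bsub>ind M\<^esub>"
  shows "x = \<zero>\<^bsub>M\<^esub>"
proof -
  have one: "lc P {()} d (\<lambda>_. z) = d () \<odot>\<^bsub>P\<^esub> z" if P: "op_module R P" and d: "d () \<in> R" "z \<in> carrier P"
    for P :: "('h oper, 'z) module" and d R z
  proof -
    interpret P: op_module R P by (rule P)
    show ?thesis using P.lc_insert[of "{}" "()" d "\<lambda>_. z"] d P.smult_mem by simp
  qed
  have "lc (ind M) {()} (\<lambda>_. id_blinfun) (\<lambda>_. unit_map M x) = \<zero>\<^bsub>ind M\<^esub>"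
    using one[OF op_module_ind, of "\<lambda>_. id_blinfun" "unit_map M x"] x0 by (simp add: N.smult_zero_right)
  from equational_criterion[of "{()}" "\<lambda>_. id_blinfun" "\<lambda>_. x", OF _ _ _ this] x
  obtain K :: "(nat + unit) set" and \<alpha> d where K': "finite K" "\<forall>k\<in>K. \<alpha> k \<in> A" "\<forall>k\<in>K. d k () \<in> B"
    "\<forall>k\<in>K. lc M {()} (d k) (\<lambda>_. x) = \<zero>\<^bsub>M\<^esub>" "id_blinfun = (\<Sum>k\<in>K. \<alpha> k o\<^sub>L d k ())" by auto
  then have K: "finite K" "\<And>k. k \<in> K \<Longrightarrow> \<alpha> k \<in> A" "\<And>k. k \<in> K \<Longrightarrow> d k () \<in> B"
    "\<And>k. k \<in> K \<Longrightarrow> lc M {()} (d k) (\<lambda>_. x) = \<zero>\<^bsub>M\<^esub>" "id_blinfun = (\<Sum>k\<in>K. \<alpha> k o\<^sub>L d k ())" by blast+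
  have dx: "d k () \<odot>\<^bsub>M\<^esub> x = \<zero>\<^bsub>M\<^esub>" if "k \<in> K" for k
    using K(4)[OF that] one[OF op_module_B, of "d k" x] K(3)[OF that] x by simp
  obtain F where F: "is_ann B K {\<lambda>k. d k ()} F"
    using ann_exists[OF B.vN K(1), of "{\<lambda>k. d k ()}"] K(3) by auto
  have FB: "F k l \<in> B" if "k \<in> K" "l \<in> K" for k l using proj_onD(1)[OF is_annD(1)[OF F] that] .
  \<comment> \<open>The range projection of the column \<open>d\<close>. As \<open>F d = 0\<close>,
    replacing \<open>\<alpha>\<close> by \<open>b = \<alpha> P\<close> keeps
    \<open>b d = 1\<close>.\<close>
  define P where "P k l = (if k = l then id_blinfun else 0) - F k l" for k l
  have PB: "P k l \<in> B" if "k \<in> K" "l \<in> K" for k l using FB[OF that] by (simp add: P_def B.closed)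
  define b where "b l = (\<Sum>k\<in>K. \<alpha> k o\<^sub>L P k l)" for l
  have bP: "b l = \<alpha> l - (\<Sum>k\<in>K. \<alpha> k o\<^sub>L F k l)" if "l \<in> K" for l
    using that by (simp add: b_def P_def compose_diff_right sum_subtractf sum_compose_delta K(1))
  have bd: "(\<Sum>l\<in>K. b l o\<^sub>L d l ()) = id_blinfun"
  proof -
    have "(\<Sum>l\<in>K. b l o\<^sub>L d l ()) = (\<Sum>l\<in>K. \<alpha> l o\<^sub>L d l ()) - (\<Sum>l\<in>K. \<Sum>k\<in>K. \<alpha> k o\<^sub>L (F k l o\<^sub>L d l ()))"
      by (simp add: bP compose_diff_left sum_subtractf compose_sum_left compose_assoc)
    also have "(\<Sum>l\<in>K. \<Sum>k\<in>K. \<alpha> k o\<^sub>L (F k l o\<^sub>L d l ())) = (\<Sum>k\<in>K. \<alpha> k o\<^sub>L (\<Sum>l\<in>K. F k l o\<^sub>L d l ()))"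
      unfolding compose_sum_right by (rule sum.swap)
    also have "\<dots> = 0" using is_annD(2)[OF F] by simp
    finally show ?thesis using K(5) by simp
  qed
  have bA: "b l \<in> A" if "l \<in> K" for l
    unfolding b_def using that PB K(2) subset by (intro A.sum_mem A.compose_mem) auto
  have bB: "b l \<in> B" if l: "l \<in> K" for l
  proof -
    have "T o\<^sub>L b l = b l o\<^sub>L T" if T: "T \<in> commutant B" for T
    proof -
      have Tb: "T \<in> bounded_ops" and TS: "\<And>S. S \<in> B \<Longrightarrow> T o\<^sub>L S = S o\<^sub>L T" using T by (auto simp: commutant_def)
      \<comment> \<open>The commutator of \<open>T\<close> with \<open>b\<close> kills
        \<open>d\<close>, because \<open>b d = 1\<close> and \<open>T\<close> commutes with
        \<open>d\<close>; hence \<open>F\<close> fixes it. But \<open>b F = 0\<close>, so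
        \<open>F\<close> also sends it to zero.\<close>
      define y where "y k = (T o\<^sub>L b k) - (b k o\<^sub>L T)" for k
      have yb: "y k \<in> bounded_ops" if "k \<in> K" for k
        unfolding y_def using A.bounded[OF bA[OF that]] Tb by (intro bounded_ops_diff bounded_ops_compose)
      have "(\<Sum>k\<in>K. y k o\<^sub>L d k ()) = (T o\<^sub>L (\<Sum>k\<in>K. b k o\<^sub>L d k ())) - ((\<Sum>k\<in>K. b k o\<^sub>L d k ()) o\<^sub>L T)"
        using TS[OF K(3)]
        by (simp add: y_def compose_diff_left sum_subtractf compose_sum_right compose_sum_left compose_assoc)
      then have "(\<Sum>k\<in>K. y k o\<^sub>L d k ()) = 0" by (simp add: bd)
      then have yF: "(\<Sum>k\<in>K. y k o\<^sub>L F k l) = y l" using yb l by (intro is_annD(3)[OF F]) auto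
      have bF: "(\<Sum>k\<in>K. b k o\<^sub>L F k l) = 0" if "l \<in> K" for l
      proof -
        have "(\<Sum>k\<in>K. (\<Sum>j\<in>K. \<alpha> j o\<^sub>L F j k) o\<^sub>L F k l) = (\<Sum>k\<in>K. \<Sum>j\<in>K. \<alpha> j o\<^sub>L (F j k o\<^sub>L F k l))"
          by (simp add: compose_sum_left compose_assoc)
        also have "\<dots> = (\<Sum>j\<in>K. \<alpha> j o\<^sub>L (\<Sum>k\<in>K. F j k o\<^sub>L F k l))"
          unfolding compose_sum_right by (rule sum.swap)
        also have "\<dots> = (\<Sum>j\<in>K. \<alpha> j o\<^sub>L F j l)"
          using proj_onD(2)[OF is_annD(1)[OF F]] that by simp
        finally show ?thesis by (simp add: bP compose_diff_left sum_subtractf)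
      qed
      have "(\<Sum>k\<in>K. y k o\<^sub>L F k l) = (T o\<^sub>L (\<Sum>k\<in>K. b k o\<^sub>L F k l)) - ((\<Sum>k\<in>K. b k o\<^sub>L F k l) o\<^sub>L T)"
        using TS[OF FB] l
        by (simp add: y_def compose_diff_left sum_subtractf compose_sum_right compose_sum_left compose_assoc)
      then have "y l = 0" using yF bF[OF l] by simp
      then show ?thesis by (simp add: y_def)
    qed
    then have "b l \<in> commutant (commutant B)"
      using A.bounded[OF bA[OF l]] by (auto simp: commutant_def[of "commutant B"])
    then show ?thesis using B.vN by (simp add: von_neumann_algebra_def)
  qed
  have "x = lc M {()} (\<lambda>_. id_blinfun) (\<lambda>_. x)"
    using one[OF op_module_B, of "\<lambda>_. id_blinfun" x] M.M.smult_one[OF x] x by simp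
  also have "\<dots> = lc M {()} (\<lambda>i. \<Sum>k\<in>K. b k o\<^sub>L d k ()) (\<lambda>_. x)" by (simp only: bd)
  also have "\<dots> = lc M K b (\<lambda>k. lc M {()} (\<lambda>i. d k ()) (\<lambda>_. x))"
    using K bB x by (intro M.lc_compose) auto
  also have "\<dots> = lc M K b (\<lambda>k. \<zero>\<^bsub>M\<^esub>)"
    using bB dx one[OF op_module_B, of "\<lambda>_. d k ()" x for k] K(3) x by (intro M.lc_cong) auto
  also have "\<dots> = \<zero>\<^bsub>M\<^esub>"
    using K(1) bB
  proof (induction K rule: finite_induct)
    case (insert k K)
    then show ?case by (simp add: M.lc_insert M.smult_zero_right)
  qed simp
  finally show ?thesis .
qed

end

lemma induced_map_unit_map:
  assumes "left_module (op_ring B) M" "left_module (op_ring B) N" "f \<in> lmod_hom (op_ring B) M N"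
  shows "induced_map (op_ring A) (op_ring B) N f (unit_map M x) = unit_map N (f x)"
  by (simp add: unit_map_def induced_map_tcl[OF assms])

text \<open>The criterion turns a vanishing image into relations over \<open>B\<close> among the
  \<open>f (g i)\<close>. Injectivity of \<open>f\<close> makes them relations among the
  \<open>g i\<close>, and the converse of the criterion concludes.\<close>

theorem induced_map_inj:
  assumes L: "left_module (op_ring B) L" and M: "left_module (op_ring B) M"
    and f: "f \<in> lmod_hom (op_ring B) L M" and inj: "inj_on f (carrier L)"
  shows "inj_on (induced_map (op_ring A) (op_ring B) M f) (carrier (ind L))"
proof (rule inj_onI)
  let ?f = "induced_map (op_ring A) (op_ring B) M f"
  interpret L: op_module B L using op_module_B[OF L] .
  interpret IL: op_module A "ind L" using op_module_ind[OF L] .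
  interpret IM: op_module A "ind M" using op_module_ind[OF M] .
  have hom: "?f \<in> lmod_hom (op_ring A) (ind L) (ind M)" by (rule induced_map_hom[OF L M f])
  have ker: "X = \<zero>\<^bsub>ind L\<^esub>" if X: "X \<in> carrier (ind L)" "?f X = \<zero>\<^bsub>ind M\<^esub>" for X
  proof -
    obtain n :: nat and y g where y: "\<And>i. i < n \<Longrightarrow> y i \<in> A" and g: "\<And>i. i < n \<Longrightarrow> g i \<in> carrier L"
      and Xe: "X = lc (ind L) {..<n} y (\<lambda>i. unit_map L (g i))"
      using ind_element[OF L X(1)] by blast
    have "?f X = lc (ind M) {..<n} y (\<lambda>i. ?f (unit_map L (g i)))"
      unfolding Xe using y g by (intro IL.lc_hom[OF op_module_ind[OF M] hom]) (auto intro: unit_map_closed[OF L])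
    then have "lc (ind M) {..<n} y (\<lambda>i. unit_map M (f (g i))) = \<zero>\<^bsub>ind M\<^esub>"
      using X(2) by (simp add: induced_map_unit_map[OF L M f])
    from equational_criterion[OF M _ _ _ this] y g lmod_homD(1)[OF f]
    obtain K :: "(nat + nat) set" and \<alpha> d where K: "finite K" "\<forall>k\<in>K. \<alpha> k \<in> A" "\<forall>k\<in>K. \<forall>i\<in>{..<n}. d k i \<in> B"
      "\<forall>k\<in>K. lc M {..<n} (d k) (\<lambda>i. f (g i)) = \<zero>\<^bsub>M\<^esub>" "\<forall>i\<in>{..<n}. y i = (\<Sum>k\<in>K. \<alpha> k o\<^sub>L d k i)" by auto
    have "lc L {..<n} (d k) g = \<zero>\<^bsub>L\<^esub>" if k: "k \<in> K" for k
    proof (rule inj_onD[OF inj])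
      have "f (lc L {..<n} (d k) g) = lc M {..<n} (d k) (\<lambda>i. f (g i))"
        using K(3) k g by (intro L.lc_hom[OF op_module_B[OF M] f]) auto
      then show "f (lc L {..<n} (d k) g) = f \<zero>\<^bsub>L\<^esub>"
        using K(4) k lmod_hom_zero[OF left_module_abelian_group[OF L] left_module_abelian_group[OF M] f] by simp
      show "lc L {..<n} (d k) g \<in> carrier L" using K(3) k g by (intro L.lc_closed) auto
    qed simp
    then show ?thesis
      unfolding Xe using K g by (intro lc_unit_map_zeroI[OF L, of _ K \<alpha> d]) auto
  qed
  fix X Y assume XY: "X \<in> carrier (ind L)" "Y \<in> carrier (ind L)" "?f X = ?f Y"
  have "?f (X \<ominus>\<^bsub>ind L\<^esub> Y) = \<zero>\<^bsub>ind M\<^esub>"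
    using XY lmod_homD(1,2)[OF hom]
      lmod_hom_minus[OF left_module_abelian_group[OF left_module_induced[OF L]]
        left_module_abelian_group[OF left_module_induced[OF M]] hom XY(2)]
    by (simp add: a_minus_def IM.M.r_neg)
  then have "X \<ominus>\<^bsub>ind L\<^esub> Y = \<zero>\<^bsub>ind L\<^esub>" using ker XY by simp
  then show "X = Y" using XY IL.M.minus_eq_zeroD by blast
qed

text \<open>Evaluating at \<open>1 \<otimes> x\<close> shows that the tensor of 1 with the
  difference of \<open>f x\<close> and \<open>g x\<close> vanishes, which
  \<open>unit_map_faithful\<close> detects.\<close>

theorem induced_map_faithful:
  assumes M: "left_module (op_ring B) M" and N: "left_module (op_ring B) N"
    and f: "f \<in> lmod_hom (op_ring B) M N" and g: "g \<in> lmod_hom (op_ring B) M N"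
    and eq: "\<And>X. X \<in> carrier (ind M) \<Longrightarrow>
      induced_map (op_ring A) (op_ring B) N f X = induced_map (op_ring A) (op_ring B) N g X"
    and x: "x \<in> carrier M"
  shows "f x = g x"
proof -
  interpret N: op_module B N using op_module_B[OF N] .
  interpret IN: op_module A "ind N" using op_module_ind[OF N] .
  have fx: "f x \<in> carrier N" "g x \<in> carrier N" using lmod_homD(1)[OF f x] lmod_homD(1)[OF g x] .
  have e: "unit_map N (f x) = unit_map N (g x)"
    using eq[OF unit_map_closed[OF M x]] by (simp add: induced_map_unit_map[OF M N f] induced_map_unit_map[OF M N g])
  have "unit_map N (f x \<ominus>\<^bsub>N\<^esub> g x) \<oplus>\<^bsub>ind N\<^esub> unit_map N (g x) = unit_map N (f x)"
    using fx unit_map_add[OF N, of "f x \<ominus>\<^bsub>N\<^esub> g x" "g x"]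
    by (simp add: a_minus_def N.M.a_assoc N.M.l_neg)
  then have "unit_map N (f x \<ominus>\<^bsub>N\<^esub> g x) = \<zero>\<^bsub>ind N\<^esub>"
    using fx e unit_map_closed[OF N] by (simp add: IN.M.add.r_cancel_one')
  then have "f x \<ominus>\<^bsub>N\<^esub> g x = \<zero>\<^bsub>N\<^esub>" using unit_map_faithful[OF N] fx by simp
  then show ?thesis using fx N.M.minus_eq_zeroD by blast
qed

end

section \<open>Dimension\<close>

lemma lmod_homI:
  assumes "\<And>x. x \<in> carrier M \<Longrightarrow> f x \<in> carrier N"
    and "\<And>x y. x \<in> carrier M \<Longrightarrow> y \<in> carrier M \<Longrightarrow> f (x \<oplus>\<^bsub>M\<^esub> y) = f x \<oplus>\<^bsub>N\<^esub> f y"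
    and "\<And>a x. a \<in> carrier R \<Longrightarrow> x \<in> carrier M \<Longrightarrow> f (a \<odot>\<^bsub>M\<^esub> x) = a \<odot>\<^bsub>N\<^esub> f x"
  shows "f \<in> lmod_hom R M N"
  using assms by (simp add: lmod_hom_def)

section \<open>Submodules and linear combinations\<close>

context op_module
begin

text \<open>Coefficients of indices with equal \<open>g i\<close> are added up; this trades a family
  of generators, possibly with repetitions, for a set containing its values.\<close>

lemma lc_regroup:
  assumes "finite J" "finite X" "\<And>i. i \<in> J \<Longrightarrow> y i \<in> A" "\<And>i. i \<in> J \<Longrightarrow> g i \<in> X"
    "\<And>x. x \<in> X \<Longrightarrow> f x \<in> carrier M"
  shows "lc M X (\<lambda>x. \<Sum>i\<in>J. y i o\<^sub>L (if x = g i then id_blinfun else 0)) f = lc M J y (\<lambda>i. f (g i))"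
proof -
  have "lc M X (\<lambda>x. \<Sum>i\<in>J. y i o\<^sub>L (if x = g i then id_blinfun else 0)) f
      = lc M J y (\<lambda>i. lc M X (\<lambda>x. if x = g i then id_blinfun else 0) f)"
    using assms by (intro lc_compose) auto
  also have "\<dots> = lc M J y (\<lambda>i. f (g i))"
    using assms M.smult_one by (intro lc_cong) (auto simp: lc_delta)
  finally show ?thesis .
qed

lemma submoduleI:
  assumes "H \<subseteq> carrier M" "\<zero>\<^bsub>M\<^esub> \<in> H" "\<And>x y. x \<in> H \<Longrightarrow> y \<in> H \<Longrightarrow> x \<oplus>\<^bsub>M\<^esub> y \<in> H"
    "\<And>a x. a \<in> A \<Longrightarrow> x \<in> H \<Longrightarrow> a \<odot>\<^bsub>M\<^esub> x \<in> H"
  shows "submodule H (op_ring A) M"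
proof -
  have "\<ominus>\<^bsub>M\<^esub> x \<in> H" if "x \<in> H" for x
    using assms(4)[of "- id_blinfun" x] that smult_minus_one[of x] assms(1) by (auto simp: closed)
  then show ?thesis
    using assms by (intro submodule.intro subgroup.intro submodule_axioms.intro) (auto simp: a_inv_def)
qed

lemma submoduleD:
  assumes "submodule H (op_ring A) M"
  shows "H \<subseteq> carrier M" "\<zero>\<^bsub>M\<^esub> \<in> H" "x \<in> H \<Longrightarrow> y \<in> H \<Longrightarrow> x \<oplus>\<^bsub>M\<^esub> y \<in> H"
    "a \<in> A \<Longrightarrow> x \<in> H \<Longrightarrow> a \<odot>\<^bsub>M\<^esub> x \<in> H"
proof -
  interpret H: submodule H "op_ring A" M by fact
  show "H \<subseteq> carrier M" "\<zero>\<^bsub>M\<^esub> \<in> H" "x \<in> H \<Longrightarrow> y \<in> H \<Longrightarrow> x \<oplus>\<^bsub>M\<^esub> y \<in> H"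
    using H.subset H.one_closed H.m_closed by auto
  show "a \<in> A \<Longrightarrow> x \<in> H \<Longrightarrow> a \<odot>\<^bsub>M\<^esub> x \<in> H" using H.smult_closed[of a x] by simp
qed

lemma submodule_op_module:
  assumes H: "submodule H (op_ring A) M"
  shows "op_module A (M\<lparr>carrier := H\<rparr>)"
proof -
  note H = submoduleD[OF H]
  have ag: "abelian_group (M\<lparr>carrier := H\<rparr>)"
  proof (rule abelian_groupI)
    fix x assume x: "x \<in> carrier (M\<lparr>carrier := H\<rparr>)"
    then have xM: "x \<in> carrier M" using H(1) by auto
    have "\<ominus>\<^bsub>M\<^esub> x \<in> H" using H(4)[of "- id_blinfun" x] x by (simp add: closed smult_minus_one[OF xM])
    then show "\<exists>y\<in>carrier (M\<lparr>carrier := H\<rparr>). y \<oplus>\<^bsub>M\<lparr>carrier := H\<rparr>\<^esub> x = \<zero>\<^bsub>M\<lparr>carrier := H\<rparr>\<^esub>"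
      using M.l_neg[OF xM] by auto
  qed (use H M.a_assoc M.a_comm in \<open>auto simp: subset_iff\<close>)
  have "left_module (op_ring A) (M\<lparr>carrier := H\<rparr>)"
    using ag ring_op_ring H M.smult_l_distr M.smult_r_distr M.smult_assoc M.smult_one
    by (intro left_module.intro left_module_axioms.intro) (auto simp: subset_iff)
  then show ?thesis using vn_algebra_axioms by (simp add: op_module_def)
qed

lemma submodule_lc:
  assumes H: "submodule H (op_ring A) M" and "finite I" "\<And>i. i \<in> I \<Longrightarrow> c i \<in> A" "\<And>i. i \<in> I \<Longrightarrow> g i \<in> H"
  shows "lc M I c g \<in> H" "lc (M\<lparr>carrier := H\<rparr>) I c g = lc M I c g"
proof -
  interpret H: op_module A "M\<lparr>carrier := H\<rparr>" by (rule submodule_op_module[OF H])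
  have "lc (M\<lparr>carrier := H\<rparr>) I c g = lc M I c g"
    using assms(2-)
  proof (induction I rule: finite_induct)
    case (insert k I)
    have "lc (M\<lparr>carrier := H\<rparr>) (insert k I) c g = c k \<odot>\<^bsub>M\<^esub> g k \<oplus>\<^bsub>M\<^esub> lc (M\<lparr>carrier := H\<rparr>) I c g"
      using insert H.lc_insert[of I k c g] by simp
    moreover have "lc M (insert k I) c g = c k \<odot>\<^bsub>M\<^esub> g k \<oplus>\<^bsub>M\<^esub> lc M I c g"
      using insert submoduleD(1)[OF H] by (intro lc_insert) auto
    ultimately show ?case using insert by simp
  qed simp
  then show "lc (M\<lparr>carrier := H\<rparr>) I c g = lc M I c g" "lc M I c g \<in> H"
    using H.lc_closed[of I c g] assms by auto
qed

lemma lmod_hom_inv: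
  assumes f: "f \<in> lmod_hom (op_ring A) M N" and bij: "bij_betw f (carrier M) (carrier N)"
  shows "inv_into (carrier M) f \<in> lmod_hom (op_ring A) N M"
proof -
  let ?g = "inv_into (carrier M) f"
  have gf: "?g (f x) = x" if "x \<in> carrier M" for x using bij_betw_inv_into_left[OF bij that] .
  have fg: "f (?g y) = y" and g: "?g y \<in> carrier M" if "y \<in> carrier N" for y
    using bij_betw_inv_into_right[OF bij that] bij_betw_apply[OF bij_betw_inv_into[OF bij] that] .
  show ?thesis
  proof (rule lmod_homI)
    show "?g (x \<oplus>\<^bsub>N\<^esub> y) = ?g x \<oplus>\<^bsub>M\<^esub> ?g y" if "x \<in> carrier N" "y \<in> carrier N" for x y
      using gf[of "?g x \<oplus>\<^bsub>M\<^esub> ?g y"] lmod_homD(2)[OF f g[OF that(1)] g[OF that(2)]] fg that g by simp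
    show "?g (a \<odot>\<^bsub>N\<^esub> x) = a \<odot>\<^bsub>M\<^esub> ?g x" if "a \<in> carrier (op_ring A)" "x \<in> carrier N" for a x
      using gf[of "a \<odot>\<^bsub>M\<^esub> ?g x"] lmod_homD(3)[OF f that(1) g[OF that(2)]] fg that g smult_mem by simp
  qed (rule g)
qed

lemma lc_diff_zero: "finite I \<Longrightarrow> (\<And>i. i \<in> I \<Longrightarrow> g i \<in> carrier M) \<Longrightarrow> (\<And>i. i \<in> I \<Longrightarrow> c i \<in> A) \<Longrightarrow> (\<And>i. i \<in> I \<Longrightarrow> d i \<in> A) \<Longrightarrow>
    lc M I c g = lc M I d g \<Longrightarrow> lc M I (\<lambda>i. c i - d i) g = \<zero>\<^bsub>M\<^esub>"
proof -
  assume *: "finite I" "\<And>i. i \<in> I \<Longrightarrow> g i \<in> carrier M" "\<And>i. i \<in> I \<Longrightarrow> c i \<in> A" "\<And>i. i \<in> I \<Longrightarrow> d i \<in> A"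
    "lc M I c g = lc M I d g"
  have "lc M I (\<lambda>i. c i - d i) g \<oplus>\<^bsub>M\<^esub> lc M I d g = lc M I d g"
    using lc_add[of I "\<lambda>i. c i - d i" d g] * by (simp add: closed)
  moreover have "lc M I (\<lambda>i. c i - d i) g \<in> carrier M" "lc M I d g \<in> carrier M"
    using * by (auto intro!: lc_closed closed)
  ultimately show ?thesis by (simp add: M.add.r_cancel_one')
qed

end

subsection \<open>Free modules and row spaces\<close>

lemma free_lmod_simps:
  "carrier (free_lmod (op_ring A) I) = {x. (\<forall>i\<in>I. x i \<in> A) \<and> (\<forall>i. i \<notin> I \<longrightarrow> x i = 0) \<and> finite {i. x i \<noteq> 0}}"
  "x \<oplus>\<^bsub>free_lmod (op_ring A) I\<^esub> y = (\<lambda>i. x i + y i)"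
  "a \<odot>\<^bsub>free_lmod (op_ring A) I\<^esub> x = (\<lambda>i. a o\<^sub>L x i)"
  "\<zero>\<^bsub>free_lmod (op_ring A) I\<^esub> = (\<lambda>i. 0)"
  by (simp_all add: free_lmod_def)

context vn_algebra
begin

lemma free_lmod_mem: "x \<in> carrier (free_lmod (op_ring A) I) \<Longrightarrow> x i \<in> A"
  by (cases "i \<in> I") (auto simp: free_lmod_simps)

lemma op_module_free: "op_module A (free_lmod (op_ring A) I)"
proof -
  have fin: "finite {i. x i + y i \<noteq> 0}" if "finite {i. x i \<noteq> 0}" "finite {i. y i \<noteq> 0}" for x y :: "'b \<Rightarrow> 'h oper"
    by (rule finite_subset[OF _ finite_UnI[OF that]]) auto
  have fin': "finite {i. a o\<^sub>L x i \<noteq> 0}" if "finite {i. x i \<noteq> 0}" for x :: "'b \<Rightarrow> 'h oper" and a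
    by (rule finite_subset[OF _ that]) auto
  have "abelian_group (free_lmod (op_ring A) I)"
  proof (rule abelian_groupI)
    show "\<exists>y\<in>carrier (free_lmod (op_ring A) I). y \<oplus>\<^bsub>free_lmod (op_ring A) I\<^esub> x = \<zero>\<^bsub>free_lmod (op_ring A) I\<^esub>"
      if "x \<in> carrier (free_lmod (op_ring A) I)" for x
      using that by (intro bexI[of _ "\<lambda>i. - x i"]) (auto simp: free_lmod_simps closed)
  qed (auto simp: free_lmod_simps closed fin add_ac)
  then have "left_module (op_ring A) (free_lmod (op_ring A) I)"
    using ring_op_ring
    by (intro left_module.intro left_module_axioms.intro)
      (auto simp: free_lmod_simps closed fin' compose_add_left compose_add_right compose_assoc)
  then show ?thesis using vn_algebra_axioms by (simp add: op_module_def)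
qed

lemma lc_free:
  assumes "finite J" "\<And>j. j \<in> J \<Longrightarrow> c j \<in> A" "\<And>j. j \<in> J \<Longrightarrow> g j \<in> carrier (free_lmod (op_ring A) I)"
  shows "lc (free_lmod (op_ring A) I) J c g = (\<lambda>i. \<Sum>j\<in>J. c j o\<^sub>L g j i)"
proof -
  interpret F: op_module A "free_lmod (op_ring A) I" by (rule op_module_free)
  show ?thesis
    using assms
  proof (induction J rule: finite_induct)
    case (insert k J)
    have "lc (free_lmod (op_ring A) I) (insert k J) c g =
        c k \<odot>\<^bsub>free_lmod (op_ring A) I\<^esub> g k \<oplus>\<^bsub>free_lmod (op_ring A) I\<^esub> lc (free_lmod (op_ring A) I) J c g"
      using insert by (intro F.lc_insert) auto
    with insert show ?case by (simp add: free_lmod_simps)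
  qed (simp add: free_lmod_simps)
qed

text \<open>For a projection \<open>F\<close> this is the image, described by fixed rows so that
  membership is an equation.\<close>

definition row_space :: "nat \<Rightarrow> (nat \<Rightarrow> nat \<Rightarrow> 'h oper) \<Rightarrow> (nat \<Rightarrow> 'h oper) set" where
  "row_space n F = {x. (\<forall>i<n. x i \<in> A) \<and> (\<forall>i. \<not> i < n \<longrightarrow> x i = 0) \<and> (\<forall>j<n. (\<Sum>i<n. x i o\<^sub>L F i j) = x j)}"

definition row_vec :: "nat \<Rightarrow> (nat \<Rightarrow> nat \<Rightarrow> 'h oper) \<Rightarrow> nat \<Rightarrow> nat \<Rightarrow> 'h oper" where
  "row_vec n F i j = (if j < n then F i j else 0)"

context
  fixes n :: nat and F
  assumes F: "proj_on A {..<n} F"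
begin

lemma row_space_submodule: "submodule (row_space n F) (op_ring A) (free_lmod (op_ring A) {..<n})"
proof -
  interpret R: op_module A "free_lmod (op_ring A) {..<n}" by (rule op_module_free)
  have "finite {i. x i \<noteq> 0}" if "\<forall>i. \<not> i < n \<longrightarrow> x i = 0" for x :: "nat \<Rightarrow> 'h oper"
    by (rule finite_subset[of _ "{..<n}"]) (use that in auto)
  then show ?thesis
    by (intro R.submoduleI)
      (auto simp: row_space_def free_lmod_simps closed compose_add_left sum.distrib compose_assoc compose_sum_right[symmetric])
qed

lemma matrix_image_eq: "matrix_image A n F = (free_lmod (op_ring A) {..<n})\<lparr>carrier := row_space n F\<rparr>"
proof -
  have sub: "row_space n F \<subseteq> carrier (free_lmod (op_ring A) {..<n})"
    using row_space_submodule op_module.submoduleD(1)[OF op_module_free] by blast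
  have "(\<lambda>x j. if j < n then \<Sum>i<n. x i o\<^sub>L F i j else 0) ` carrier (free_lmod (op_ring A) {..<n}) = row_space n F"
    (is "?f ` ?C = _")
  proof (rule Set.equalityI; rule subsetI)
    fix y assume "y \<in> ?f ` ?C"
    then obtain x where x: "x \<in> ?C" "y = ?f x" by blast
    have "(\<Sum>i<n. y i o\<^sub>L F i j) = y j" if j: "j < n" for j
    proof -
      have "(\<Sum>i<n. y i o\<^sub>L F i j) = (\<Sum>i<n. \<Sum>k<n. x k o\<^sub>L (F k i o\<^sub>L F i j))"
        by (simp add: x(2) compose_sum_left compose_assoc)
      also have "\<dots> = (\<Sum>k<n. x k o\<^sub>L (\<Sum>i<n. F k i o\<^sub>L F i j))"
        unfolding compose_sum_right by (rule sum.swap)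
      also have "\<dots> = y j" using proj_onD(2)[OF F] j by (simp add: x(2))
      finally show ?thesis .
    qed
    moreover have "y j \<in> A" if "j < n" for j
      using x that free_lmod_mem proj_onD(1)[OF F] by (auto intro!: closed)
    ultimately show "y \<in> row_space n F" by (simp add: row_space_def x(2))
  next
    fix y assume y: "y \<in> row_space n F"
    then have "y = ?f y" by (auto simp: row_space_def fun_eq_iff)
    then show "y \<in> ?f ` ?C" using subsetD[OF sub y] by (rule image_eqI)
  qed
  then show ?thesis by (simp add: matrix_image_def)
qed

lemma op_module_matrix_image: "op_module A (matrix_image A n F)"
  unfolding matrix_image_eq by (rule op_module.submodule_op_module[OF op_module_free row_space_submodule])

lemma carrier_matrix_image: "carrier (matrix_image A n F) = row_space n F"
  by (simp add: matrix_image_eq)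

lemma matrix_image_ops:
  "x \<oplus>\<^bsub>matrix_image A n F\<^esub> y = (\<lambda>i. x i + y i)"
  "a \<odot>\<^bsub>matrix_image A n F\<^esub> x = (\<lambda>i. a o\<^sub>L x i)" "\<zero>\<^bsub>matrix_image A n F\<^esub> = (\<lambda>i. 0)"
  by (simp_all add: matrix_image_eq free_lmod_simps)

lemma lc_matrix_image:
  assumes "finite J" "\<And>j. j \<in> J \<Longrightarrow> c j \<in> A" "\<And>j. j \<in> J \<Longrightarrow> g j \<in> row_space n F"
  shows "lc (matrix_image A n F) J c g = (\<lambda>i. \<Sum>j\<in>J. c j o\<^sub>L g j i)"
proof -
  have "row_space n F \<subseteq> carrier (free_lmod (op_ring A) {..<n})"
    using row_space_submodule op_module.submoduleD(1)[OF op_module_free] by blast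
  then have "lc (free_lmod (op_ring A) {..<n}) J c g = (\<lambda>i. \<Sum>j\<in>J. c j o\<^sub>L g j i)"
    using assms by (intro lc_free) auto
  then show ?thesis
    unfolding matrix_image_eq
    using op_module.submodule_lc(2)[OF op_module_free row_space_submodule, of J c g] assms by simp
qed

lemma row_vec_mem: "i < n \<Longrightarrow> row_vec n F i \<in> row_space n F"
  using proj_onD(1,2)[OF F] by (simp add: row_space_def row_vec_def)

text \<open>This is \<open>x = x F\<close> read row by row: the rows of \<open>F\<close> generate,
  with the entries of \<open>x\<close> as coefficients.\<close>

lemma row_expansion: "x \<in> row_space n F \<Longrightarrow> lc (matrix_image A n F) {..<n} x (row_vec n F) = x"
proof -
  assume x: "x \<in> row_space n F"
  have "lc (matrix_image A n F) {..<n} x (row_vec n F) = (\<lambda>j. \<Sum>i<n. x i o\<^sub>L row_vec n F i j)"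
    using x row_vec_mem by (intro lc_matrix_image) (auto simp: row_space_def)
  also have "\<dots> = x"
  proof
    show "(\<Sum>i<n. x i o\<^sub>L row_vec n F i j) = x j" for j
      using x by (cases "j < n") (simp_all add: row_space_def row_vec_def)
  qed
  finally show ?thesis .
qed

end

end

text \<open>Let \<open>u\<close> have the rows \<open>f (row_vec n F i)\<close> and \<open>v\<close>
  the rows \<open>g (row_vec m G j)\<close>. Expanding the rows of \<open>u\<close> in the rows of
  \<open>G\<close> and applying \<open>g\<close> gives \<open>u v = F\<close>; symmetrically
  \<open>v u = G\<close>.\<close>

lemma (in vn_trace) ptrace_iso:
  assumes F: "proj_on A {..<n} F" and G: "proj_on A {..<m} G"
    and f: "f \<in> lmod_hom (op_ring A) (matrix_image A n F) (matrix_image A m G)"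
    and g: "g \<in> lmod_hom (op_ring A) (matrix_image A m G) (matrix_image A n F)"
    and gf: "\<And>x. x \<in> row_space n F \<Longrightarrow> g (f x) = x" and fg: "\<And>x. x \<in> row_space m G \<Longrightarrow> f (g x) = x"
  shows "ptrace tr {..<n} F = ptrace tr {..<m} G"
proof -
  have half: "F i k = (\<Sum>j<m. f (row_vec n F i) j o\<^sub>L g (row_vec m G j) k)"
    if F: "proj_on A {..<n} F" and G: "proj_on A {..<m} G"
    and f: "f \<in> lmod_hom (op_ring A) (matrix_image A n F) (matrix_image A m G)"
    and g: "g \<in> lmod_hom (op_ring A) (matrix_image A m G) (matrix_image A n F)"
    and gf: "\<And>x. x \<in> row_space n F \<Longrightarrow> g (f x) = x" and ik: "i < n" "k < n" for F G f g n m i k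
  proof -
    interpret Q: op_module A "matrix_image A m G" by (rule op_module_matrix_image[OF G])
    note cF = carrier_matrix_image[OF F] and cG = carrier_matrix_image[OF G]
    let ?w = "f (row_vec n F i)"
    have w: "?w \<in> row_space m G"
      using lmod_homD(1)[OF f] row_vec_mem[OF F ik(1)] by (simp add: cF cG)
    have "g ?w = g (lc (matrix_image A m G) {..<m} ?w (row_vec m G))"
      using row_expansion[OF G w] by simp
    also have "\<dots> = lc (matrix_image A n F) {..<m} ?w (\<lambda>j. g (row_vec m G j))"
      using w row_vec_mem[OF G] by (intro Q.lc_hom[OF op_module_matrix_image[OF F] g]) (auto simp: row_space_def cG)
    also have "\<dots> = (\<lambda>k. \<Sum>j<m. ?w j o\<^sub>L g (row_vec m G j) k)"
      using w row_vec_mem[OF G] lmod_homD(1)[OF g] by (intro lc_matrix_image[OF F]) (auto simp: row_space_def cG cF)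
    finally have "row_vec n F i k = (\<Sum>j<m. ?w j o\<^sub>L g (row_vec m G j) k)"
      using gf[OF row_vec_mem[OF F ik(1)]] by (simp add: fun_eq_iff)
    then show ?thesis using ik by (simp add: row_vec_def)
  qed
  show ?thesis
  proof (rule ptrace_swap)
    show "f (row_vec n F i) j \<in> A" if "i \<in> {..<n}" "j \<in> {..<m}" for i j
      using lmod_homD(1)[OF f, of "row_vec n F i"] row_vec_mem[OF F] that
      by (simp add: carrier_matrix_image[OF F] carrier_matrix_image[OF G] row_space_def)
    show "g (row_vec m G j) i \<in> A" if "i \<in> {..<n}" "j \<in> {..<m}" for i j
      using lmod_homD(1)[OF g, of "row_vec m G j"] row_vec_mem[OF G] that
      by (simp add: carrier_matrix_image[OF F] carrier_matrix_image[OF G] row_space_def)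
    show "F i i = (\<Sum>j<m. f (row_vec n F i) j o\<^sub>L g (row_vec m G j) i)" if "i \<in> {..<n}" for i
      using half[OF F G f g gf] that by simp
    show "G j j = (\<Sum>i<n. g (row_vec m G j) i o\<^sub>L f (row_vec n F i) j)" if "j \<in> {..<m}" for j
      using half[OF G F g f fg] that by simp
  qed
qed

text \<open>The values among which \<open>dim_fg_proj\<close> chooses coincide: two matrix
  presentations of \<open>P\<close> are isomorphic through \<open>P\<close>, and
  \<open>ptrace_iso\<close> equates their traces.\<close>

lemma (in vn_trace) dim_fg_proj_eq:
  assumes P: "op_module A P" and F: "proj_on A {..<n} F" and iso: "lmod_iso (op_ring A) P (matrix_image A n F)"
  shows "dim_fg_proj A tr P = ptrace tr {..<n} F"
proof -
  interpret P: op_module A P by (rule P)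
  have pt: "Re (matrix_trace tr n F) = ptrace tr {..<n} F" for n F
    by (simp add: matrix_trace_def ptrace_def)
  obtain f where f: "f \<in> lmod_hom (op_ring A) P (matrix_image A n F)" "bij_betw f (carrier P) (carrier (matrix_image A n F))"
    using iso by (auto simp: lmod_iso_def)
  have "d = ptrace tr {..<n} F"
    if d: "\<exists>m G. projection_matrix A m G \<and> lmod_iso (op_ring A) P (matrix_image A m G) \<and> d = Re (matrix_trace tr m G)" for d
  proof -
    obtain m G g where G: "proj_on A {..<m} G" "d = ptrace tr {..<m} G"
      and g: "g \<in> lmod_hom (op_ring A) P (matrix_image A m G)" "bij_betw g (carrier P) (carrier (matrix_image A m G))"
      using d by (auto simp: lmod_iso_def projection_matrix_iff pt)
    let ?f' = "inv_into (carrier P) f" and ?g' = "inv_into (carrier P) g"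
    have comp: "b \<circ> a \<in> lmod_hom (op_ring A) X Z" if "a \<in> lmod_hom (op_ring A) X Y" "b \<in> lmod_hom (op_ring A) Y Z"
      for a b and X :: "('h oper, nat \<Rightarrow> 'h oper) module" and Y :: "('h oper, 'b) module" and Z :: "('h oper, nat \<Rightarrow> 'h oper) module"
      using lmod_homD[OF that(1)] lmod_homD[OF that(2)] by (intro lmod_homI) auto
    have "ptrace tr {..<n} F = ptrace tr {..<m} G"
    proof (rule ptrace_iso[OF F G(1), of "g \<circ> ?f'" "f \<circ> ?g'"])
      show "g \<circ> ?f' \<in> lmod_hom (op_ring A) (matrix_image A n F) (matrix_image A m G)"
        by (rule comp[OF P.lmod_hom_inv[OF f] g(1)])
      show "f \<circ> ?g' \<in> lmod_hom (op_ring A) (matrix_image A m G) (matrix_image A n F)"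
        by (rule comp[OF P.lmod_hom_inv[OF g] f(1)])
      show "(f \<circ> ?g') ((g \<circ> ?f') x) = x" if "x \<in> row_space n F" for x
        using that bij_betw_inv_into_right[OF f(2)] bij_betw_apply[OF bij_betw_inv_into[OF f(2)]] bij_betw_inv_into_left[OF g(2)]
        by (simp add: carrier_matrix_image[OF F])
      show "(g \<circ> ?f') ((f \<circ> ?g') x) = x" if "x \<in> row_space m G" for x
        using that bij_betw_inv_into_right[OF g(2)] bij_betw_apply[OF bij_betw_inv_into[OF g(2)]] bij_betw_inv_into_left[OF f(2)]
        by (simp add: carrier_matrix_image[OF G(1)])
    qed
    then show ?thesis using G(2) by simp
  qed
  moreover have "\<exists>d m G. projection_matrix A m G \<and> lmod_iso (op_ring A) P (matrix_image A m G) \<and> d = Re (matrix_trace tr m G)"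
    using F iso by (auto simp: projection_matrix_iff)
  ultimately show ?thesis unfolding dim_fg_proj_def by (rule someI2_ex[rotated])
qed

subsection \<open>Finitely generated projective submodules\<close>

text \<open>Embeddings of the row space of a projection \<open>F\<close>, given by the images \<open>m i\<close> of its rows.\<close>

definition (in op_module) embeds :: "'i set \<Rightarrow> ('i \<Rightarrow> 'i \<Rightarrow> 'h oper) \<Rightarrow> ('i \<Rightarrow> 'm) \<Rightarrow> bool" where
  "embeds I F m \<longleftrightarrow> proj_on A I F \<and> (\<forall>i\<in>I. m i \<in> carrier M) \<and>
    (\<forall>y. (\<forall>i\<in>I. y i \<in> A) \<longrightarrow> (\<forall>j\<in>I. (\<Sum>i\<in>I. y i o\<^sub>L F i j) = y j) \<longrightarrow> lc M I y m = \<zero>\<^bsub>M\<^esub> \<longrightarrow> (\<forall>i\<in>I. y i = 0))"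

context op_module
begin

lemma embedsD:
  assumes "embeds I F m"
  shows "proj_on A I F" "i \<in> I \<Longrightarrow> m i \<in> carrier M"
    "(\<And>i. i \<in> I \<Longrightarrow> y i \<in> A) \<Longrightarrow> (\<And>j. j \<in> I \<Longrightarrow> (\<Sum>i\<in>I. y i o\<^sub>L F i j) = y j) \<Longrightarrow> lc M I y m = \<zero>\<^bsub>M\<^esub> \<Longrightarrow>
      i \<in> I \<Longrightarrow> y i = 0"
  using assms by (simp_all add: embeds_def)

text \<open>The free module splits into the image of \<open>\<sigma>\<close> and the kernel of
  \<open>\<pi>\<close>, through the decomposition of \<open>x\<close> into
  \<open>\<sigma> (\<pi> x)\<close> and the rest.\<close>

lemma projective_retract:
  fixes I :: "'m set"
  assumes \<sigma>: "\<sigma> \<in> lmod_hom (op_ring A) M (free_lmod (op_ring A) I)"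
    and \<pi>: "\<pi> \<in> lmod_hom (op_ring A) (free_lmod (op_ring A) I) M"
    and \<pi>\<sigma>: "\<And>p. p \<in> carrier M \<Longrightarrow> \<pi> (\<sigma> p) = p"
  shows "projective (op_ring A) M"
proof -
  let ?L = "free_lmod (op_ring A) I"
  interpret L: op_module A ?L by (rule op_module_free)
  define U where "U = \<sigma> ` carrier M"
  define V where "V = {x \<in> carrier ?L. \<pi> x = \<zero>\<^bsub>M\<^esub>}"
  have \<sigma>0: "\<sigma> \<zero>\<^bsub>M\<^esub> = \<zero>\<^bsub>?L\<^esub>" and \<pi>0: "\<pi> \<zero>\<^bsub>?L\<^esub> = \<zero>\<^bsub>M\<^esub>"
    using lmod_hom_zero[OF _ _ \<sigma>] lmod_hom_zero[OF _ _ \<pi>] left_module_abelian_group[OF M.left_module_axioms]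
      left_module_abelian_group[OF L.M.left_module_axioms] by blast+
  have U: "submodule U (op_ring A) ?L"
  proof (rule L.submoduleI)
    show "\<zero>\<^bsub>?L\<^esub> \<in> U" unfolding U_def using \<sigma>0 M.zero_closed by (metis imageI)
    show "x \<oplus>\<^bsub>?L\<^esub> y \<in> U" if xy: "x \<in> U" "y \<in> U" for x y
    proof -
      obtain p q where "p \<in> carrier M" "q \<in> carrier M" "x = \<sigma> p" "y = \<sigma> q" using xy by (auto simp: U_def)
      then show ?thesis unfolding U_def using lmod_homD(2)[OF \<sigma>, of p q] by (metis M.a_closed imageI)
    qed
    show "a \<odot>\<^bsub>?L\<^esub> x \<in> U" if ax: "a \<in> A" "x \<in> U" for a x
    proof -
      obtain p where "p \<in> carrier M" "x = \<sigma> p" using ax by (auto simp: U_def)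
      then show ?thesis unfolding U_def using lmod_homD(3)[OF \<sigma>, of a p] smult_mem[of a p] ax(1)
        by (metis imageI op_ring_simps(1))
    qed
  qed (use lmod_homD(1)[OF \<sigma>] in \<open>auto simp: U_def\<close>)
  have V: "submodule V (op_ring A) ?L"
    by (rule L.submoduleI)
      (auto simp: V_def \<pi>0 lmod_homD[OF \<pi>] smult_zero_right L.smult_mem)
  have "U \<inter> V = {\<zero>\<^bsub>?L\<^esub>}"
    using L.submoduleD(2)[OF U] L.submoduleD(2)[OF V] \<pi>\<sigma> \<sigma>0 by (auto simp: U_def V_def)
  moreover have "U <+>\<^bsub>?L\<^esub> V = carrier ?L"
  proof (rule Set.equalityI; rule subsetI)
    fix x assume "x \<in> U <+>\<^bsub>?L\<^esub> V"
    then obtain u v where "u \<in> U" "v \<in> V" "x = u \<oplus>\<^bsub>?L\<^esub> v" by (auto simp: set_add_def')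
    then show "x \<in> carrier ?L" using L.submoduleD(1)[OF U] L.submoduleD(1)[OF V] by auto
  next
    fix x assume x: "x \<in> carrier ?L"
    have \<pi>x: "\<pi> x \<in> carrier M" "\<sigma> (\<pi> x) \<in> carrier ?L" using lmod_homD(1)[OF \<pi> x] lmod_homD(1)[OF \<sigma>] by auto
    have "\<pi> (x \<ominus>\<^bsub>?L\<^esub> \<sigma> (\<pi> x)) = \<pi> x \<oplus>\<^bsub>M\<^esub> \<ominus>\<^bsub>M\<^esub> \<pi> x"
      using x \<pi>x lmod_homD(2)[OF \<pi>] \<pi>\<sigma>
        lmod_hom_minus[OF left_module_abelian_group[OF L.M.left_module_axioms] left_module_abelian_group[OF M.left_module_axioms] \<pi>]
      by (simp add: a_minus_def)
    then have "x \<ominus>\<^bsub>?L\<^esub> \<sigma> (\<pi> x) \<in> V" using x \<pi>x by (simp add: V_def M.r_neg)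
    moreover have "x = \<sigma> (\<pi> x) \<oplus>\<^bsub>?L\<^esub> (x \<ominus>\<^bsub>?L\<^esub> \<sigma> (\<pi> x))"
      using x \<pi>x by (simp add: a_minus_def L.M.a_lcomm L.M.r_neg)
    moreover have "\<sigma> (\<pi> x) \<in> U" using \<pi>x by (simp add: U_def)
    ultimately show "x \<in> U <+>\<^bsub>?L\<^esub> V" unfolding set_add_def' by blast
  qed
  moreover have "lmod_iso (op_ring A) M (?L\<lparr>carrier := U\<rparr>)"
  proof -
    have "\<sigma> \<in> lmod_hom (op_ring A) M (?L\<lparr>carrier := U\<rparr>)"
      using lmod_homD[OF \<sigma>] by (intro lmod_homI) (auto simp: U_def)
    moreover have "bij_betw \<sigma> (carrier M) U"
      using \<pi>\<sigma> by (auto simp: bij_betw_def U_def intro: inj_on_inverseI)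
    ultimately show ?thesis unfolding lmod_iso_def by auto
  qed
  ultimately show ?thesis unfolding projective_def using U V by blast
qed

lemma fg_projective_of_iso:
  fixes n :: nat
  assumes F: "proj_on A {..<n} F"
    and \<psi>: "\<psi> \<in> lmod_hom (op_ring A) (matrix_image A n F) M" and bij: "bij_betw \<psi> (row_space n F) (carrier M)"
  shows "finitely_generated (op_ring A) M" "projective (op_ring A) M" "lmod_iso (op_ring A) M (matrix_image A n F)"
proof -
  let ?Q = "matrix_image A n F"
  interpret Q: op_module A ?Q by (rule op_module_matrix_image[OF F])
  note cQ = carrier_matrix_image[OF F]
  define \<theta> where "\<theta> = inv_into (row_space n F) \<psi>"
  have \<theta>: "\<theta> \<in> lmod_hom (op_ring A) M ?Q"
    using Q.lmod_hom_inv[OF \<psi>] bij by (simp add: \<theta>_def cQ)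
  have bij': "bij_betw \<theta> (carrier M) (row_space n F)" using bij by (simp add: \<theta>_def bij_betw_inv_into)
  have \<psi>\<theta>: "\<psi> (\<theta> p) = p" if "p \<in> carrier M" for p
    using bij_betw_inv_into_right[OF bij that] by (simp add: \<theta>_def)
  define g where "g i = \<psi> (row_vec n F i)" for i
  have g: "g i \<in> carrier M" if "i < n" for i
    using lmod_homD(1)[OF \<psi>] row_vec_mem[OF F that] by (simp add: g_def cQ)
  have \<theta>A: "\<theta> p i \<in> A" if "p \<in> carrier M" "i < n" for p i
    using lmod_homD(1)[OF \<theta> that(1)] that(2) by (simp add: cQ row_space_def)
  have expand: "lc M {..<n} (\<theta> p) g = p" if p: "p \<in> carrier M" for p
  proof -
    have \<theta>p: "\<theta> p \<in> row_space n F" using lmod_homD(1)[OF \<theta> p] by (simp add: cQ)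
    have "p = \<psi> (lc ?Q {..<n} (\<theta> p) (row_vec n F))" using row_expansion[OF F \<theta>p] \<psi>\<theta>[OF p] by simp
    also have "\<dots> = lc M {..<n} (\<theta> p) g"
      unfolding g_def using \<theta>A[OF p] row_vec_mem[OF F]
      by (intro Q.lc_hom[OF op_module_axioms \<psi>]) (auto simp: cQ)
    finally show ?thesis by simp
  qed
  show "lmod_iso (op_ring A) M ?Q" using \<theta> bij' by (auto simp: lmod_iso_def cQ)
  show "finitely_generated (op_ring A) M"
    unfolding finitely_generated_def
  proof (intro exI[of _ "g ` {..<n}"] conjI allI impI)
    fix H assume H: "submodule H (op_ring A) M \<and> g ` {..<n} \<subseteq> H"
    then have "p \<in> H" if "p \<in> carrier M" for p
      using submodule_lc(1)[of H "{..<n}" "\<theta> p" g] expand[OF that] \<theta>A[OF that] by auto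
    then show "H = carrier M" using H submoduleD(1) by blast
  qed (use g in auto)
  \<comment> \<open>The basis in \<open>projective\<close> must be a set of elements of
    \<open>M\<close>, so the images of the rows are taken without repetitions;
    \<open>\<sigma>\<close> adds the coefficients of coinciding ones.\<close>
  define G where "G = g ` {..<n}"
  have G: "finite G" "G \<subseteq> carrier M" using g by (auto simp: G_def)
  define \<sigma> where "\<sigma> p x = (if x \<in> G then \<Sum>i<n. \<theta> p i o\<^sub>L (if x = g i then id_blinfun else 0) else 0)" for p x
  define \<pi> where "\<pi> x = lc M G x (\<lambda>x. x)" for x
  show "projective (op_ring A) M"
  proof (rule projective_retract)
    show "\<sigma> \<in> lmod_hom (op_ring A) M (free_lmod (op_ring A) G)"
    proof (rule lmod_homI)
      show "\<sigma> p \<in> carrier (free_lmod (op_ring A) G)" if "p \<in> carrier M" for p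
      proof -
        have "finite {x. \<sigma> p x \<noteq> 0}" by (rule finite_subset[OF _ G(1)]) (auto simp: \<sigma>_def)
        then show ?thesis using \<theta>A[OF that] by (auto simp: free_lmod_simps \<sigma>_def intro!: closed)
      qed
      show "\<sigma> (p \<oplus>\<^bsub>M\<^esub> q) = \<sigma> p \<oplus>\<^bsub>free_lmod (op_ring A) G\<^esub> \<sigma> q" if "p \<in> carrier M" "q \<in> carrier M" for p q
        using lmod_homD(2)[OF \<theta> that]
        by (auto simp: \<sigma>_def free_lmod_simps matrix_image_ops[OF F] compose_add_left sum.distrib)
      show "\<sigma> (a \<odot>\<^bsub>M\<^esub> p) = a \<odot>\<^bsub>free_lmod (op_ring A) G\<^esub> \<sigma> p" if "a \<in> carrier (op_ring A)" "p \<in> carrier M" for a p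
        using lmod_homD(3)[OF \<theta> that]
        by (auto simp: \<sigma>_def free_lmod_simps matrix_image_ops[OF F] compose_assoc compose_sum_right)
    qed
    show "\<pi> \<in> lmod_hom (op_ring A) (free_lmod (op_ring A) G) M"
    proof (rule lmod_homI)
      fix x assume x: "x \<in> carrier (free_lmod (op_ring A) G)"
      show "\<pi> x \<in> carrier M" unfolding \<pi>_def using free_lmod_mem[OF x] G by (intro lc_closed) auto
      show "\<pi> (x \<oplus>\<^bsub>free_lmod (op_ring A) G\<^esub> y) = \<pi> x \<oplus>\<^bsub>M\<^esub> \<pi> y" if "y \<in> carrier (free_lmod (op_ring A) G)" for y
        unfolding \<pi>_def free_lmod_simps using free_lmod_mem[OF x] free_lmod_mem[OF that] G by (intro lc_add) auto
      show "\<pi> (a \<odot>\<^bsub>free_lmod (op_ring A) G\<^esub> x) = a \<odot>\<^bsub>M\<^esub> \<pi> x" if "a \<in> carrier (op_ring A)" for a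
        unfolding \<pi>_def free_lmod_simps using free_lmod_mem[OF x] that G by (intro lc_smult) auto
    qed
    fix p assume p: "p \<in> carrier M"
    have "\<pi> (\<sigma> p) = lc M G (\<lambda>x. \<Sum>i<n. \<theta> p i o\<^sub>L (if x = g i then id_blinfun else 0)) (\<lambda>x. x)"
      unfolding \<pi>_def using \<theta>A[OF p] G by (intro lc_cong) (auto simp: \<sigma>_def intro!: closed)
    also have "\<dots> = lc M {..<n} (\<theta> p) g"
      using \<theta>A[OF p] G by (intro lc_regroup) (auto simp: G_def)
    finally show "\<pi> (\<sigma> p) = p" using expand[OF p] by simp
  qed
qed

text \<open>\<open>embeds\<close> says that forming combinations of the \<open>m i\<close> is
  injective on the row space; the image is the submodule sought.\<close>

lemma embeds_submodule:
  assumes emb: "embeds {..<n} F m"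
  shows "\<exists>H. submodule H (op_ring A) M \<and> finitely_generated (op_ring A) (M\<lparr>carrier := H\<rparr>) \<and>
    projective (op_ring A) (M\<lparr>carrier := H\<rparr>) \<and> lmod_iso (op_ring A) (M\<lparr>carrier := H\<rparr>) (matrix_image A n F)"
proof -
  note F = embedsD(1)[OF emb] and m = embedsD(2)[OF emb]
  let ?Q = "matrix_image A n F"
  interpret Q: op_module A ?Q by (rule op_module_matrix_image[OF F])
  note cQ = carrier_matrix_image[OF F]
  define \<psi> where "\<psi> y = lc M {..<n} y m" for y
  have yA: "y i \<in> A" if "y \<in> row_space n F" for y i
    using that by (cases "i < n") (auto simp: row_space_def)
  have \<psi>: "\<psi> \<in> lmod_hom (op_ring A) ?Q M"
    by (rule lmod_homI) (auto simp: cQ \<psi>_def matrix_image_ops[OF F] yA m intro!: lc_closed lc_add lc_smult)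
  have inj: "inj_on \<psi> (row_space n F)"
  proof (rule inj_onI)
    fix x y assume xy: "x \<in> row_space n F" "y \<in> row_space n F" "\<psi> x = \<psi> y"
    have eq: "x i - y i = 0" if "i < n" for i
    proof (rule embedsD(3)[OF emb, where y = "\<lambda>i. x i - y i"])
      show "x k - y k \<in> A" for k using yA[OF xy(1)] yA[OF xy(2)] by (simp add: closed)
      show "(\<Sum>k<n. (x k - y k) o\<^sub>L F k j) = x j - y j" if "j \<in> {..<n}" for j
        using xy(1,2) that by (simp add: compose_diff_left sum_subtractf row_space_def)
      show "lc M {..<n} (\<lambda>i. x i - y i) m = \<zero>\<^bsub>M\<^esub>"
        using xy yA m by (intro lc_diff_zero) (auto simp: \<psi>_def)
    qed (use that in simp)
    show "x = y"
    proof
      show "x i = y i" for i using eq[of i] xy(1,2) by (cases "i < n") (simp_all add: row_space_def)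
    qed
  qed
  define H where "H = \<psi> ` row_space n F"
  have H: "submodule H (op_ring A) M"
  proof (rule submoduleI)
    show "\<zero>\<^bsub>M\<^esub> \<in> H"
      using lmod_hom_zero[OF left_module_abelian_group[OF Q.M.left_module_axioms] left_module_abelian_group[OF M.left_module_axioms] \<psi>]
        Q.M.zero_closed unfolding H_def cQ by (metis imageI)
    show "x \<oplus>\<^bsub>M\<^esub> y \<in> H" if xy: "x \<in> H" "y \<in> H" for x y
    proof -
      obtain p q where "p \<in> row_space n F" "q \<in> row_space n F" "x = \<psi> p" "y = \<psi> q" using xy by (auto simp: H_def)
      then show ?thesis unfolding H_def using lmod_homD(2)[OF \<psi>, of p q] Q.M.a_closed[of p q] by (metis cQ imageI)
    qed
    show "a \<odot>\<^bsub>M\<^esub> x \<in> H" if ax: "a \<in> A" "x \<in> H" for a x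
    proof -
      obtain p where "p \<in> row_space n F" "x = \<psi> p" using ax by (auto simp: H_def)
      then show ?thesis unfolding H_def using lmod_homD(3)[OF \<psi>, of a p] Q.smult_mem[of a p] ax(1)
        by (metis cQ imageI op_ring_simps(1))
    qed
  qed (use lmod_homD(1)[OF \<psi>] in \<open>auto simp: H_def cQ\<close>)
  interpret H: op_module A "M\<lparr>carrier := H\<rparr>" by (rule submodule_op_module[OF H])
  have "\<psi> \<in> lmod_hom (op_ring A) ?Q (M\<lparr>carrier := H\<rparr>)"
    using lmod_homD[OF \<psi>] by (intro lmod_homI) (auto simp: H_def cQ)
  from H.fg_projective_of_iso[OF F this] show ?thesis using H inj by (auto simp: bij_betw_def H_def)
qed

text \<open>The projection onto the summand \<open>U\<close> along \<open>V\<close> gives an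
  idempotent matrix \<open>u\<close>, which need not be self-adjoint. The annihilator of the columns
  of \<open>1 - u\<close> is self-adjoint and has the same fixed rows.\<close>

lemma projective_basis:
  assumes fg: "finitely_generated (op_ring A) M" and proj: "projective (op_ring A) M"
  shows "\<exists>(n::nat) F. proj_on A {..<n} F \<and> lmod_iso (op_ring A) M (matrix_image A n F)"
proof -
  obtain I :: "'m set" and U V where U: "submodule U (op_ring A) (free_lmod (op_ring A) I)"
    and V: "submodule V (op_ring A) (free_lmod (op_ring A) I)" and UV: "U \<inter> V = {\<zero>\<^bsub>free_lmod (op_ring A) I\<^esub>}"
    "U <+>\<^bsub>free_lmod (op_ring A) I\<^esub> V = carrier (free_lmod (op_ring A) I)"
    and iso: "lmod_iso (op_ring A) M ((free_lmod (op_ring A) I)\<lparr>carrier := U\<rparr>)"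
    using proj unfolding projective_def by blast
  let ?L = "free_lmod (op_ring A) I"
  interpret L: op_module A ?L by (rule op_module_free)
  obtain \<theta> where \<theta>: "\<theta> \<in> lmod_hom (op_ring A) M (?L\<lparr>carrier := U\<rparr>)" and \<theta>bij: "bij_betw \<theta> (carrier M) U"
    using iso by (auto simp: lmod_iso_def)
  have \<theta>U: "\<theta> p \<in> U" if "p \<in> carrier M" for p using lmod_homD(1)[OF \<theta> that] by simp
  have UL: "U \<subseteq> carrier ?L" and VL: "V \<subseteq> carrier ?L" using L.submoduleD(1)[OF U] L.submoduleD(1)[OF V] .
  have \<theta>add: "\<theta> (p \<oplus>\<^bsub>M\<^esub> q) = (\<lambda>i. \<theta> p i + \<theta> q i)" if "p \<in> carrier M" "q \<in> carrier M" for p q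
    using lmod_homD(2)[OF \<theta> that] by (simp add: free_lmod_simps)
  have \<theta>smult: "\<theta> (a \<odot>\<^bsub>M\<^esub> p) = (\<lambda>i. a o\<^sub>L \<theta> p i)" if "a \<in> A" "p \<in> carrier M" for a p
    using lmod_homD(3)[OF \<theta>, of a p] that by (simp add: free_lmod_simps)
  have \<theta>zero: "\<theta> \<zero>\<^bsub>M\<^esub> = (\<lambda>i. 0)"
    using \<theta>smult[of 0 "\<zero>\<^bsub>M\<^esub>"] by (simp add: smult_zero_left)
  obtain S where S: "finite S" "S \<subseteq> carrier M" "\<And>H. submodule H (op_ring A) M \<Longrightarrow> S \<subseteq> H \<Longrightarrow> H = carrier M"
    using fg unfolding finitely_generated_def by blast
  \<comment> \<open>Finitely many generators have finite supports, so the whole image of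
    \<open>\<theta>\<close> lives on a finite part of the possibly infinite basis.\<close>
  define I0 where "I0 = (\<Union>s\<in>S. {i. \<theta> s i \<noteq> 0})"
  have "finite {i. \<theta> s i \<noteq> 0} \<and> {i. \<theta> s i \<noteq> 0} \<subseteq> I" if "s \<in> S" for s
    using subsetD[OF UL \<theta>U[OF subsetD[OF S(2) that]]] by (auto simp: free_lmod_simps)
  then have I0: "finite I0" "I0 \<subseteq> I" using S(1) by (auto simp: I0_def)
  have "submodule {p \<in> carrier M. \<forall>i. i \<notin> I0 \<longrightarrow> \<theta> p i = 0} (op_ring A) M"
    by (rule submoduleI) (auto simp: \<theta>add \<theta>smult \<theta>zero smult_mem)
  from S(3)[OF this] have supp: "\<theta> p i = 0" if "p \<in> carrier M" "i \<notin> I0" for p i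
    using that S(2) by (auto simp: I0_def)
  define n where "n = card I0"
  obtain e where e: "bij_betw e {..<n} I0"
    using ex_bij_betw_nat_finite[OF I0(1)] by (auto simp: n_def atLeast0LessThan)
  have eI: "e r \<in> I" if "r < n" for r using bij_betw_apply[OF e] that I0(2) by auto
  define \<delta> where "\<delta> r i = (if i = e r then id_blinfun else 0 :: 'h oper)" for r i
  have \<delta>L: "\<delta> r \<in> carrier ?L" if "r < n" for r
  proof -
    have "finite {i. \<delta> r i \<noteq> 0}" by (rule finite_subset[of _ "{e r}"]) (auto simp: \<delta>_def)
    then show ?thesis using eI[OF that] by (auto simp: free_lmod_simps \<delta>_def)
  qed
  have "\<exists>u v. u \<in> U \<and> v \<in> V \<and> \<delta> r = u \<oplus>\<^bsub>?L\<^esub> v" if "r < n" for r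
    using \<delta>L[OF that] unfolding UV(2)[symmetric] set_add_def' by blast
  then obtain u v where uv: "\<And>r. r < n \<Longrightarrow> u r \<in> U" "\<And>r. r < n \<Longrightarrow> v r \<in> V"
    "\<And>r. r < n \<Longrightarrow> \<delta> r = u r \<oplus>\<^bsub>?L\<^esub> v r" by metis
  have uL: "u r \<in> carrier ?L" and vL: "v r \<in> carrier ?L" if "r < n" for r using uv(1,2)[OF that] UL VL by blast+
  have key: "\<theta> p i = (\<Sum>r<n. \<theta> p (e r) o\<^sub>L u r i)" if p: "p \<in> carrier M" for p i
  proof -
    have xA: "\<theta> p i \<in> A" for i using free_lmod_mem[OF subsetD[OF UL \<theta>U[OF p]]] .
    \<comment> \<open>The components of \<open>\<theta> p\<close> in \<open>U\<close> and
      \<open>V\<close>. As \<open>\<theta> p\<close> lies in \<open>U\<close>, so does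
      \<open>z\<close>, whence \<open>z = 0\<close>.\<close>
    define w z where "w = (\<lambda>i. \<Sum>r<n. \<theta> p (e r) o\<^sub>L u r i)" and "z = (\<lambda>i. \<Sum>r<n. \<theta> p (e r) o\<^sub>L v r i)"
    have w: "w \<in> U" using L.submodule_lc(1)[OF U, of "{..<n}" "\<lambda>r. \<theta> p (e r)" u] lc_free[of "{..<n}" "\<lambda>r. \<theta> p (e r)" u I] uv(1) uL xA
      by (simp add: w_def)
    have z: "z \<in> V" using L.submodule_lc(1)[OF V, of "{..<n}" "\<lambda>r. \<theta> p (e r)" v] lc_free[of "{..<n}" "\<lambda>r. \<theta> p (e r)" v I] uv(2) vL xA
      by (simp add: z_def)
    have x: "\<theta> p i = w i + z i" for i
    proof -
      have "w i + z i = (\<Sum>r<n. \<theta> p (e r) o\<^sub>L (if i = e r then id_blinfun else 0))"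
        using uv(3) unfolding w_def z_def sum.distrib[symmetric]
        by (intro sum.cong) (auto simp: compose_add_right[symmetric] free_lmod_simps \<delta>_def fun_eq_iff)
      also have "\<dots> = (\<Sum>j\<in>I0. \<theta> p j o\<^sub>L (if i = j then id_blinfun else 0))"
        using sum.reindex_bij_betw[OF e, of "\<lambda>j. \<theta> p j o\<^sub>L (if i = j then id_blinfun else 0)"] .
      also have "\<dots> = \<theta> p i"
      proof (cases "i \<in> I0")
        case True
        then show ?thesis using sum_compose_delta(1)[OF I0(1) True, of "\<theta> p" id_blinfun] by (simp add: eq_commute)
      next
        case False
        have "(\<Sum>j\<in>I0. \<theta> p j o\<^sub>L (if i = j then id_blinfun else 0)) = 0"
          using False by (intro sum.neutral) auto
        then show ?thesis using supp[OF p False] by simp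
      qed
      finally show ?thesis by simp
    qed
    have "(- id_blinfun) \<odot>\<^bsub>?L\<^esub> w \<in> U" using L.submoduleD(4)[OF U _ w] by (simp add: closed)
    from L.submoduleD(3)[OF U \<theta>U[OF p] this] have "z \<in> U"
      using x by (simp add: free_lmod_simps compose_minus_left)
    then have "z = (\<lambda>i. 0)" using z UV(1) by (auto simp: free_lmod_simps)
    then show ?thesis using x[of i] by (simp add: w_def)
  qed
  \<comment> \<open>\<open>C s\<close> is column \<open>s\<close> of \<open>1 - u\<close>, so a row
    is killed by all of them iff \<open>u\<close> fixes it.\<close>
  define C where "C s r = (if r = s then id_blinfun else 0) - u r (e s)" for s r
  obtain F where F: "is_ann A {..<n} (C ` {..<n}) F"
    using ann_exists[OF vN, of "{..<n}" "C ` {..<n}"] free_lmod_mem[OF uL] by (auto simp: C_def closed)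
  note PF = is_annD(1)[OF F]
  have row: "(\<forall>j<n. (\<Sum>i<n. y i o\<^sub>L F i j) = y j) \<longleftrightarrow> (\<forall>s<n. (\<Sum>r<n. y r o\<^sub>L u r (e s)) = y s)"
    if yA: "\<And>i. i < n \<Longrightarrow> y i \<in> A" for y
  proof -
    have C: "(\<Sum>r<n. y r o\<^sub>L C s r) = y s - (\<Sum>r<n. y r o\<^sub>L u r (e s))" if "s < n" for s y
      using that by (simp add: C_def compose_diff_right sum_subtractf sum_compose_delta)
    show ?thesis
    proof
      assume yF: "\<forall>j<n. (\<Sum>i<n. y i o\<^sub>L F i j) = y j"
      have "(\<Sum>r<n. y r o\<^sub>L C s r) = 0" if s: "s < n" for s
      proof -
        have "(\<Sum>r<n. y r o\<^sub>L C s r) = (\<Sum>r<n. \<Sum>i<n. y i o\<^sub>L (F i r o\<^sub>L C s r))"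
        proof (rule sum.cong[OF refl])
          fix r assume "r \<in> {..<n}"
          then have "y r o\<^sub>L C s r = (\<Sum>i<n. y i o\<^sub>L F i r) o\<^sub>L C s r" using yF by simp
          then show "y r o\<^sub>L C s r = (\<Sum>i<n. y i o\<^sub>L (F i r o\<^sub>L C s r))" by (simp add: compose_sum_left compose_assoc)
        qed
        also have "\<dots> = (\<Sum>i<n. y i o\<^sub>L (\<Sum>r<n. F i r o\<^sub>L C s r))"
          unfolding compose_sum_right by (rule sum.swap)
        also have "\<dots> = 0" using is_annD(2)[OF F, of "C s"] s by simp
        finally show ?thesis .
      qed
      then show "\<forall>s<n. (\<Sum>r<n. y r o\<^sub>L u r (e s)) = y s" by (simp add: C)
    next
      assume "\<forall>s<n. (\<Sum>r<n. y r o\<^sub>L u r (e s)) = y s"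
      then show "\<forall>j<n. (\<Sum>i<n. y i o\<^sub>L F i j) = y j"
        using yA bounded by (intro allI impI is_annD(3)[OF F]) (auto simp: C)
    qed
  qed
  define \<gamma> where "\<gamma> p s = (if s < n then \<theta> p (e s) else 0)" for p s
  have \<gamma>: "\<gamma> p \<in> row_space n F" if p: "p \<in> carrier M" for p
  proof -
    have A: "\<theta> p i \<in> A" for i using free_lmod_mem[OF subsetD[OF UL \<theta>U[OF p]]] .
    have "\<forall>s<n. (\<Sum>r<n. \<gamma> p r o\<^sub>L u r (e s)) = \<gamma> p s" using key[OF p, symmetric] by (simp add: \<gamma>_def)
    then show ?thesis using row[of "\<gamma> p"] A by (simp add: row_space_def \<gamma>_def)
  qed
  have "bij_betw \<gamma> (carrier M) (row_space n F)"
    unfolding bij_betw_def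
  proof
    show "inj_on \<gamma> (carrier M)"
    proof (rule inj_onI)
      fix p q assume pq: "p \<in> carrier M" "q \<in> carrier M" "\<gamma> p = \<gamma> q"
      have "\<theta> p (e r) = \<theta> q (e r)" if "r < n" for r using fun_cong[OF pq(3), of r] that by (simp add: \<gamma>_def)
      then have "\<theta> p i = \<theta> q i" for i
        by (subst key[OF pq(1)], subst key[OF pq(2)]) (intro sum.cong, simp_all)
      then have "\<theta> p = \<theta> q" ..
      then show "p = q" using \<theta>bij pq by (auto simp: bij_betw_def inj_on_def)
    qed
    show "\<gamma> ` carrier M = row_space n F"
    proof (rule Set.equalityI; rule subsetI)
      fix y assume y: "y \<in> row_space n F"
      then have yA: "\<And>i. i < n \<Longrightarrow> y i \<in> A" by (simp add: row_space_def)
      have yu: "\<forall>s<n. (\<Sum>r<n. y r o\<^sub>L u r (e s)) = y s" using row[OF yA] y by (simp add: row_space_def)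
      have "(\<lambda>i. \<Sum>r<n. y r o\<^sub>L u r i) \<in> U"
        using L.submodule_lc(1)[OF U, of "{..<n}" y u] lc_free[of "{..<n}" y u I] uv(1) uL yA by simp
      then obtain p where p: "p \<in> carrier M" "\<theta> p = (\<lambda>i. \<Sum>r<n. y r o\<^sub>L u r i)"
        using \<theta>bij by (auto simp: bij_betw_def) 
      have "\<gamma> p = y" using yu y by (auto simp: \<gamma>_def p(2) row_space_def fun_eq_iff)
      then show "y \<in> \<gamma> ` carrier M" using p(1) by blast
    qed (use \<gamma> in auto)
  qed
  moreover have "\<gamma> \<in> lmod_hom (op_ring A) M (matrix_image A n F)"
    by (rule lmod_homI) (auto simp: carrier_matrix_image[OF PF] \<gamma> matrix_image_ops[OF PF] \<gamma>_def \<theta>add \<theta>smult)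
  ultimately have "lmod_iso (op_ring A) M (matrix_image A n F)"
    unfolding lmod_iso_def carrier_matrix_image[OF PF] by blast
  then show ?thesis using PF by blast
qed

text \<open>The \<open>m i\<close> are the preimages of the rows of \<open>F\<close>, so a
  combination with coefficients \<open>y = y F\<close> has image \<open>y\<close> and vanishes only
  for \<open>y = 0\<close>.\<close>

lemma submodule_embeds:
  assumes H: "submodule H (op_ring A) M" and F: "proj_on A {..<n} F"
    and iso: "lmod_iso (op_ring A) (M\<lparr>carrier := H\<rparr>) (matrix_image A n F)"
  shows "\<exists>m. embeds {..<n} F m"
proof -
  interpret H: op_module A "M\<lparr>carrier := H\<rparr>" by (rule submodule_op_module[OF H])
  interpret Q: op_module A "matrix_image A n F" by (rule op_module_matrix_image[OF F])
  note cQ = carrier_matrix_image[OF F]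
  obtain \<gamma> where \<gamma>: "\<gamma> \<in> lmod_hom (op_ring A) (M\<lparr>carrier := H\<rparr>) (matrix_image A n F)"
    and bij: "bij_betw \<gamma> H (row_space n F)"
    using iso by (auto simp: lmod_iso_def cQ)
  define m where "m i = inv_into H \<gamma> (row_vec n F i)" for i
  have m: "m i \<in> H" "\<gamma> (m i) = row_vec n F i" if "i < n" for i
    using bij_betw_apply[OF bij_betw_inv_into[OF bij] row_vec_mem[OF F that]]
      bij_betw_inv_into_right[OF bij row_vec_mem[OF F that]] by (simp_all add: m_def)
  have "y i = 0" if yA: "\<And>i. i < n \<Longrightarrow> y i \<in> A" and yF: "\<And>j. j < n \<Longrightarrow> (\<Sum>i<n. y i o\<^sub>L F i j) = y j"
    and y0: "lc M {..<n} y m = \<zero>\<^bsub>M\<^esub>" and i: "i < n" for y i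
  proof -
    have "\<gamma> (lc (M\<lparr>carrier := H\<rparr>) {..<n} y m) = lc (matrix_image A n F) {..<n} y (\<lambda>i. \<gamma> (m i))"
      using yA m by (intro H.lc_hom[OF op_module_matrix_image[OF F] \<gamma>]) auto
    also have "\<dots> = lc (matrix_image A n F) {..<n} y (row_vec n F)"
      using yA m row_vec_mem[OF F] by (intro Q.lc_cong) (auto simp: cQ)
    also have "\<dots> = (\<lambda>j. \<Sum>i<n. y i o\<^sub>L row_vec n F i j)"
      using yA row_vec_mem[OF F] by (intro lc_matrix_image[OF F]) auto
    finally have "\<gamma> \<zero>\<^bsub>M\<^esub> i = y i"
      using submodule_lc(2)[OF H, of "{..<n}" y m] yA m y0 yF i by (simp add: row_vec_def)
    moreover have "\<gamma> \<zero>\<^bsub>M\<^esub> = (\<lambda>i. 0)"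
      using lmod_hom_zero[OF left_module_abelian_group[OF H.M.left_module_axioms] left_module_abelian_group[OF Q.M.left_module_axioms] \<gamma>]
      by (simp add: matrix_image_ops[OF F])
    ultimately show ?thesis by simp
  qed
  then have "embeds {..<n} F m"
    unfolding embeds_def using F m(1) submoduleD(1)[OF H] by auto
  then show ?thesis by blast
qed

text \<open>Trades submodules for matrices with tuples of elements, data that can be moved between
  \<open>B\<close> and \<open>A\<close>.\<close>

theorem vn_dim_eq:
  assumes tr: "is_trace A tr"
  shows "vn_dim A tr M = Sup {ereal (ptrace tr {..<n} F) | (n::nat) F. \<exists>m. embeds {..<n} F m}"
proof -
  interpret T: vn_trace A tr using tr vn_algebra_axioms by (simp add: vn_trace_def vn_trace_axioms_def)
  let ?\<H> = "{H. submodule H (op_ring A) M \<and> finitely_generated (op_ring A) (M\<lparr>carrier := H\<rparr>) \<and>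
      projective (op_ring A) (M\<lparr>carrier := H\<rparr>)}"
  have "(\<lambda>H. ereal (dim_fg_proj A tr (M\<lparr>carrier := H\<rparr>))) ` ?\<H> =
      {ereal (ptrace tr {..<n} F) | (n::nat) F. \<exists>m. embeds {..<n} F m}" (is "?l = ?r")
  proof (rule Set.equalityI; rule subsetI)
    fix d assume "d \<in> ?l"
    then obtain H where H: "submodule H (op_ring A) M" "finitely_generated (op_ring A) (M\<lparr>carrier := H\<rparr>)"
      "projective (op_ring A) (M\<lparr>carrier := H\<rparr>)" "d = ereal (dim_fg_proj A tr (M\<lparr>carrier := H\<rparr>))" by blast
    obtain n :: nat and F where F: "proj_on A {..<n} F" "lmod_iso (op_ring A) (M\<lparr>carrier := H\<rparr>) (matrix_image A n F)"
      using op_module.projective_basis[OF submodule_op_module[OF H(1)] H(2,3)] by blast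
    show "d \<in> ?r"
      using submodule_embeds[OF H(1) F] T.dim_fg_proj_eq[OF submodule_op_module[OF H(1)] F] H(4) by auto
  next
    fix d assume "d \<in> ?r"
    then obtain n :: nat and F m where emb: "embeds {..<n} F m" "d = ereal (ptrace tr {..<n} F)" by blast
    obtain H where H: "submodule H (op_ring A) M" "finitely_generated (op_ring A) (M\<lparr>carrier := H\<rparr>)"
      "projective (op_ring A) (M\<lparr>carrier := H\<rparr>)" "lmod_iso (op_ring A) (M\<lparr>carrier := H\<rparr>) (matrix_image A n F)"
      using embeds_submodule[OF emb(1)] by blast
    have "d = ereal (dim_fg_proj A tr (M\<lparr>carrier := H\<rparr>))"
      using T.dim_fg_proj_eq[OF submodule_op_module[OF H(1)] embedsD(1)[OF emb(1)] H(4)] emb(2) by simp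
    with H show "d \<in> ?l" by blast
  qed
  then show ?thesis unfolding vn_dim_def by simp
qed

end

subsection \<open>Invariance of the dimension under induction\<close>

context vn_inclusion
begin

lemma proj_on_mono: "proj_on B I F \<Longrightarrow> proj_on A I F"
  using subset by (auto simp: proj_on_def)

lemma is_ann_mono: "is_ann B I S F \<Longrightarrow> is_ann A I S F"
  using proj_on_mono by (auto simp: is_ann_def)

text \<open>By flatness, a row \<open>y = y F\<close> over \<open>A\<close> of value zero is
  \<open>\<alpha> d\<close> with rows \<open>d\<close> over \<open>B\<close> such that
  \<open>d m' = 0\<close>. Each \<open>d F\<close> lies in the row space over \<open>B\<close> and
  has value zero, hence is zero; so \<open>y = \<alpha> d F = 0\<close>.\<close>

lemma embeds_induced:
  fixes I :: "'i set"
  assumes M: "left_module (op_ring B) M" and I: "finite I" and emb: "op_module.embeds B M I F m"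
  shows "\<exists>m'. op_module.embeds A (ind M) I F m'"
proof -
  interpret M: op_module B M by (rule op_module_B[OF M])
  interpret N: op_module A "ind M" by (rule op_module_ind[OF M])
  note F = M.embedsD(1)[OF emb] and m = M.embedsD(2)[OF emb]
  note PF = proj_onD[OF F]
  \<comment> \<open>The rows \<open>d\<close> supplied by the criterion need not be fixed by
    \<open>F\<close>; taking \<open>F m\<close> for \<open>m\<close> makes \<open>d m'\<close> the
    value of the row \<open>d F\<close>, which is fixed.\<close>
  define m' where "m' i = lc M I (F i) m" for i
  have m': "m' i \<in> carrier M" if "i \<in> I" for i
    unfolding m'_def using PF(1) that m by (intro M.lc_closed) auto
  have inj: "y i = 0" if yA: "\<And>i. i \<in> I \<Longrightarrow> y i \<in> A" and yF: "\<And>j. j \<in> I \<Longrightarrow> (\<Sum>i\<in>I. y i o\<^sub>L F i j) = y j"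
    and y0: "lc (ind M) I y (\<lambda>i. unit_map M (m' i)) = \<zero>\<^bsub>ind M\<^esub>" and i: "i \<in> I" for y i
  proof -
    from equational_criterion[OF M I _ _ y0] yA m'
    obtain K :: "(nat + 'i) set" and \<alpha> d where K: "finite K" "\<forall>k\<in>K. \<alpha> k \<in> A" "\<forall>k\<in>K. \<forall>i\<in>I. d k i \<in> B"
      "\<forall>k\<in>K. lc M I (d k) m' = \<zero>\<^bsub>M\<^esub>" "\<forall>i\<in>I. y i = (\<Sum>k\<in>K. \<alpha> k o\<^sub>L d k i)"
      by auto
    have dF: "(\<Sum>i\<in>I. d k i o\<^sub>L F i j) = 0" if k: "k \<in> K" and j: "j \<in> I" for k j
    proof (rule M.embedsD(3)[OF emb _ _ _ j, of "\<lambda>j. \<Sum>i\<in>I. d k i o\<^sub>L F i j"])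
      show "(\<Sum>i\<in>I. d k i o\<^sub>L F i j) \<in> B" if "j \<in> I" for j
        using K(3) k PF(1) that by (intro B.sum_mem B.compose_mem) auto
      show "(\<Sum>l\<in>I. (\<Sum>i\<in>I. d k i o\<^sub>L F i l) o\<^sub>L F l j) = (\<Sum>i\<in>I. d k i o\<^sub>L F i j)" if j: "j \<in> I" for j
      proof -
        have "(\<Sum>l\<in>I. (\<Sum>i\<in>I. d k i o\<^sub>L F i l) o\<^sub>L F l j) = (\<Sum>l\<in>I. \<Sum>i\<in>I. d k i o\<^sub>L (F i l o\<^sub>L F l j))"
          by (simp add: compose_sum_left compose_assoc)
        also have "\<dots> = (\<Sum>i\<in>I. d k i o\<^sub>L (\<Sum>l\<in>I. F i l o\<^sub>L F l j))"
          unfolding compose_sum_right by (rule sum.swap)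
        finally show ?thesis using PF(2) j by simp
      qed
      have "lc M I (\<lambda>j. \<Sum>i\<in>I. d k i o\<^sub>L F i j) m = lc M I (d k) m'"
        unfolding m'_def using K(3) k PF(1) m by (intro M.lc_compose[OF I I]) auto
      then show "lc M I (\<lambda>j. \<Sum>i\<in>I. d k i o\<^sub>L F i j) m = \<zero>\<^bsub>M\<^esub>" using K(4) k by simp
    qed
    have "y i = (\<Sum>l\<in>I. (\<Sum>k\<in>K. \<alpha> k o\<^sub>L d k l) o\<^sub>L F l i)" using yF[OF i] K(5) by simp
    also have "\<dots> = (\<Sum>l\<in>I. \<Sum>k\<in>K. \<alpha> k o\<^sub>L (d k l o\<^sub>L F l i))" by (simp add: compose_sum_left compose_assoc)
    also have "\<dots> = (\<Sum>k\<in>K. \<alpha> k o\<^sub>L (\<Sum>l\<in>I. d k l o\<^sub>L F l i))"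
      unfolding compose_sum_right by (rule sum.swap)
    also have "\<dots> = 0" using dF i by simp
    finally show ?thesis .
  qed
  have "N.embeds I F (\<lambda>i. unit_map M (m' i))"
    unfolding N.embeds_def
  proof (intro conjI ballI allI impI)
    show "unit_map M (m' i) \<in> carrier (ind M)" if "i \<in> I" for i using unit_map_closed[OF M m'[OF that]] .
    show "y i = 0" if "\<forall>i\<in>I. y i \<in> A" "\<forall>j\<in>I. (\<Sum>i\<in>I. y i o\<^sub>L F i j) = y j"
      "lc (ind M) I y (\<lambda>i. unit_map M (m' i)) = \<zero>\<^bsub>ind M\<^esub>" "i \<in> I" for y i
      using inj[of y i] that by simp
  qed (rule proj_on_mono[OF F])
  then show ?thesis by blast
qed

lemma embeds_descend:
  assumes M: "left_module (op_ring B) M" and tr: "normal_vn_trace A tr"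
    and emb: "op_module.embeds A (ind M) {..<k::nat} q z"
  shows "\<exists>(n::nat) F m. op_module.embeds B M {..<n} F m \<and> ptrace tr {..<k} q \<le> ptrace tr {..<n} F"
proof -
  interpret M: op_module B M by (rule op_module_B[OF M])
  interpret N: op_module A "ind M" by (rule op_module_ind[OF M])
  interpret T: normal_vn_trace A tr by (rule tr)
  have "\<exists>(n::nat) y g. (\<forall>i<n. y i \<in> A \<and> g i \<in> carrier M) \<and> z r = lc (ind M) {..<n} y (\<lambda>i. unit_map M (g i))"
    if "r < k" for r using ind_element[OF M] N.embedsD(2)[OF emb] that by simp
  then obtain n :: "nat \<Rightarrow> nat" and w g where w: "\<And>r i. r < k \<Longrightarrow> i < n r \<Longrightarrow> w r i \<in> A"
    and g: "\<And>r i. r < k \<Longrightarrow> i < n r \<Longrightarrow> g r i \<in> carrier M"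
    and z: "\<And>r. r < k \<Longrightarrow> z r = lc (ind M) {..<n r} (w r) (\<lambda>i. unit_map M (g r i))" by metis
  \<comment> \<open>The elements of \<open>M\<close> that occur serve as their own index set;
    repetitions are merged by \<open>lc_regroup\<close>.\<close>
  define X where "X = (\<Union>r<k. g r ` {..<n r})"
  have X: "finite X" "X \<subseteq> carrier M" using g by (auto simp: X_def)
  define W where "W r x = (\<Sum>i<n r. w r i o\<^sub>L (if x = g r i then id_blinfun else 0))" for r x
  have WA: "W r x \<in> A" if "r < k" for r x
    unfolding W_def using w[OF that] by (intro A.sum_mem A.compose_mem) auto
  have zW: "z r = lc (ind M) X (W r) (unit_map M)" if r: "r < k" for r
  proof -
    have "g r i \<in> X" if "i < n r" for i using that r by (auto simp: X_def)
    then show ?thesis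
      unfolding W_def z[OF r] using w[OF r] X unit_map_closed[OF M]
      by (intro N.lc_regroup[symmetric]) auto
  qed
  define R where "R = {c. (\<forall>x\<in>X. c x \<in> B) \<and> lc M X c (\<lambda>x. x) = \<zero>\<^bsub>M\<^esub>}"
  \<comment> \<open>\<open>F\<close> kills the adjoint columns of all relations, so
    \<open>c F = 0\<close> for every relation \<open>c\<close>. A relation in the row space of
    \<open>F\<close> is therefore zero, which is the embedding into \<open>M\<close>.\<close>
  obtain F where F: "is_ann B X ((\<lambda>c x. op_adj (c x)) ` R) F"
    using ann_exists[OF B.vN X(1), of "(\<lambda>c x. op_adj (c x)) ` R"] by (auto simp: R_def B.closed)
  note PF = is_annD(1)[OF F]
  have le: "ptrace tr {..<k} q \<le> ptrace tr X F"
  proof (rule T.ptrace_le_ann[where W = W and R = R, OF _ X(1) N.embedsD(1)[OF emb]])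
    show "W r x \<in> A" if "r \<in> {..<k}" "x \<in> X" for r x using WA that by simp
    show "\<forall>c\<in>R. \<forall>x\<in>X. c x \<in> A" using subset by (auto simp: R_def)
    show "is_ann A X ((\<lambda>c x. op_adj (c x)) ` R) F" by (rule is_ann_mono[OF F])
    fix y L b assume L: "finite L" "L \<subseteq> R" and yA: "\<And>r. r \<in> {..<k} \<Longrightarrow> y r \<in> A" and b: "\<And>l. l \<in> L \<Longrightarrow> b l \<in> A"
      and yq: "\<And>r. r \<in> {..<k} \<Longrightarrow> (\<Sum>j<k. y j o\<^sub>L q j r) = y r"
      and eq: "\<And>x. x \<in> X \<Longrightarrow> (\<Sum>r<k. y r o\<^sub>L W r x) = (\<Sum>l\<in>L. b l o\<^sub>L l x)"
    \<comment> \<open>If \<open>y W\<close> is an \<open>A\<close>-combination of relations over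
      \<open>B\<close>, then the combination of the \<open>z r\<close> with coefficients
      \<open>y\<close> is zero, and \<open>y = 0\<close> because \<open>q\<close> embeds.\<close>
    have "lc (ind M) {..<k} y z = lc (ind M) {..<k} y (\<lambda>r. lc (ind M) X (W r) (unit_map M))"
      using yA WA X unit_map_closed[OF M] by (intro N.lc_cong) (auto simp: zW intro!: N.lc_closed)
    also have "\<dots> = lc (ind M) X (\<lambda>x. \<Sum>r<k. y r o\<^sub>L W r x) (unit_map M)"
      using yA WA X unit_map_closed[OF M] by (intro N.lc_compose[symmetric]) auto
    also have "\<dots> = \<zero>\<^bsub>ind M\<^esub>"
      using L b X eq by (intro lc_unit_map_zeroI[OF M, of X L b "\<lambda>l. l" "\<lambda>x. x"]) (auto simp: R_def)
    finally have y0: "lc (ind M) {..<k} y z = \<zero>\<^bsub>ind M\<^esub>" .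
    show "\<forall>r\<in>{..<k}. y r = 0" using N.embedsD(3)[OF emb yA yq y0] by blast
  qed simp
  \<comment> \<open>The dimension formula counts embeddings indexed by \<open>{..<n}\<close>, so
    \<open>X\<close> is enumerated.\<close>
  define n' where "n' = card X"
  obtain h where h: "bij_betw h {..<n'} X"
    using ex_bij_betw_nat_finite[OF X(1)] by (auto simp: n'_def atLeast0LessThan)
  have hX: "h i \<in> X" if "i < n'" for i using bij_betw_apply[OF h] that by simp
  have sumh: "(\<Sum>i<n'. f (h i)) = (\<Sum>x\<in>X. f x)" for f :: "_ \<Rightarrow> 'd::comm_monoid_add"
    by (rule sum.reindex_bij_betw[OF h])
  define F' where "F' i j = F (h i) (h j)" for i j
  have PF': "proj_on B {..<n'} F'"
    unfolding proj_on_def F'_def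
  proof (intro ballI conjI)
    fix i j assume "i \<in> {..<n'}" "j \<in> {..<n'}"
    then have ij: "h i \<in> X" "h j \<in> X" using hX by simp_all
    show "(\<Sum>k<n'. F (h i) (h k) o\<^sub>L F (h k) (h j)) = F (h i) (h j)"
      using sumh[of "\<lambda>x. F (h i) x o\<^sub>L F x (h j)"] proj_onD(2)[OF PF ij] by simp
  qed (use hX proj_onD(1,3)[OF PF] in auto)
  have "y i = 0" if yB: "\<And>i. i < n' \<Longrightarrow> y i \<in> B" and yF: "\<And>j. j < n' \<Longrightarrow> (\<Sum>i<n'. y i o\<^sub>L F' i j) = y j"
    and y0: "lc M {..<n'} y h = \<zero>\<^bsub>M\<^esub>" and i: "i < n'" for y i
  proof -
    define c where "c x = y (inv_into {..<n'} h x)" for x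
    have ch: "c (h i) = y i" if "i < n'" for i
      using bij_betw_inv_into_left[OF h] that by (simp add: c_def)
    have cB: "c x \<in> B" if "x \<in> X" for x
      using yB bij_betw_apply[OF bij_betw_inv_into[OF h] that] by (simp add: c_def)
    have "lc M X c (\<lambda>x. x) = lc M (h ` {..<n'}) c (\<lambda>x. x)" using h by (simp add: bij_betw_def)
    also have "\<dots> = lc M {..<n'} (\<lambda>i. c (h i)) h"
      unfolding lc_def using h hX cB X(2)
      by (intro M.M.finsum_reindex) (auto simp: bij_betw_def intro!: M.smult_mem)
    also have "\<dots> = lc M {..<n'} y h" using yB hX X(2) by (intro M.lc_cong) (auto simp: ch)
    finally have "c \<in> R" using cB y0 by (simp add: R_def)
    then have z: "(\<Sum>x\<in>X. F w x o\<^sub>L op_adj (c x)) = 0" if "w \<in> X" for w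
      using is_annD(2)[OF F imageI that] by simp
    \<comment> \<open>Self-adjointness of \<open>F\<close> turns the adjoint of \<open>F\<close>
      times the adjoint column of \<open>c\<close> into \<open>c F\<close>.\<close>
    have "op_adj (\<Sum>x\<in>X. F (h i) x o\<^sub>L op_adj (c x)) = (\<Sum>x\<in>X. c x o\<^sub>L F x (h i))"
      using hX[OF i] proj_onD(1,3)[OF PF] cB B.bounded
      by (simp add: op_adj_sum bounded_ops_compose op_adj_closed op_adj_compose op_adj_op_adj)
    then have "(\<Sum>x\<in>X. c x o\<^sub>L F x (h i)) = 0" using z[OF hX[OF i]] by simp
    then have "(\<Sum>j<n'. c (h j) o\<^sub>L F' j i) = 0" using sumh[of "\<lambda>x. c x o\<^sub>L F x (h i)"] by (simp add: F'_def)
    then show ?thesis using yF[OF i] ch by simp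
  qed
  then have "M.embeds {..<n'} F' h"
    unfolding M.embeds_def using PF' hX X(2) by auto
  moreover have "ptrace tr {..<n'} F' = ptrace tr X F"
    unfolding ptrace_def F'_def by (rule sumh)
  ultimately show ?thesis
    using le by (intro exI[of _ n'] exI[of _ F'] exI[of _ h]) simp
qed

theorem vn_dim_induced:
  assumes M: "left_module (op_ring B) M" and tr: "normal_vn_trace A tr"
    and trB: "is_trace B trB" "\<And>T. T \<in> B \<Longrightarrow> trB T = tr T"
  shows "vn_dim B trB M = vn_dim A tr (ind M)"
proof -
  interpret M: op_module B M by (rule op_module_B[OF M])
  interpret N: op_module A "ind M" by (rule op_module_ind[OF M])
  interpret T: normal_vn_trace A tr by (rule tr)
  have eq: "ptrace trB {..<n} F = ptrace tr {..<n} F" if "M.embeds {..<n} F m" for n :: nat and F m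
    unfolding ptrace_def using proj_onD(1)[OF M.embedsD(1)[OF that]] trB(2) by simp
  show ?thesis
    unfolding M.vn_dim_eq[OF trB(1)] N.vn_dim_eq[OF T.trace]
  proof (rule antisym; rule Sup_least)
    fix d assume "d \<in> {ereal (ptrace trB {..<n} F) |(n::nat) F. \<exists>m. M.embeds {..<n} F m}"
    then obtain n :: nat and F m where d: "M.embeds {..<n} F m" "d = ereal (ptrace trB {..<n} F)" by blast
    obtain m' where "N.embeds {..<n} F m'" using embeds_induced[OF M _ d(1)] by blast
    then show "d \<le> Sup {ereal (ptrace tr {..<n} F) |(n::nat) F. \<exists>m. N.embeds {..<n} F m}"
      unfolding d(2) eq[OF d(1)] by (intro Sup_upper CollectI exI[of _ n] exI[of _ F] exI[of _ m'] conjI refl)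
  next
    fix d assume "d \<in> {ereal (ptrace tr {..<n} F) |(n::nat) F. \<exists>m. N.embeds {..<n} F m}"
    then obtain k :: nat and q z where d: "N.embeds {..<k} q z" "d = ereal (ptrace tr {..<k} q)" by blast
    obtain n :: nat and F m where F: "M.embeds {..<n} F m" "ptrace tr {..<k} q \<le> ptrace tr {..<n} F"
      using embeds_descend[OF M tr d(1)] by blast
    have "ereal (ptrace tr {..<n} F) \<le> Sup {ereal (ptrace trB {..<n} F) |(n::nat) F. \<exists>m. M.embeds {..<n} F m}"
      unfolding eq[OF F(1), symmetric]
      by (intro Sup_upper CollectI exI[of _ n] exI[of _ F] exI[of _ m] conjI refl F(1))
    then show "d \<le> Sup {ereal (ptrace trB {..<n} F) |(n::nat) F. \<exists>m. M.embeds {..<n} F m}"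
      using F(2) d(2) by (meson ereal_less_eq(3) order_trans)
  qed
qed

end

theorem proposition7p1:
  fixes A B :: "('h::complex_hilbert) oper set"
    and trA trB :: "'h oper \<Rightarrow> complex"
  assumes "von_neumann_algebra A"
    and "normal_faithful_trace A trA"
    and "von_neumann_subalgebra B A"
    and "\<forall>T\<in>B. trB T = trA T"
  shows
    \<comment> \<open>induction is a functor from left B-modules to left A-modules\<close>
    "(\<forall>M :: ('h oper, 'm) module. left_module (op_ring B) M \<longrightarrow>
        left_module (op_ring A) (ind_obj A B M) \<and>
        (\<forall>X\<in>carrier (ind_obj A B M). ind_map A B M (\<lambda>x. x) X = X))
   \<and> (\<forall>(M :: ('h oper, 'm) module) (N :: ('h oper, 'n) module) f.
        left_module (op_ring B) M \<and> left_module (op_ring B) N \<and> f \<in> lmod_hom (op_ring B) M N \<longrightarrow>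
        ind_map A B N f \<in> lmod_hom (op_ring A) (ind_obj A B M) (ind_obj A B N))
   \<and> (\<forall>(L :: ('h oper, 'l) module) (M :: ('h oper, 'm) module) (N :: ('h oper, 'n) module) f g.
        left_module (op_ring B) L \<and> left_module (op_ring B) M \<and> left_module (op_ring B) N \<and>
        f \<in> lmod_hom (op_ring B) L M \<and> g \<in> lmod_hom (op_ring B) M N \<longrightarrow>
        (\<forall>X\<in>carrier (ind_obj A B L).
           ind_map A B N (g \<circ> f) X = ind_map A B N g (ind_map A B M f X)))
     \<comment> \<open>it is exact\<close>
   \<and> (\<forall>(L :: ('h oper, 'l) module) (M :: ('h oper, 'm) module) (N :: ('h oper, 'n) module) f g.
        left_module (op_ring B) L \<and> left_module (op_ring B) M \<and> left_module (op_ring B) N \<and> short_exact (op_ring B) L M N f g \<longrightarrow>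
        short_exact (op_ring A) (ind_obj A B L) (ind_obj A B M) (ind_obj A B N)
          (ind_map A B M f) (ind_map A B N g))
     \<comment> \<open>it is faithful\<close>
   \<and> (\<forall>(M :: ('h oper, 'm) module) (N :: ('h oper, 'n) module) f g.
        left_module (op_ring B) M \<and> left_module (op_ring B) N \<and> f \<in> lmod_hom (op_ring B) M N \<and> g \<in> lmod_hom (op_ring B) M N \<and>
        (\<forall>X\<in>carrier (ind_obj A B M). ind_map A B N f X = ind_map A B N g X)
        \<longrightarrow> (\<forall>x\<in>carrier M. f x = g x))
     \<comment> \<open>it preserves dimension\<close>
   \<and> (\<forall>M :: ('h oper, 'm) module. left_module (op_ring B) M \<longrightarrow>
        vn_dim B trB M = vn_dim A trA (ind_obj A B M))"
proof -
  have A: "von_neumann_algebra A" and B: "von_neumann_algebra B" and BA: "B \<subseteq> A"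
    using assms(1,3) by (simp_all add: von_neumann_subalgebra_def von_neumann_algebra_def)
  interpret vn_inclusion A B
    using A B BA by unfold_locales
  have tr: "normal_vn_trace A trA"
    using A assms(2) by unfold_locales (simp_all add: normal_faithful_trace_def)
  have trB: "is_trace B trB"
    unfolding is_trace_def
  proof (intro conjI ballI allI)
    have tA: "is_trace A trA" using assms(2) by (simp add: normal_faithful_trace_def)
    fix S T c assume ST: "S \<in> B" "T \<in> B"
    then have "S \<in> A" "T \<in> A" using BA by blast+
    note tA' = tA[unfolded is_trace_def] this
    show "trB (S + T) = trB S + trB T" using tA' ST by (simp add: assms(4) B.closed)
    show "trB (S o\<^sub>L T) = trB (T o\<^sub>L S)" using tA' ST assms(4) B.compose_mem by metis
  next
    fix T c assume T: "T \<in> B"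
    then have "T \<in> A" using BA by blast
    then show "trB (op_scaleC c T) = c * trB T" "trB (op_adj T o\<^sub>L T) \<in> \<real>\<^sub>\<ge>\<^sub>0"
      using assms(2,4) T B.closed B.scaleC_mem by (auto simp: normal_faithful_trace_def is_trace_def)
  qed
  have exact: "short_exact (op_ring A) (ind L) (ind M) (ind N) (ind_map A B M f) (ind_map A B N g)"
    if "left_module (op_ring B) L" "left_module (op_ring B) M" "left_module (op_ring B) N"
      "short_exact (op_ring B) L M N f g"
    for L :: "('h oper, 'l) module" and M :: "('h oper, 'm) module" and N :: "('h oper, 'n) module" and f g
    using that induced_right_exact[of L M N f g] induced_map_inj[of L M f]
      induced_map_hom[of L M f] induced_map_hom[of M N g]
    unfolding short_exact_def by simp
  show ?thesis
  proof (intro conjI allI impI ballI, goal_cases)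
    case (1 M) then show ?case by (rule left_module_induced)
  next
    case (2 M X) then show ?case by (rule induced_map_id)
  next
    case (3 M N f) then show ?case by (elim conjE) (rule induced_map_hom)
  next
    case (4 L M N f g X) then show ?case by (elim conjE) (rule induced_map_comp)
  next
    case (5 L M N f g) then show ?case by (elim conjE) (rule exact)
  next
    case (6 M N f g x)
    then have "\<And>X. X \<in> carrier (ind M) \<Longrightarrow> ind_map A B N f X = ind_map A B N g X" by blast
    with 6 show ?case by (elim conjE) (rule induced_map_faithful)
  next
    case (7 M)
    then show ?case using assms(4) by (intro vn_dim_induced[OF _ tr trB]) auto
  qed
qed

end
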